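(* Let $N>1$ and let $\mathcal H$ denote either $H^2(B_N)$ or $A^2_\alpha(B_N)$ with $\alpha>-1$. Suppose $\varphi$ and $\psi$ are parabolic linear-fractional self-maps of $B_N$ fixing $e_1=(1,0,\dots,0)$, so that $D_1\varphi_1(e_1)=1=D_1\psi_1(e_1)$. If $\varphi\neq\psi$, then $C_\varphi-C_\psi$ is not compact on $\mathcal H$.
   Context: $B_N$ is the open unit ball of $\mathbb C^N$ with inner product $\langle z,w\rangle=\sum z_j\overline{w_j}$. $H^2(B_N)$ is the space of analytic $f$ on $B_N$ with $\sup_{0<r<1}\int_{\partial B_N}|f(r\zeta)|^2d\sigma(\zeta)<\infty$ ($\sigma$ normalized surface measure); $A^2_\alpha(B_N)$ is the space of analytic $f$ with $\int_{B_N}|f|^2\frac{\Gamma(N+\alpha+1)}{\Gamma(N+1)\Gamma(\alpha+1)}(1-|z|^2)^\alpha d\nu<\infty$ ($\nu$ normalized volume measure). A linear-fractional self-map of $B_N$ is a map $\varphi(z)=\frac{Az+B}{\langle z,C\rangle+d}$ ($A$ an $N\times N$ matrix, $B,C\in\mathbb C^N$, $d\in\mathbb C$) analytic on $B_N$ with $\varphi(B_N)\subseteq B_N$; it is analytic on a neighborhood of $\overline{B_N}$. $C_\varphi f=f\circ\varphi$. $\varphi_1$ is the first coordinate function of $\varphi$ and $D_1$ is the partial derivative with respect to $z_1$. A parabolic linear-fractional self-map of $B_N$ fixing $e_1$ is a linear-fractional self-map $\tau$ of $B_N$ with $\tau(e_1)=e_1$ and $D_1\tau_1(e_1)=1$ that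 fixes no other point of $\overline{B_N}$. *)

theory Defs
  imports "HOL-Analysis.Analysis"
begin

type_synonym 'n cvec = "complex ^ 'n"

definition cinner :: "'n::finite cvec \<Rightarrow> 'n cvec \<Rightarrow> complex" where
  "cinner z w = (\<Sum>j\<in>UNIV. z $ j * cnj (w $ j))"

abbreviation unit_ball :: "'n::finite cvec set" where
  "unit_ball \<equiv> ball 0 1"

definition analytic_several :: "('n::finite cvec \<Rightarrow> complex) \<Rightarrow> 'n cvec set \<Rightarrow> bool" where
  "analytic_several f S \<longleftrightarrow> (\<forall>z\<in>S. \<exists>L. (f has_derivative L) (at z) \<and>
       (\<forall>(c::complex) v. L (c *s v) = c * L v))"

text \<open>Normalized surface measure on the sphere, realised as the cone measure:
  integral over the sphere of g = (1/vol(B)) * integral over B of g(z/|z|).\<close>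
definition sphere_nnint :: "('n::finite cvec \<Rightarrow> ennreal) \<Rightarrow> ennreal" where
  "sphere_nnint g = (\<integral>\<^sup>+ z\<in>unit_ball. g (sgn z) \<partial>lborel) / emeasure lborel (unit_ball :: 'n cvec set)"

definition H2_sqnorm :: "('n::finite cvec \<Rightarrow> complex) \<Rightarrow> ennreal" where
  "H2_sqnorm f = (SUP r\<in>{0<..<(1::real)}. sphere_nnint (\<lambda>\<zeta>. ennreal ((cmod (f (r *\<^sub>R \<zeta>)))\<^sup>2)))"

definition bergman_const :: "nat \<Rightarrow> real \<Rightarrow> real" where
  "bergman_const N \<alpha> = Gamma (real N + \<alpha> + 1) / (Gamma (real N + 1) * Gamma (\<alpha> + 1))"

definition A2_sqnorm :: "real \<Rightarrow> ('n::finite cvec \<Rightarrow> complex) \<Rightarrow> ennreal" where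
  "A2_sqnorm \<alpha> f = (\<integral>\<^sup>+ z\<in>unit_ball. ennreal ((cmod (f z))\<^sup>2 *
        bergman_const CARD('n) \<alpha> * (1 - (norm z)\<^sup>2) powr \<alpha>) \<partial>lborel)
      / emeasure lborel (unit_ball :: 'n cvec set)"

definition fspace :: "(('n::finite cvec \<Rightarrow> complex) \<Rightarrow> ennreal) \<Rightarrow> ('n cvec \<Rightarrow> complex) set" where
  "fspace Nsq = {f. analytic_several f unit_ball \<and> Nsq f < top}"

definition compact_op :: "(('n::finite cvec \<Rightarrow> complex) \<Rightarrow> ennreal) \<Rightarrow>
    (('n cvec \<Rightarrow> complex) \<Rightarrow> ('n cvec \<Rightarrow> complex)) \<Rightarrow> bool" where
  "compact_op Nsq T \<longleftrightarrow> (\<forall>fs::nat \<Rightarrow> ('n cvec \<Rightarrow> complex). (\<forall>k. fs k \<in> fspace Nsq) \<and> (\<exists>M::ennreal. M < top \<and> (\<forall>k. Nsq (fs k) \<le> M)) \<longrightarrow>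
      (\<exists>r g. strict_mono r \<and> g \<in> fspace Nsq \<and> ((\<lambda>j. Nsq (T (fs (r j)) - g)) \<longlongrightarrow> 0) sequentially))"

definition lf_selfmap :: "('n::finite cvec \<Rightarrow> 'n cvec) \<Rightarrow> bool" where
  "lf_selfmap \<phi> \<longleftrightarrow> (\<exists>(A::complex^'n^'n) (B::'n cvec) (C::'n cvec) (d::complex).
      (\<forall>z. \<phi> z = (1 / (cinner z C + d)) *s (A *v z + B)) \<and>
      (\<forall>z\<in>unit_ball. cinner z C + d \<noteq> 0) \<and>
      \<phi> ` unit_ball \<subseteq> unit_ball)"

definition parabolic_lf_fixing :: "'n::finite \<Rightarrow> ('n cvec \<Rightarrow> 'n cvec) \<Rightarrow> bool" where
  "parabolic_lf_fixing k \<tau> \<longleftrightarrow> lf_selfmap \<tau> \<and> \<tau> (axis k 1) = axis k 1 \<and>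
     ((\<lambda>t. \<tau> (axis k 1 + t *s axis k 1) $ k) has_field_derivative 1) (at 0) \<and>
     (\<forall>z\<in>cball 0 1. \<tau> z = z \<longrightarrow> z = axis k 1)"

end

theory Submission
  imports Defs
begin

text \<open>
  In the Siegel coordinates \<open>w = 1 / (1 - z\<^sub>1)\<close>, \<open>u = z' / (1 - z\<^sub>1)\<close> every parabolic linear-fractional
  self-map fixing \<open>e\<^sub>1\<close> has the form \<open>(w, u) \<mapsto> (w + L u, G u)\<close> with affine \<open>L\<close> and \<open>G\<close>, so \<open>\<phi> \<noteq> \<psi>\<close> means
  that \<open>L\<close> or \<open>G\<close> differ. Let \<open>t \<rightarrow> 0\<close> and consider the region of size \<open>t\<^sup>2\<close> in the direction \<open>z\<^sub>1\<close> and
  \<open>t\<close> in the others around the point \<open>(1 + i t) e\<^sub>1\<close>; it approaches \<open>e\<^sub>1\<close> tangentially. There \<open>w - i / t\<close>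
  and \<open>u\<close> stay bounded, so the two maps remain apart on the scale of the region. Powers of
  \<open>E = 1 / (1 - (i / t) (1 - z\<^sub>1))\<close>, possibly times \<open>E z\<^sub>j\<close>, normalised by \<open>t\<^sup>m\<^sup>-\<^sup>s\<close> (\<open>s = N\<close> for \<open>H\<^sup>2\<close>,
  \<open>s = N + 1 + \<alpha>\<close> for \<open>A\<^sup>2\<^sub>\<alpha>\<close>), form a bounded family tending to \<open>0\<close> pointwise, whereas the norm of
  their images under \<open>C\<^sub>\<phi> - C\<^sub>\<psi>\<close> is bounded below by the contribution of the region. By Fatou's lemma
  a norm limit of a subsequence of the images would have to be \<open>0\<close>.
\<close>

section \<open>Integration in parabolic and polar coordinates\<close>

text \<open>In Siegel coordinates the ball is the domain \<open>2 Re w > 1 + |u|^2\<close>.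
  Translating \<open>w\<close> by \<open>i / t\<close> is an automorphism of it, and it commutes
  with both maps because \<open>L\<close> and \<open>G\<close> depend on \<open>u\<close> alone. Up
  to an error vanishing with \<open>t\<close>, the regions are translates of one fixed
  neighbourhood, so the gap between the two maps does not shrink along them. This is why the
  approach is tangential: along the radius \<open>Re w\<close> tends to infinity, and a bounded
  shift of \<open>w\<close> becomes invisible on the hyperbolic scale. In these coordinates
  \<open>E = w / (w - i / t)\<close>, with its pole at \<open>z_1 = 1 + i t\<close>, at distance
  comparable with \<open>t^2\<close> from the ball, and \<open>E z_j = u_j / (w - i / t)\<close>.
  Powers of \<open>E\<close> detect a difference of \<open>L\<close>; the factor
  \<open>E z_j\<close> is needed when only \<open>G\<close> differs. The Hardy norm is a supremum
  over spheres and not a volume integral; its lower bound comes from averaging over a shell of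
  thickness of order \<open>t^2\<close> that contains the region.\<close>

lemma borel_measurable_vec_nth [measurable]: "(\<lambda>z::'n::finite cvec. z $ k) \<in> borel_measurable borel"
  by (intro borel_measurable_continuous_onI continuous_intros)

lemma borel_measurable_sgn [measurable]: "(sgn :: 'a::euclidean_space \<Rightarrow> 'a) \<in> borel_measurable borel"
  unfolding sgn_div_norm[abs_def] by measurable

lemma ball_borel [measurable]: "ball (c::'a::metric_space) r \<in> sets borel"
  by simp

text \<open>The dilation adapted to the boundary: near a boundary point of the \<open>k\<close>-th
  axis \<open>1 - |z|^2\<close> is linear in coordinate \<open>k\<close> and quadratic in the
  others, so the weights 2 and 1 make both contributions equally large.\<close>

definition parabolic_dil :: "'n::finite \<Rightarrow> real \<Rightarrow> 'n cvec \<Rightarrow> 'n cvec" where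
  "parabolic_dil k s v = (\<chi> j. if j = k then s\<^sup>2 *\<^sub>R v $ j else s *\<^sub>R v $ j)"

text \<open>The factor is the real Jacobian: the two real directions of coordinate \<open>k\<close>
  contribute \<open>s^4\<close>, the remaining \<open>2 N - 2\<close> directions \<open>s\<close>
  each.\<close>

lemma nn_integral_parabolic_dil:
  fixes F :: "'n::finite cvec \<Rightarrow> ennreal"
  assumes [measurable]: "F \<in> borel_measurable borel" and s: "s > 0"
  shows "(\<integral>\<^sup>+z. F z \<partial>lborel)
    = ennreal (s ^ (2 * CARD('n) + 2)) * (\<integral>\<^sup>+v. F (p + parabolic_dil k s v) \<partial>lborel)"
proof -
  define A where "A = axis k ` (Basis :: complex set)"
  define c where "c b = s * (if b \<in> A then s else 1)" for b :: "'n cvec"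
  have A: "A \<subseteq> Basis" unfolding A_def Basis_vec_def by auto
  have "inj_on (axis k) (Basis :: complex set)"
    by (auto simp: inj_on_def axis_eq_axis)
  then have cardA: "card A = 2" unfolding A_def by (simp add: card_image)
  have inA: "axis i e \<in> A \<longleftrightarrow> i = k" if "e \<in> Basis" for i e
    using that by (auto simp: A_def axis_eq_axis nonzero_Basis)
  have T: "p + parabolic_dil k s v = p + (\<Sum>b\<in>Basis. (c b * (v \<bullet> b)) *\<^sub>R b)" for v
  proof -
    have "parabolic_dil k s v \<bullet> b = (\<Sum>b\<in>Basis. (c b * (v \<bullet> b)) *\<^sub>R b) \<bullet> b" if b: "b \<in> Basis" for b
    proof -
      obtain i e where be: "b = axis i e" "e \<in> Basis"
        using b unfolding Basis_vec_def by auto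
      have "parabolic_dil k s v \<bullet> b = c b * (v \<bullet> b)"
        using inA[OF be(2), of i] unfolding be(1)
        by (simp add: inner_axis c_def parabolic_dil_def power2_eq_square)
      also have "\<dots> = (\<Sum>b'\<in>Basis. (c b' * (v \<bullet> b')) *\<^sub>R b') \<bullet> b"
        using b by (simp only: inner_sum_left_Basis)
      finally show ?thesis .
    qed
    then have "parabolic_dil k s v = (\<Sum>b\<in>Basis. (c b * (v \<bullet> b)) *\<^sub>R b)"
      by (rule euclidean_eqI)
    then show ?thesis by simp
  qed
  have "(\<Prod>b\<in>Basis. \<bar>c b\<bar>) = (\<Prod>b\<in>(Basis::'n cvec set). s * (if b \<in> A then s else 1))"
    using s by (intro prod.cong) (auto simp: c_def)
  also have "\<dots> = s ^ DIM('n cvec) * (\<Prod>b\<in>(Basis::'n cvec set). (if b \<in> A then s else 1))"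
    by (simp add: prod.distrib)
  also have "(\<Prod>b\<in>(Basis::'n cvec set). (if b \<in> A then s else 1)) = s ^ 2"
    using A cardA by (simp add: prod.If_cases Int_absorb1)
  finally have P: "(\<Prod>b\<in>(Basis::'n cvec set). \<bar>c b\<bar>) = s ^ (2 * CARD('n) + 2)"
    by (simp add: power_add mult.commute power2_eq_square)
  have c0: "\<And>b. b \<in> Basis \<Longrightarrow> c b \<noteq> 0" using s by (auto simp: c_def)
  have "(\<integral>\<^sup>+z. F z \<partial>lborel) = (\<integral>\<^sup>+z. F z \<partial>density (distr lborel borel
     (\<lambda>x. p + (\<Sum>j\<in>Basis. (c j * (x \<bullet> j)) *\<^sub>R j))) (\<lambda>_. ennreal (\<Prod>j\<in>Basis. \<bar>c j\<bar>)))"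
    using lborel_affine_euclidean[of c p, OF c0] by simp
  also have "\<dots> = ennreal (s ^ (2 * CARD('n) + 2)) *
      (\<integral>\<^sup>+x. F (p + (\<Sum>j\<in>Basis. (c j * (x \<bullet> j)) *\<^sub>R j)) \<partial>lborel)"
    unfolding P by (simp add: nn_integral_density nn_integral_distr nn_integral_cmult)
  finally show ?thesis unfolding T .
qed

section \<open>Polar coordinates\<close>

lemma nn_integral_tail_power:
  fixes a :: real and n :: nat
  assumes "a > 0" "n > 0"
  shows "(\<integral>\<^sup>+x. ennreal (1 / x ^ Suc n) * indicator {a..} x \<partial>lborel) = ennreal (1 / (real n * a ^ n))"
proof -
  have "((\<lambda>x::real. 1 / x ^ n) \<longlongrightarrow> 0) at_top"
    by (rule tendsto_divide_0[OF tendsto_const filterlim_at_top_imp_at_infinity])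
       (use assms in \<open>auto intro!: filterlim_pow_at_top filterlim_ident\<close>)
  then have "((\<lambda>x::real. - ((1 / x ^ n) / real n)) \<longlongrightarrow> - (0 / real n)) at_top"
    using assms by (intro tendsto_intros) auto
  then have lim: "((\<lambda>x::real. - (1 / (real n * x ^ n))) \<longlongrightarrow> 0) at_top"
    by (simp add: mult.commute)
  have der: "DERIV (\<lambda>x. - (1 / (real n * x ^ n))) x :> 1 / x ^ Suc n" if "a \<le> x" for x
  proof -
    have "x > 0" using that assms by simp
    have "x ^ n = x * x ^ (n - 1)" using assms(2) by (metis Suc_diff_1 power_Suc)
    then have eq: "real n * (real n * x ^ (n - 1)) / (real n * x ^ n * (real n * x ^ n)) = 1 / x ^ Suc n"
      using \<open>x > 0\<close> assms(2) by (simp add: field_simps)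
    have "((\<lambda>x. real n * x ^ n) has_real_derivative real n * (real n * x ^ (n - 1))) (at x)"
      by (intro DERIV_cmult) (metis DERIV_pow One_nat_def)
    then have "((\<lambda>x. inverse (real n * x ^ n)) has_real_derivative
        - (real n * (real n * x ^ (n - 1)) * inverse ((real n * x ^ n) ^ Suc (Suc 0)))) (at x)"
      using \<open>x > 0\<close> assms(2) by (intro DERIV_inverse_fun) auto
    from DERIV_minus[OF this] show ?thesis
      unfolding eq[symmetric] by (simp add: inverse_eq_divide mult.assoc)
  qed
  have "(\<integral>\<^sup>+x. ennreal (1 / x ^ Suc n) * indicator {a..} x \<partial>lborel)
      = ennreal (0 - (- (1 / (real n * a ^ n))))"
    by (rule nn_integral_FTC_atLeast[OF _ der _ lim]) (use assms in auto)
  then show ?thesis by simp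
qed

lemma nn_integral_lborel_scale:
  fixes F :: "'a::euclidean_space \<Rightarrow> ennreal"
  assumes [measurable]: "F \<in> borel_measurable borel" and c: "c > 0"
  shows "(\<integral>\<^sup>+x. F x \<partial>lborel) = ennreal (c ^ DIM('a)) * (\<integral>\<^sup>+x. F (c *\<^sub>R x) \<partial>lborel)"
  using c by (subst lborel_affine[of c 0]) (auto simp: nn_integral_density nn_integral_distr nn_integral_cmult)

text \<open>Substitute
  \<open>\<rho> = \<lambda> * norm x\<close>, exchange the integrals, substitute \<open>y = \<lambda> x\<close>,
  and integrate out \<open>\<lambda>\<close>.\<close>

lemma nn_integral_polar:
  fixes F :: "'a::euclidean_space \<Rightarrow> ennreal"
  assumes [measurable]: "F \<in> borel_measurable borel"
  shows "(\<integral>\<^sup>+y. F y \<partial>lborel) = (\<integral>\<^sup>+\<rho>. ennreal (real DIM('a) * \<rho> ^ (DIM('a) - 1)) * indicator {0<..} \<rho> *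
      (\<integral>\<^sup>+x. F (\<rho> *\<^sub>R sgn x) * indicator (ball 0 1) x \<partial>lborel) \<partial>lborel)"
proof -
  define n where "n = DIM('a)"
  have n: "n > 0" "n - 1 + 1 = n" unfolding n_def by (auto simp: Suc_leI)
  have inner: "(\<integral>\<^sup>+\<rho>. ennreal (\<rho> ^ (n-1)) * indicator {0<..} \<rho> * F (\<rho> *\<^sub>R sgn x) \<partial>lborel)
     = (\<integral>\<^sup>+l. ennreal (l ^ (n-1) * norm x ^ n) * indicator {0<..} l * F (l *\<^sub>R x) \<partial>lborel)" if x: "x \<noteq> 0" for x :: 'a
  proof -
    have "(\<integral>\<^sup>+\<rho>. ennreal (\<rho> ^ (n-1)) * indicator {0<..} \<rho> * F (\<rho> *\<^sub>R sgn x) \<partial>lborel)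
      = ennreal \<bar>norm x\<bar> * (\<integral>\<^sup>+l. ennreal ((0 + norm x * l) ^ (n-1)) * indicator {0<..} (0 + norm x * l) * F ((0 + norm x * l) *\<^sub>R sgn x) \<partial>lborel)"
      using x by (intro nn_integral_real_affine) auto
    also have "\<dots> = (\<integral>\<^sup>+l. ennreal \<bar>norm x\<bar> * (ennreal ((0 + norm x * l) ^ (n-1)) * indicator {0<..} (0 + norm x * l) * F ((0 + norm x * l) *\<^sub>R sgn x)) \<partial>lborel)"
      by (rule nn_integral_cmult[symmetric]) auto
    also have "\<dots> = (\<integral>\<^sup>+l. ennreal (l ^ (n-1) * norm x ^ n) * indicator {0<..} l * F (l *\<^sub>R x) \<partial>lborel)"
    proof (intro nn_integral_cong)
      fix l :: real
      have "norm x ^ n = norm x * norm x ^ (n-1)" using n(2) by (metis power_Suc Suc_eq_plus1)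
      then have a: "l ^ (n-1) * norm x ^ n = norm x * (norm x * l) ^ (n-1)"
        by (simp add: power_mult_distrib mult_ac)
      have b: "(norm x * l) *\<^sub>R sgn x = l *\<^sub>R x" using x by (simp add: sgn_div_norm)
      have c: "indicator {0<..} (norm x * l) = (indicator {0<..} l :: ennreal)"
        using x by (auto simp: indicator_def zero_less_mult_iff)
      show "ennreal \<bar>norm x\<bar> * (ennreal ((0 + norm x * l) ^ (n-1)) * indicator {0<..} (0 + norm x * l) * F ((0 + norm x * l) *\<^sub>R sgn x))
         = ennreal (l ^ (n-1) * norm x ^ n) * indicator {0<..} l * F (l *\<^sub>R x)"
      proof (cases "l > 0")
        case True
        then show ?thesis unfolding a using x
          by (simp add: b c ennreal_mult mult.assoc)
      qed (simp add: c)
    qed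
    finally show ?thesis .
  qed
  have lam: "(\<integral>\<^sup>+x. ennreal (l ^ (n-1) * norm x ^ n) * F (l *\<^sub>R x) * indicator (ball 0 1) x \<partial>lborel)
     = (\<integral>\<^sup>+y. ennreal (norm y ^ n / l ^ (n+1)) * F y * indicator {norm y<..} l \<partial>lborel)" if l: "l > 0" for l
  proof -
    have "(\<integral>\<^sup>+y. ennreal (norm y ^ n / l ^ (n+1)) * F y * indicator (ball 0 l) y \<partial>lborel)
       = ennreal (l ^ n) * (\<integral>\<^sup>+x. ennreal (norm (l *\<^sub>R x) ^ n / l ^ (n+1)) * F (l *\<^sub>R x) * indicator (ball 0 l) (l *\<^sub>R x) \<partial>lborel)"
      unfolding n_def by (rule nn_integral_lborel_scale[OF _ l]) measurable
    also have "\<dots> = (\<integral>\<^sup>+x. ennreal (l ^ n) * (ennreal (norm (l *\<^sub>R x) ^ n / l ^ (n+1)) * F (l *\<^sub>R x) * indicator (ball 0 l) (l *\<^sub>R x)) \<partial>lborel)"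
      by (rule nn_integral_cmult[symmetric]) auto
    also have "\<dots> = (\<integral>\<^sup>+x. ennreal (l ^ (n-1) * norm x ^ n) * F (l *\<^sub>R x) * indicator (ball 0 1) x \<partial>lborel)"
    proof (intro nn_integral_cong)
      fix x :: 'a
      have "l ^ n * (norm (l *\<^sub>R x) ^ n / l ^ (n+1)) = l ^ (n-1) * norm x ^ n"
      proof -
        have "l ^ n = l * l ^ (n-1)" using n(2) by (metis power_Suc Suc_eq_plus1)
        then show ?thesis using l by (simp add: power_mult_distrib field_simps)
      qed
      then have a: "ennreal (l ^ n) * ennreal (norm (l *\<^sub>R x) ^ n / l ^ (n+1)) = ennreal (l ^ (n-1) * norm x ^ n)"
        using l by (simp add: ennreal_mult[symmetric])
      have c: "indicator (ball 0 l) (l *\<^sub>R x) = (indicator (ball 0 1) x :: ennreal)"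
        using l by (auto simp: indicator_def)
      show "ennreal (l ^ n) * (ennreal (norm (l *\<^sub>R x) ^ n / l ^ (n+1)) * F (l *\<^sub>R x) * indicator (ball 0 l) (l *\<^sub>R x))
        = ennreal (l ^ (n-1) * norm x ^ n) * F (l *\<^sub>R x) * indicator (ball 0 1) x"
        unfolding a[symmetric] c by (simp only: mult_ac)
    qed
    finally have "(\<integral>\<^sup>+x. ennreal (l ^ (n-1) * norm x ^ n) * F (l *\<^sub>R x) * indicator (ball 0 1) x \<partial>lborel)
      = (\<integral>\<^sup>+y. ennreal (norm y ^ n / l ^ (n+1)) * F y * indicator (ball 0 l) y \<partial>lborel)" by simp
    also have "\<dots> = (\<integral>\<^sup>+y. ennreal (norm y ^ n / l ^ (n+1)) * F y * indicator {norm y<..} l \<partial>lborel)"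
      by (intro nn_integral_cong) (auto simp: indicator_def)
    finally show ?thesis .
  qed
  \<comment> \<open>The integral over \<open>l\<close> of \<open>norm y ^ n / l ^ (n + 1)\<close>
    from \<open>norm y\<close> on is \<open>1 / n\<close> whatever \<open>y\<close> is; the factor
    \<open>DIM('a)\<close> of the formula cancels it. The point \<open>l = norm y\<close> is null,
    so open and closed half-lines agree.\<close>
  have last: "(\<integral>\<^sup>+l. ennreal (norm y ^ n / l ^ (n+1)) * F y * indicator {norm y<..} l * indicator {0<..} l \<partial>lborel)
     = ennreal (1 / real n) * F y" if y: "y \<noteq> 0" for y :: 'a
  proof -
    have "(\<integral>\<^sup>+l. ennreal (norm y ^ n / l ^ (n+1)) * F y * indicator {norm y<..} l * indicator {0<..} l \<partial>lborel)
      = (\<integral>\<^sup>+l. (ennreal (norm y ^ n) * F y) * (ennreal (1 / l ^ Suc n) * indicator {norm y..} l) \<partial>lborel)"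
    proof (intro nn_integral_cong_AE)
      have "AE l in lborel. l \<noteq> norm y" by (rule AE_lborel_singleton)
      then show "AE l in lborel. ennreal (norm y ^ n / l ^ (n+1)) * F y * indicator {norm y<..} l * indicator {0<..} l
          = (ennreal (norm y ^ n) * F y) * (ennreal (1 / l ^ Suc n) * indicator {norm y..} l)"
      proof eventually_elim
        fix l assume ne: "l \<noteq> norm y"
        show "ennreal (norm y ^ n / l ^ (n+1)) * F y * indicator {norm y<..} l * indicator {0<..} l
          = (ennreal (norm y ^ n) * F y) * (ennreal (1 / l ^ Suc n) * indicator {norm y..} l)"
        proof (cases "norm y < l")
          case True
          then have l: "l > 0" using norm_ge_zero[of y] by linarith
          have "ennreal (norm y ^ n / l ^ (n+1)) = ennreal (norm y ^ n) * ennreal (1 / l ^ Suc n)"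
            using l by (subst ennreal_mult[symmetric]) auto
          then show ?thesis using True l by (simp add: mult_ac)
        next
          case False
          then show ?thesis using ne by (simp add: indicator_def)
        qed
      qed
    qed
    also have "\<dots> = (ennreal (norm y ^ n) * F y) * ennreal (1 / (real n * norm y ^ n))"
      using y n nn_integral_tail_power[of "norm y" n]
      by (subst nn_integral_cmult) (auto simp del: power_Suc)
    also have "\<dots> = ennreal (1 / real n) * F y"
    proof -
      have "ennreal (norm y ^ n) * ennreal (1 / (real n * norm y ^ n)) = ennreal (1 / real n)"
        using y by (subst ennreal_mult[symmetric]) auto
      then show ?thesis by (metis mult.assoc mult.commute)
    qed
    finally show ?thesis .
  qed
  have "(\<integral>\<^sup>+\<rho>. ennreal (\<rho> ^ (n - 1)) * indicator {0<..} \<rho> *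
      (\<integral>\<^sup>+x. F (\<rho> *\<^sub>R sgn x) * indicator (ball 0 1) x \<partial>lborel) \<partial>lborel)
    = (\<integral>\<^sup>+\<rho>. (\<integral>\<^sup>+x. ennreal (\<rho> ^ (n - 1)) * indicator {0<..} \<rho> * F (\<rho> *\<^sub>R sgn x) * indicator (ball 0 1) x \<partial>lborel) \<partial>lborel)"
    by (intro nn_integral_cong) (simp add: nn_integral_cmult[symmetric] mult.assoc)
  also have "\<dots> = (\<integral>\<^sup>+x. (\<integral>\<^sup>+\<rho>. ennreal (\<rho> ^ (n - 1)) * indicator {0<..} \<rho> * F (\<rho> *\<^sub>R sgn x) * indicator (ball 0 1) x \<partial>lborel) \<partial>lborel)"
    by (rule lborel_pair.Fubini') measurable
  also have "\<dots> = (\<integral>\<^sup>+x. (\<integral>\<^sup>+\<rho>. ennreal (\<rho> ^ (n - 1)) * indicator {0<..} \<rho> * F (\<rho> *\<^sub>R sgn x) \<partial>lborel) * indicator (ball 0 1) x \<partial>lborel)"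
    by (intro nn_integral_cong) (simp add: nn_integral_multc)
  also have "\<dots> = (\<integral>\<^sup>+x. (\<integral>\<^sup>+l. ennreal (l ^ (n-1) * norm x ^ n) * indicator {0<..} l * F (l *\<^sub>R x) \<partial>lborel) * indicator (ball 0 1) x \<partial>lborel)"
  proof (intro nn_integral_cong_AE)
    have "AE x in lborel. x \<noteq> (0::'a)" by (rule AE_lborel_singleton)
    then show "AE x in lborel. (\<integral>\<^sup>+\<rho>. ennreal (\<rho> ^ (n - 1)) * indicator {0<..} \<rho> * F (\<rho> *\<^sub>R sgn x) \<partial>lborel) * indicator (ball 0 1) x
      = (\<integral>\<^sup>+l. ennreal (l ^ (n-1) * norm x ^ n) * indicator {0<..} l * F (l *\<^sub>R x) \<partial>lborel) * indicator (ball 0 1) x"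
      by eventually_elim (drule inner, simp only:)
  qed
  also have "\<dots> = (\<integral>\<^sup>+x. (\<integral>\<^sup>+l. ennreal (l ^ (n-1) * norm x ^ n) * indicator {0<..} l * F (l *\<^sub>R x) * indicator (ball 0 1) x \<partial>lborel) \<partial>lborel)"
    by (intro nn_integral_cong) (simp add: nn_integral_multc)
  also have "\<dots> = (\<integral>\<^sup>+l. (\<integral>\<^sup>+x. ennreal (l ^ (n-1) * norm x ^ n) * indicator {0<..} l * F (l *\<^sub>R x) * indicator (ball 0 1) x \<partial>lborel) \<partial>lborel)"
    by (rule lborel_pair.Fubini') measurable
  also have "\<dots> = (\<integral>\<^sup>+l. (\<integral>\<^sup>+y. ennreal (norm y ^ n / l ^ (n+1)) * F y * indicator {norm y<..} l * indicator {0<..} l \<partial>lborel) \<partial>lborel)"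
  proof (rule nn_integral_cong)
    fix l :: real
    show "(\<integral>\<^sup>+x. ennreal (l ^ (n-1) * norm x ^ n) * indicator {0<..} l * F (l *\<^sub>R x) * indicator (ball 0 1) x \<partial>lborel)
      = (\<integral>\<^sup>+y. ennreal (norm y ^ n / l ^ (n+1)) * F y * indicator {norm y<..} l * indicator {0<..} l \<partial>lborel)"
      using lam[of l] by (cases "l > 0") (simp_all del: One_nat_def)
  qed
  also have "\<dots> = (\<integral>\<^sup>+y. (\<integral>\<^sup>+l. ennreal (norm y ^ n / l ^ (n+1)) * F y * indicator {norm y<..} l * indicator {0<..} l \<partial>lborel) \<partial>lborel)"
  proof (rule lborel_pair.Fubini')
    have [measurable]: "Measurable.pred (borel \<Otimes>\<^sub>M borel) (\<lambda>p. norm (fst p :: 'a) < (snd p :: real))"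
      by measurable
    have "(\<lambda>(y::'a, l::real). indicator {norm y<..} l :: ennreal) = (\<lambda>p. if norm (fst p) < snd p then 1 else 0)"
      by (auto simp: fun_eq_iff indicator_def)
    then have [measurable]: "(\<lambda>(y::'a, l::real). indicator {norm y<..} l :: ennreal) \<in> borel_measurable (borel \<Otimes>\<^sub>M borel)"
      by simp
    show "(\<lambda>(y, l). ennreal (norm y ^ n / l ^ (n+1)) * F y * indicator {norm y<..} l * indicator {0<..} l)
       \<in> borel_measurable (lborel \<Otimes>\<^sub>M lborel)" by measurable
  qed
  also have "\<dots> = (\<integral>\<^sup>+y. ennreal (1 / real n) * F y \<partial>lborel)"
  proof (intro nn_integral_cong_AE)
    have "AE x in lborel. x \<noteq> (0::'a)" by (rule AE_lborel_singleton)
    then show "AE y in lborel. (\<integral>\<^sup>+l. ennreal (norm y ^ n / l ^ (n+1)) * F y * indicator {norm y<..} l * indicator {0<..} l \<partial>lborel)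
      = ennreal (1 / real n) * F y"
      by eventually_elim (rule last)
  qed
  also have "\<dots> = ennreal (1 / real n) * (\<integral>\<^sup>+y. F y \<partial>lborel)"
    by (simp add: nn_integral_cmult)
  finally have main: "(\<integral>\<^sup>+\<rho>. ennreal (\<rho> ^ (n - 1)) * indicator {0<..} \<rho> *
      (\<integral>\<^sup>+x. F (\<rho> *\<^sub>R sgn x) * indicator (ball 0 1) x \<partial>lborel) \<partial>lborel) = ennreal (1 / real n) * (\<integral>\<^sup>+y. F y \<partial>lborel)" .
  have "ennreal (real n) * ennreal (1 / real n) = 1"
    using n by (subst ennreal_mult[symmetric]) auto
  then have "(\<integral>\<^sup>+y. F y \<partial>lborel) = ennreal (real n) * (ennreal (1 / real n) * (\<integral>\<^sup>+y. F y \<partial>lborel))"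
    by (simp add: mult.assoc[symmetric])
  also have "\<dots> = ennreal (real n) * (\<integral>\<^sup>+\<rho>. ennreal (\<rho> ^ (n - 1)) * indicator {0<..} \<rho> *
      (\<integral>\<^sup>+x. F (\<rho> *\<^sub>R sgn x) * indicator (ball 0 1) x \<partial>lborel) \<partial>lborel)"
    by (simp only: main)
  also have "\<dots> = (\<integral>\<^sup>+\<rho>. ennreal (real n) * (ennreal (\<rho> ^ (n - 1)) * indicator {0<..} \<rho> *
      (\<integral>\<^sup>+x. F (\<rho> *\<^sub>R sgn x) * indicator (ball 0 1) x \<partial>lborel)) \<partial>lborel)"
    by (rule nn_integral_cmult[symmetric]) measurable
  also have "\<dots> = (\<integral>\<^sup>+\<rho>. ennreal (real n * \<rho> ^ (n - 1)) * indicator {0<..} \<rho> *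
      (\<integral>\<^sup>+x. F (\<rho> *\<^sub>R sgn x) * indicator (ball 0 1) x \<partial>lborel) \<partial>lborel)"
    by (intro nn_integral_cong) (auto simp: ennreal_mult mult_ac indicator_def)
  finally show ?thesis unfolding n_def .
qed

section \<open>Kernel estimates\<close>

text \<open>In polar coordinates the radial integrand is a constant times
  \<open>\<rho>^(n - 1) / (1 + \<rho>)^p\<close>. As \<open>p\<close> is an integer above the real
  dimension \<open>n\<close>, this is at most \<open>1 / (1 + \<rho>)^2\<close>, which is
  integrable.\<close>

lemma nn_integral_inverse_power_norm_finite:
  assumes p: "p > DIM('a)"
  shows "(\<integral>\<^sup>+x. ennreal (1 / (1 + norm (x::'a::euclidean_space)) ^ p) \<partial>lborel) < \<infinity>"
proof -
  define n where "n = DIM('a)"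
  define V where "V = emeasure lborel (ball (0::'a) 1)"
  have V: "V < \<infinity>" unfolding V_def by (rule emeasure_bounded_finite) simp
  have inner: "(\<integral>\<^sup>+x. ennreal (1 / (1 + norm (\<rho> *\<^sub>R sgn (x::'a))) ^ p) * indicator (ball 0 1) x \<partial>lborel)
      = ennreal (1 / (1 + \<rho>) ^ p) * V" if "\<rho> > 0" for \<rho>
  proof -
    have "AE x in lborel. x \<noteq> (0::'a)" by (rule AE_lborel_singleton)
    then have "(\<integral>\<^sup>+x. ennreal (1 / (1 + norm (\<rho> *\<^sub>R sgn (x::'a))) ^ p) * indicator (ball 0 1) x \<partial>lborel)
      = (\<integral>\<^sup>+x. ennreal (1 / (1 + \<rho>) ^ p) * indicator (ball (0::'a) 1) x \<partial>lborel)"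
      using that by (intro nn_integral_cong_AE) (elim AE_mp, auto simp: norm_sgn)
    also have "\<dots> = ennreal (1 / (1 + \<rho>) ^ p) * V"
      unfolding V_def by (rule nn_integral_cmult_indicator) simp
    finally show ?thesis .
  qed
  have le: "real n * \<rho> ^ (n - 1) * (1 / (1 + \<rho>) ^ p) \<le> real n * (1 / (1 + \<rho>) ^ 2)" if "\<rho> > 0" for \<rho> :: real
  proof -
    obtain q where q: "p = (n - 1) + 2 + q"
      using p less_imp_add_positive[of n p] unfolding n_def by (metis DIM_positive Suc_diff_1 add.assoc add_Suc_right add_Suc less_imp_Suc_add one_add_one plus_1_eq_Suc)
    have "\<rho> ^ (n - 1) * (1 / (1 + \<rho>) ^ p) \<le> (1 + \<rho>) ^ (n - 1) * (1 / (1 + \<rho>) ^ p)"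
      using that by (intro mult_right_mono power_mono) auto
    also have "\<dots> = (1 / (1 + \<rho>) ^ 2) * (1 / (1 + \<rho>) ^ q)"
      using that unfolding q by (simp add: power_add power2_eq_square)
    also have "\<dots> \<le> (1 / (1 + \<rho>) ^ 2) * 1"
      using that by (intro mult_left_mono) (auto simp: divide_le_eq)
    finally have "\<rho> ^ (n - 1) * (1 / (1 + \<rho>) ^ p) \<le> 1 / (1 + \<rho>) ^ 2" by simp
    from mult_left_mono[OF this, of "real n"] show ?thesis by (simp only: mult.assoc of_nat_0_le_iff simp_thms)
  qed
  have "(\<integral>\<^sup>+x. ennreal (1 / (1 + norm (x::'a)) ^ p) \<partial>lborel)
    = (\<integral>\<^sup>+\<rho>. ennreal (real n * \<rho> ^ (n - 1)) * indicator {0<..} \<rho> *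
      (\<integral>\<^sup>+x. ennreal (1 / (1 + norm (\<rho> *\<^sub>R sgn (x::'a))) ^ p) * indicator (ball 0 1) x \<partial>lborel) \<partial>lborel)"
    unfolding n_def by (rule nn_integral_polar) measurable
  also have "\<dots> \<le> (\<integral>\<^sup>+\<rho>. (ennreal (real n) * V) * (ennreal (1 / (1 + \<rho>) ^ 2) * indicator {0..} \<rho>) \<partial>lborel)"
  proof (rule nn_integral_mono)
    fix \<rho> :: real
    show "ennreal (real n * \<rho> ^ (n - 1)) * indicator {0<..} \<rho> *
      (\<integral>\<^sup>+x. ennreal (1 / (1 + norm (\<rho> *\<^sub>R sgn (x::'a))) ^ p) * indicator (ball 0 1) x \<partial>lborel)
      \<le> (ennreal (real n) * V) * (ennreal (1 / (1 + \<rho>) ^ 2) * indicator {0..} \<rho>)"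
    proof (cases "\<rho> > 0")
      case True
      have "ennreal (real n * \<rho> ^ (n - 1)) * ennreal (1 / (1 + \<rho>) ^ p)
          = ennreal (real n * \<rho> ^ (n - 1) * (1 / (1 + \<rho>) ^ p))"
        using True by (subst ennreal_mult) auto
      also have "\<dots> \<le> ennreal (real n * (1 / (1 + \<rho>) ^ 2))" by (rule ennreal_leI[OF le[OF True]])
      also have "\<dots> = ennreal (real n) * ennreal (1 / (1 + \<rho>) ^ 2)"
        by (subst ennreal_mult) auto
      finally have "ennreal (real n * \<rho> ^ (n - 1)) * ennreal (1 / (1 + \<rho>) ^ p) * V
         \<le> ennreal (real n) * ennreal (1 / (1 + \<rho>) ^ 2) * V" by (rule mult_right_mono) simp
      then show ?thesis unfolding inner[OF True] using True by (simp add: mult_ac)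
    qed simp
  qed
  also have "\<dots> = (ennreal (real n) * V) * (\<integral>\<^sup>+\<rho>. ennreal (1 / (1 + \<rho>) ^ 2) * indicator {0..} \<rho> \<partial>lborel)"
    by (rule nn_integral_cmult) measurable
  also have "(\<integral>\<^sup>+\<rho>. ennreal (1 / (1 + \<rho>) ^ 2) * indicator {0..} \<rho> \<partial>lborel) = ennreal (0 - (- (1 / (1 + 0))))"
  proof (rule nn_integral_FTC_atLeast)
    have "((\<lambda>x::real. 1 / (1 + x)) \<longlongrightarrow> 0) at_top"
      by (rule tendsto_divide_0[OF tendsto_const filterlim_at_top_imp_at_infinity])
         (rule filterlim_tendsto_add_at_top[OF tendsto_const filterlim_ident])
    from tendsto_minus[OF this] show "((\<lambda>x::real. - (1 / (1 + x))) \<longlongrightarrow> 0) at_top" by simp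
    show "DERIV (\<lambda>x. - (1 / (1 + x))) x :> 1 / (1 + x) ^ 2" if "0 \<le> x" for x :: real
      using that by (auto intro!: derivative_eq_intros simp: power2_eq_square)
  qed auto
  also have "(ennreal (real n) * V) * ennreal (0 - (- (1 / (1 + 0)))) < \<infinity>"
    using V by (simp add: ennreal_mult_less_top)
  finally show ?thesis .
qed

lemma norm_cvec_split:
  "(norm (z::'n::finite cvec))\<^sup>2 = (cmod (z $ k))\<^sup>2 + (\<Sum>j\<in>UNIV-{k}. (cmod (z $ j))\<^sup>2)"
proof -
  have "(norm z)\<^sup>2 = (\<Sum>j\<in>UNIV. (cmod (z $ j))\<^sup>2)"
    unfolding norm_vec_def L2_set_def by (simp add: sum_nonneg)
  then show ?thesis by (simp add: sum.remove[of UNIV k])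
qed

text \<open>The kernel denominator dominates the gap \<open>1 - |b|\<close>, the gap
  \<open>1 - |z_k|\<close> and, because the other coordinates satisfy
  \<open>|z'|^2 \<le> 1 - |z_k|^2\<close>, their square. The quadratic bound dictates the parabolic
  scaling of the integral estimate.\<close>

lemma ball_kernel_bounds:
  fixes z :: "'n::finite cvec"
  assumes z: "norm z \<le> 1" and b: "cmod b < 1"
  shows "1 - cmod b \<le> cmod (1 - b * z $ k)"
    and "1 - cmod (z $ k) \<le> cmod (1 - b * z $ k)"
    and "(\<Sum>j\<in>UNIV-{k}. (cmod (z $ j))\<^sup>2) \<le> 2 * cmod (1 - b * z $ k)"
proof -
  have zk: "cmod (z $ k) \<le> 1" using z Finite_Cartesian_Product.norm_nth_le[of z k] by linarith
  have t: "1 - cmod b * cmod (z $ k) \<le> cmod (1 - b * z $ k)"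
    using norm_triangle_ineq2[of 1 "b * z $ k"] by (simp add: norm_mult)
  have "cmod b * cmod (z $ k) \<le> cmod b" using zk by (simp add: mult_left_le)
  then show "1 - cmod b \<le> cmod (1 - b * z $ k)" using t by linarith
  have "cmod b * cmod (z $ k) \<le> cmod (z $ k)" using b by (simp add: mult_left_le_one_le)
  then show 1: "1 - cmod (z $ k) \<le> cmod (1 - b * z $ k)" using t by linarith
  have "(norm z)\<^sup>2 \<le> 1" using z by (simp add: power_le_one)
  then have "(\<Sum>j\<in>UNIV-{k}. (cmod (z $ j))\<^sup>2) \<le> 1 - (cmod (z $ k))\<^sup>2"
    using norm_cvec_split[of z k] by linarith
  also have "\<dots> = (1 + cmod (z $ k)) * (1 - cmod (z $ k))" by (simp add: power2_eq_square algebra_simps)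
  also have "\<dots> \<le> 2 * (1 - cmod (z $ k))" using zk by (intro mult_right_mono) auto
  also have "\<dots> \<le> 2 * cmod (1 - b * z $ k)" using 1 by (intro mult_left_mono) auto
  finally show "(\<Sum>j\<in>UNIV-{k}. (cmod (z $ j))\<^sup>2) \<le> 2 * cmod (1 - b * z $ k)" .
qed

text \<open>With \<delta> \<open>= 1 - |b|\<close>, the parabolic dilation by
  \<open>sqrt \<delta>\<close> about the boundary point where the kernel peaks makes the denominator
  at least \<open>\<delta> (1 + |v|) / 10\<close>. The Jacobian gives
  \<open>\<delta>^(N + 1)\<close>, the kernel \<open>\<delta>^(-p)\<close>, and the remaining
  integral converges because \<open>p\<close> exceeds the real dimension \<open>2 N\<close>.\<close>

lemma ball_kernel_integral_le:
  fixes k :: "'n::finite"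
  assumes p: "p > 2 * CARD('n)"
  obtains C where "C > 0" "\<And>b. cmod b < 1 \<Longrightarrow>
    (\<integral>\<^sup>+z. ennreal (1 / cmod (1 - b * (z::'n cvec) $ k) ^ p) * indicator (ball 0 1) z \<partial>lborel)
      \<le> ennreal (C * (1 - cmod b) ^ (CARD('n) + 1) / (1 - cmod b) ^ p)"
proof -
  define I where "I = (\<integral>\<^sup>+x. ennreal (1 / (1 + norm (x::'n cvec)) ^ p) \<partial>lborel)"
  have "I < \<infinity>" unfolding I_def by (rule nn_integral_inverse_power_norm_finite) (use p in \<open>simp add: mult.commute\<close>)
  then obtain I0 where I0: "I0 \<ge> 0" "I = ennreal I0" by (cases I) auto
  show thesis
  proof (rule that[of "10 ^ p * (I0 + 1)"])
    show "10 ^ p * (I0 + 1) > 0" using I0 by simp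
    fix b :: complex assume b: "cmod b < 1"
    define \<delta> where "\<delta> = 1 - cmod b"
    have \<delta>: "\<delta> > 0" using b unfolding \<delta>_def by simp
    define s where "s = sqrt \<delta>"
    have s: "s > 0" "s\<^sup>2 = \<delta>" using \<delta> unfolding s_def by auto
    \<comment> \<open>The unimodular number with \<open>b * c = cmod b\<close>: the kernel is
      closest to singular at \<open>axis k c\<close>. For \<open>b = 0\<close> any unimodular value
      would do.\<close>
    define c where "c = (if b = 0 then 1 else cnj b / cmod b)"
    have c1: "cmod c = 1" unfolding c_def by (simp add: norm_divide)
    have cb: "b = cmod b * cnj c" unfolding c_def by simp
    let ?F = "\<lambda>z::'n cvec. ennreal (1 / cmod (1 - b * z $ k) ^ p) * indicator (ball 0 1) z"
    have pt: "?F (axis k c + parabolic_dil k s v) \<le> ennreal ((10 / \<delta>) ^ p) * ennreal (1 / (1 + norm v) ^ p)" for v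
    proof (cases "axis k c + parabolic_dil k s v \<in> ball 0 1")
      case True
      define z where "z = axis k c + parabolic_dil k s v"
      have z: "norm z \<le> 1" using True unfolding z_def by simp
      define q where "q = cmod (1 - b * z $ k)"
      define r where "r = sqrt (\<Sum>j\<in>UNIV-{k}. (cmod (v $ j))\<^sup>2)"
      have r: "r \<ge> 0" "r\<^sup>2 = (\<Sum>j\<in>UNIV-{k}. (cmod (v $ j))\<^sup>2)" unfolding r_def by (auto simp: sum_nonneg)
      have zk: "z $ k = c + \<delta> *\<^sub>R v $ k" unfolding z_def parabolic_dil_def by (simp add: s)
      have zj: "z $ j = s *\<^sub>R v $ j" if "j \<noteq> k" for j using that unfolding z_def parabolic_dil_def by (simp add: axis_def)
      have q1: "\<delta> \<le> q" "(\<Sum>j\<in>UNIV-{k}. (cmod (z $ j))\<^sup>2) \<le> 2 * q"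
        using ball_kernel_bounds[OF z b] unfolding q_def \<delta>_def by auto
      have "(\<Sum>j\<in>UNIV-{k}. (cmod (z $ j))\<^sup>2) = \<delta> * r\<^sup>2"
        unfolding r(2) sum_distrib_left by (intro sum.cong) (auto simp: zj power_mult_distrib s)
      then have q2: "\<delta> * r\<^sup>2 \<le> 2 * q" using q1 by simp
      have "\<delta> * cmod (v $ k) = cmod (z $ k - c)" unfolding zk using \<delta> by simp
      also have "\<dots> = cmod (cnj c * (z $ k - c))" by (simp add: norm_mult c1)
      \<comment> \<open>Substitute \<open>b = (1 - \<delta>) * cnj c\<close>: the displacement from
        the peak is the kernel denominator up to sign and an error of size \<delta>, which
        \<open>\<delta> \<le> q\<close> absorbs.\<close>
      also have "cnj c * (z $ k - c) = (b * z $ k - 1) + complex_of_real \<delta> * (cnj c * z $ k)"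
      proof -
        have "cnj c * c = 1" using c1 complex_norm_square[of c] by (simp add: mult.commute)
        moreover have "b * z $ k = cmod b * cnj c * z $ k" using cb by (rule arg_cong)
        ultimately show ?thesis unfolding \<delta>_def by (auto simp: algebra_simps)
      qed
      also have "cmod \<dots> \<le> q + \<delta> * 1"
      proof -
        have "cmod (z $ k) \<le> 1" using z Finite_Cartesian_Product.norm_nth_le[of z k] by linarith
        then have "cmod (complex_of_real \<delta> * (cnj c * z $ k)) \<le> \<delta> * 1"
          using \<delta> by (simp add: norm_mult c1)
        moreover have "cmod (b * z $ k - 1) = q" unfolding q_def by (rule norm_minus_commute)
        ultimately show ?thesis using norm_triangle_ineq[of "b * z $ k - 1" "complex_of_real \<delta> * (cnj c * z $ k)"] by linarith
      qed
      finally have q3: "\<delta> * cmod (v $ k) \<le> 2 * q" using q1 by simp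
      have nv: "1 + norm v \<le> 2 * (1 + cmod (v $ k) + r\<^sup>2)"
      proof -
        have "(norm v)\<^sup>2 \<le> (cmod (v $ k) + r)\<^sup>2"
          using norm_cvec_split[of v k] r by (simp add: power2_sum)
        then have "norm v \<le> cmod (v $ k) + r" using r by (meson add_nonneg_nonneg norm_ge_zero power2_le_imp_le)
        moreover have "2 * r \<le> 1 + r\<^sup>2" using sum_squares_bound[of 1 r] by simp
        ultimately show ?thesis using norm_ge_zero[of "v $ k"] zero_le_power2[of r] by argo
      qed
      \<comment> \<open>The 10 is \<open>2 (1 + 2 + 2)\<close>: the summands \<delta>,
        \<open>\<delta> * cmod (v $ k)\<close> and \<open>\<delta> * r\<^sup>2\<close> are at most
        \<open>q\<close>, \<open>2 q\<close> and \<open>2 q\<close>.\<close>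
      have "\<delta> * (1 + norm v) \<le> \<delta> * (2 * (1 + cmod (v $ k) + r\<^sup>2))"
        using nv \<delta> by (intro mult_left_mono) auto
      also have "\<dots> \<le> 10 * q" using q1 q2 q3 by (simp add: algebra_simps)
      finally have q4: "\<delta> / 10 * (1 + norm v) \<le> q" by simp
      have pos: "\<delta> / 10 * (1 + norm v) > 0" using \<delta> by (simp add: add_pos_nonneg)
      have "1 / q ^ p \<le> 1 / (\<delta> / 10 * (1 + norm v)) ^ p"
        using power_mono[OF q4 less_imp_le[OF pos], of p] zero_less_power[OF pos, of p]
        by (intro frac_le) auto
      also have "\<dots> = (10 / \<delta>) ^ p * (1 / (1 + norm v) ^ p)"
        by (simp add: power_mult_distrib power_divide)
      finally have "ennreal (1 / q ^ p) \<le> ennreal ((10 / \<delta>) ^ p) * ennreal (1 / (1 + norm v) ^ p)"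
        using \<delta> by (subst ennreal_mult[symmetric]) (auto intro!: ennreal_leI)
      then show ?thesis unfolding q_def z_def by (simp add: indicator_def)
    qed simp
    have "(\<integral>\<^sup>+z. ?F z \<partial>lborel) = ennreal (s ^ (2 * CARD('n) + 2)) * (\<integral>\<^sup>+v. ?F (axis k c + parabolic_dil k s v) \<partial>lborel)"
      by (rule nn_integral_parabolic_dil[OF _ s(1)]) measurable
    also have "\<dots> \<le> ennreal (s ^ (2 * CARD('n) + 2)) * (\<integral>\<^sup>+v. ennreal ((10 / \<delta>) ^ p) * ennreal (1 / (1 + norm (v::'n cvec)) ^ p) \<partial>lborel)"
      by (intro mult_left_mono nn_integral_mono pt) simp
    also have "\<dots> = ennreal (s ^ (2 * CARD('n) + 2)) * (ennreal ((10 / \<delta>) ^ p) * I)"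
      unfolding I_def by (subst nn_integral_cmult) auto
    also have "\<dots> = ennreal (\<delta> ^ (CARD('n) + 1) * ((10 / \<delta>) ^ p * I0))"
    proof -
      have "s ^ (2 * CARD('n) + 2) = \<delta> ^ (CARD('n) + 1)"
        using power_mult[of s 2 "CARD('n) + 1"] s(2) by (simp add: power_add algebra_simps)
      then show ?thesis using \<delta> I0 by (simp add: ennreal_mult)
    qed
    also have "\<dots> \<le> ennreal (10 ^ p * (I0 + 1) * \<delta> ^ (CARD('n) + 1) / \<delta> ^ p)"
      using \<delta> I0 by (intro ennreal_leI) (simp add: power_divide field_simps)
    finally show "(\<integral>\<^sup>+z. ?F z \<partial>lborel) \<le> ennreal (10 ^ p * (I0 + 1) * (1 - cmod b) ^ (CARD('n) + 1) / (1 - cmod b) ^ p)"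
      unfolding \<delta>_def .
  qed
qed

lemma norm_sgn_le_1: "norm (sgn (x::'a::real_normed_vector)) \<le> 1"
  by (simp add: norm_sgn)

text \<open>For \<open>1 - \<rho> \<le> 1 - cmod b\<close> the kernel at \<open>\<zeta>\<close> is comparable to the one at \<open>\<rho> \<zeta>\<close>, so the sphere
  integral is bounded by the mean over that shell.\<close>

lemma sphere_kernel_integral_le:
  fixes k :: "'n::finite"
  assumes p: "p > 2 * CARD('n)"
  obtains C where "C > 0" "\<And>b. cmod b < 1 \<Longrightarrow>
    (\<integral>\<^sup>+x. ennreal (1 / cmod (1 - b * sgn (x::'n cvec) $ k) ^ p) * indicator (ball 0 1) x \<partial>lborel)
      \<le> ennreal (C * (1 - cmod b) ^ CARD('n) / (1 - cmod b) ^ p)"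
proof -
  obtain C where C: "C > 0" "\<And>b. cmod b < 1 \<Longrightarrow>
    (\<integral>\<^sup>+z. ennreal (1 / cmod (1 - b * (z::'n cvec) $ k) ^ p) * indicator (ball 0 1) z \<partial>lborel)
      \<le> ennreal (C * (1 - cmod b) ^ (CARD('n) + 1) / (1 - cmod b) ^ p)"
    using ball_kernel_integral_le[OF p] by blast
  show thesis
  proof (rule that[of "2 ^ p * C"])
    show "2 ^ p * C > 0" using C by simp
    fix b :: complex assume b: "cmod b < 1"
    define \<delta> where "\<delta> = 1 - cmod b"
    have \<delta>: "\<delta> > 0" "\<delta> \<le> 1" using b unfolding \<delta>_def by auto
    define n where "n = DIM('n cvec)"
    have n: "n > 0" unfolding n_def by simp
    let ?F = "\<lambda>z::'n cvec. ennreal (1 / cmod (1 - b * z $ k) ^ p) * indicator (ball 0 1) z"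
    define S where "S = (\<integral>\<^sup>+x. ennreal (1 / cmod (1 - b * sgn (x::'n cvec) $ k) ^ p) * indicator (ball 0 1) x \<partial>lborel)"
    have pt: "ennreal (1 / 2 ^ p) * S \<le> (\<integral>\<^sup>+x. ?F (\<rho> *\<^sub>R sgn x) * indicator (ball 0 1) x \<partial>lborel)"
      if \<rho>: "1 - \<delta> \<le> \<rho>" "\<rho> < 1" for \<rho>
    proof -
      have "\<rho> \<ge> 0" using \<rho> \<delta> by simp
      have "ennreal (1 / 2 ^ p) * S = (\<integral>\<^sup>+x. ennreal (1 / 2 ^ p) * (ennreal (1 / cmod (1 - b * sgn (x::'n cvec) $ k) ^ p) * indicator (ball 0 1) x) \<partial>lborel)"
        unfolding S_def by (rule nn_integral_cmult[symmetric]) measurable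
      also have "\<dots> \<le> (\<integral>\<^sup>+x. ?F (\<rho> *\<^sub>R sgn x) * indicator (ball 0 1) x \<partial>lborel)"
      proof (rule nn_integral_mono)
        fix x :: "'n cvec"
        let ?z = "sgn x"
        have z: "norm ?z \<le> 1" by (rule norm_sgn_le_1)
        have zk: "cmod (?z $ k) \<le> 1" using z Finite_Cartesian_Product.norm_nth_le[of ?z k] by linarith
        have "norm (\<rho> *\<^sub>R ?z) = \<rho> * norm ?z" using \<open>\<rho> \<ge> 0\<close> by simp
        also have "\<dots> \<le> \<rho> * 1" using z \<open>\<rho> \<ge> 0\<close> by (rule mult_left_mono)
        finally have nr: "norm (\<rho> *\<^sub>R ?z) < 1" using \<rho> by linarith
        have d: "\<delta> \<le> cmod (1 - b * ?z $ k)" using ball_kernel_bounds(1)[OF z b] unfolding \<delta>_def by auto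
        have "1 - b * (\<rho> *\<^sub>R ?z) $ k = (1 - b * ?z $ k) + (1 - \<rho>) *\<^sub>R (b * ?z $ k)"
          by (simp add: algebra_simps scaleR_conv_of_real[where 'a=complex])
        then have "cmod (1 - b * (\<rho> *\<^sub>R ?z) $ k) \<le> cmod (1 - b * ?z $ k) + cmod ((1 - \<rho>) *\<^sub>R (b * ?z $ k))"
          by (simp only: norm_triangle_ineq)
        also have "cmod ((1 - \<rho>) *\<^sub>R (b * ?z $ k)) \<le> \<delta> * (1 * 1)"
          unfolding norm_scaleR norm_mult using \<rho> zk b by (intro mult_mono) auto
        finally have le: "cmod (1 - b * (\<rho> *\<^sub>R ?z) $ k) \<le> 2 * cmod (1 - b * ?z $ k)" using d by simp
        have pos: "cmod (1 - b * (\<rho> *\<^sub>R ?z) $ k) > 0"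
          using ball_kernel_bounds(1)[OF less_imp_le[OF nr] b, of k] b by linarith
        have "1 / 2 ^ p * (1 / cmod (1 - b * ?z $ k) ^ p) = 1 / (2 * cmod (1 - b * ?z $ k)) ^ p"
          by (simp add: power_mult_distrib)
        also have "\<dots> \<le> 1 / cmod (1 - b * (\<rho> *\<^sub>R ?z) $ k) ^ p"
          using power_mono[OF le, of p] zero_less_power[OF pos, of p] by (intro frac_le) auto
        finally have "ennreal (1 / 2 ^ p) * ennreal (1 / cmod (1 - b * ?z $ k) ^ p) \<le> ennreal (1 / cmod (1 - b * (\<rho> *\<^sub>R ?z) $ k) ^ p)"
          by (subst ennreal_mult[symmetric]) (auto intro!: ennreal_leI)
        then show "ennreal (1 / 2 ^ p) * (ennreal (1 / cmod (1 - b * sgn (x::'n cvec) $ k) ^ p) * indicator (ball 0 1) x)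
          \<le> ?F (\<rho> *\<^sub>R sgn x) * indicator (ball 0 1) x"
          using nr by (auto simp: indicator_def)
      qed
      finally show ?thesis .
    qed
    \<comment> \<open>\<open>real n * \<rho> ^ (n - 1)\<close> is the radial density of the polar
      formula, so the shell has mass \<open>1 - (1 - \<delta>)^n \<ge> \<delta>\<close>. Dividing
      the ball estimate by it turns \<open>\<delta>^(N + 1)\<close> into
      \<open>\<delta>^N\<close>.\<close>
    have "(ennreal (1 / 2 ^ p) * S) * ennreal (1 ^ n - (1 - \<delta>) ^ n)
       = (ennreal (1 / 2 ^ p) * S) * (\<integral>\<^sup>+\<rho>. ennreal (real n * \<rho> ^ (n - 1)) * indicator {1 - \<delta>..1} \<rho> \<partial>lborel)"
    proof (subst nn_integral_FTC_Icc[where F = "\<lambda>\<rho>. \<rho> ^ n"])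
      show "((\<lambda>\<rho>. \<rho> ^ n) has_real_derivative real n * x ^ (n - 1)) (at x)" for x
        by (metis DERIV_pow One_nat_def)
    qed (use \<delta> in auto)
    also have "\<dots> = (\<integral>\<^sup>+\<rho>. (ennreal (1 / 2 ^ p) * S) * (ennreal (real n * \<rho> ^ (n - 1)) * indicator {1 - \<delta>..1} \<rho>) \<partial>lborel)"
      by (rule nn_integral_cmult[symmetric]) measurable
    also have "\<dots> \<le> (\<integral>\<^sup>+\<rho>. ennreal (real n * \<rho> ^ (n - 1)) * indicator {0<..} \<rho> *
         (\<integral>\<^sup>+x. ?F (\<rho> *\<^sub>R sgn x) * indicator (ball 0 1) x \<partial>lborel) \<partial>lborel)"
    proof (rule nn_integral_mono_AE)
      \<comment> \<open>Two null radii are dropped: \<open>pt\<close> requires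
        \<open>\<rho> < 1\<close>, and for \<open>b = 0\<close> the shell reaches down to 0, which
        the polar formula omits.\<close>
      have "AE \<rho> in lborel. \<rho> \<noteq> (0::real)" "AE \<rho> in lborel. \<rho> \<noteq> (1::real)" by (rule AE_lborel_singleton)+
      then show "AE \<rho> in lborel. (ennreal (1 / 2 ^ p) * S) * (ennreal (real n * \<rho> ^ (n - 1)) * indicator {1 - \<delta>..1} \<rho>)
        \<le> ennreal (real n * \<rho> ^ (n - 1)) * indicator {0<..} \<rho> *
         (\<integral>\<^sup>+x. ?F (\<rho> *\<^sub>R sgn x) * indicator (ball 0 1) x \<partial>lborel)"
      proof eventually_elim
        fix \<rho> :: real assume ne: "\<rho> \<noteq> 0" "\<rho> \<noteq> 1"
        show "(ennreal (1 / 2 ^ p) * S) * (ennreal (real n * \<rho> ^ (n - 1)) * indicator {1 - \<delta>..1} \<rho>)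
        \<le> ennreal (real n * \<rho> ^ (n - 1)) * indicator {0<..} \<rho> *
         (\<integral>\<^sup>+x. ?F (\<rho> *\<^sub>R sgn x) * indicator (ball 0 1) x \<partial>lborel)"
        proof (cases "1 - \<delta> \<le> \<rho> \<and> \<rho> \<le> 1")
          case True
          then have r: "1 - \<delta> \<le> \<rho>" "\<rho> < 1" "\<rho> > 0" using ne \<delta> by auto
          have "ennreal (real n * \<rho> ^ (n - 1)) * (ennreal (1 / 2 ^ p) * S) \<le> ennreal (real n * \<rho> ^ (n - 1)) *
              (\<integral>\<^sup>+x. ?F (\<rho> *\<^sub>R sgn x) * indicator (ball 0 1) x \<partial>lborel)"
            by (rule mult_left_mono[OF pt[OF r(1,2)]]) simp
          then show ?thesis using r by (simp add: mult_ac)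
        qed (auto simp: indicator_def)
      qed
    qed
    also have "\<dots> = (\<integral>\<^sup>+z. ?F z \<partial>lborel)"
      unfolding n_def by (rule nn_integral_polar[symmetric]) measurable
    also have "\<dots> \<le> ennreal (C * \<delta> ^ (CARD('n) + 1) / \<delta> ^ p)" using C(2)[OF b] unfolding \<delta>_def .
    finally have main: "(ennreal (1 / 2 ^ p) * S) * ennreal (1 ^ n - (1 - \<delta>) ^ n) \<le> ennreal (C * \<delta> ^ (CARD('n) + 1) / \<delta> ^ p)" .
    have "(1 - \<delta>) ^ n \<le> (1 - \<delta>) ^ 1" using \<delta> n by (intro power_decreasing) auto
    then have "\<delta> \<le> 1 ^ n - (1 - \<delta>) ^ n" by simp
    then have "(ennreal (1 / 2 ^ p) * S) * ennreal \<delta> \<le> ennreal (C * \<delta> ^ (CARD('n) + 1) / \<delta> ^ p)"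
      using main by (meson ennreal_leI mult_left_mono order_trans zero_le)
    then have "ennreal (2 ^ p / \<delta>) * ((ennreal (1 / 2 ^ p) * S) * ennreal \<delta>) \<le> ennreal (2 ^ p / \<delta>) * ennreal (C * \<delta> ^ (CARD('n) + 1) / \<delta> ^ p)"
      by (rule mult_left_mono) simp
    also have "ennreal (2 ^ p / \<delta>) * ((ennreal (1 / 2 ^ p) * S) * ennreal \<delta>) = (ennreal (2 ^ p / \<delta>) * ennreal (1 / 2 ^ p) * ennreal \<delta>) * S"
      by (simp only: mult_ac)
    also have "ennreal (2 ^ p / \<delta>) * ennreal (1 / 2 ^ p) * ennreal \<delta> = 1"
      using \<delta> by (simp add: ennreal_mult[symmetric])
    also have "ennreal (2 ^ p / \<delta>) * ennreal (C * \<delta> ^ (CARD('n) + 1) / \<delta> ^ p) = ennreal (2 ^ p * C * \<delta> ^ CARD('n) / \<delta> ^ p)"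
      using \<delta> C(1) by (simp add: ennreal_mult[symmetric] field_simps)
    finally show "(\<integral>\<^sup>+x. ennreal (1 / cmod (1 - b * sgn (x::'n cvec) $ k) ^ p) * indicator (ball 0 1) x \<partial>lborel)
      \<le> ennreal (2 ^ p * C * (1 - cmod b) ^ CARD('n) / (1 - cmod b) ^ p)"
      unfolding S_def \<delta>_def by simp
  qed
qed

text \<open>The integrand is an exact derivative, since \<open>t / (t + \<delta>)\<close> has
  derivative \<open>\<delta> / (t + \<delta>)^2\<close>. For \<open>a < 0\<close> it blows up at 0,
  so the fundamental theorem is applied away from 0 and Fatou's lemma recovers the whole
  interval.\<close>

lemma weighted_tail_integral_le:
  fixes a \<delta> :: real
  assumes a: "a > -1" and \<delta>: "\<delta> > 0"
  shows "(\<integral>\<^sup>+t. ennreal ((t / (t + \<delta>)) powr a / (t + \<delta>)\<^sup>2) * indicator {0<..1} t \<partial>lborel) \<le> ennreal (1 / ((a + 1) * \<delta>))"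
proof -
  let ?f = "\<lambda>t. (t / (t + \<delta>)) powr a / (t + \<delta>)\<^sup>2"
  let ?G = "\<lambda>t. (t / (t + \<delta>)) powr (a + 1) / ((a + 1) * \<delta>)"
  have der: "(?G has_real_derivative ?f t) (at t)" if "t > 0" for t
  proof -
    have q: "((\<lambda>t. t / (t + \<delta>)) has_real_derivative \<delta> / (t + \<delta>)\<^sup>2) (at t)"
      using that \<delta> by (auto intro!: derivative_eq_intros simp: power2_eq_square field_simps)
    have "((\<lambda>t. (t / (t + \<delta>)) powr (a + 1)) has_real_derivative ((a + 1) * (t / (t + \<delta>)) powr (a + 1 - 1) * (\<delta> / (t + \<delta>)\<^sup>2))) (at t)"
      using that \<delta> by (intro has_real_derivative_powr[THEN DERIV_chain2] q) auto
    then have "(?G has_real_derivative ((a + 1) * (t / (t + \<delta>)) powr (a + 1 - 1) * (\<delta> / (t + \<delta>)\<^sup>2)) / ((a + 1) * \<delta>)) (at t)"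
      by (rule DERIV_cdivide)
    then show ?thesis using a \<delta> by simp
  qed
  have step: "(\<integral>\<^sup>+t. ennreal (?f t) * indicator {\<epsilon>..1} t \<partial>lborel) \<le> ennreal (1 / ((a + 1) * \<delta>))" if \<epsilon>: "0 < \<epsilon>" "\<epsilon> \<le> 1" for \<epsilon>
  proof -
    have "(\<integral>\<^sup>+t. ennreal (?f t) * indicator {\<epsilon>..1} t \<partial>lborel) = ennreal (?G 1 - ?G \<epsilon>)"
      by (rule nn_integral_FTC_Icc) (use der \<epsilon> in auto)
    also have "?G 1 - ?G \<epsilon> \<le> ?G 1" using a \<delta> by simp
    also have "?G 1 \<le> 1 / ((a + 1) * \<delta>)"
      using a \<delta> by (intro divide_right_mono powr_le1) auto
    finally show ?thesis by (auto intro: ennreal_leI)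
  qed
  define e where "e i = 1 / real (Suc i)" for i
  have lim: "ennreal (?f t) * indicator {0<..1} t \<le> liminf (\<lambda>i. ennreal (?f t) * indicator {e i..1} t)" for t
  proof (cases "t \<in> {0<..1}")
    case True
    have "e \<longlonglongrightarrow> 0" unfolding e_def using lim_inverse_n' LIMSEQ_Suc by fastforce
    then have "eventually (\<lambda>i. e i < t) sequentially" using True by (intro order_tendstoD) auto
    then have "eventually (\<lambda>i. ennreal (?f t) * indicator {0<..1} t \<le> ennreal (?f t) * indicator {e i..1} t) sequentially"
      by eventually_elim (use True in auto)
    then show ?thesis by (rule Liminf_bounded)
  qed simp
  have "(\<integral>\<^sup>+t. ennreal (?f t) * indicator {0<..1} t \<partial>lborel) \<le> (\<integral>\<^sup>+t. liminf (\<lambda>i. ennreal (?f t) * indicator {e i..1} t) \<partial>lborel)"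
    by (rule nn_integral_mono) (rule lim)
  also have "\<dots> \<le> liminf (\<lambda>i. \<integral>\<^sup>+t. ennreal (?f t) * indicator {e i..1} t \<partial>lborel)"
    by (rule nn_integral_liminf) measurable
  also have "\<dots> \<le> ennreal (1 / ((a + 1) * \<delta>))"
    by (rule Liminf_le) (auto intro!: always_eventually step simp: e_def divide_le_eq)
  finally show ?thesis .
qed

text \<open>On the sphere of radius \<rho> the parameter \<open>b\<close> acts as
  \<open>b \<rho>\<close>, so the sphere estimate gives \<open>(1 - |b| \<rho>)^(N - p)\<close> and
  one radial integral remains. The second condition on \<open>p\<close> makes
  \<open>\<alpha> + 2 - e\<close> nonpositive, where \<open>e = p - N\<close>; that part of the
  power of \<open>t + \<delta>\<close>, with \<open>t = 1 - \<rho>\<close>, is bounded by a power of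
  \<delta>, and the rest is the integrand of \<open>weighted_tail_integral_le\<close>.\<close>

lemma weighted_kernel_integral_le:
  fixes k :: "'n::finite" and \<alpha> :: real
  assumes \<alpha>: "\<alpha> > -1" and p: "p > 2 * CARD('n)" "real p \<ge> real CARD('n) + \<alpha> + 2"
  obtains C where "C > 0" "\<And>b. cmod b < 1 \<Longrightarrow>
    (\<integral>\<^sup>+z. ennreal (1 / cmod (1 - b * (z::'n cvec) $ k) ^ p * (1 - (norm z)\<^sup>2) powr \<alpha>) * indicator (ball 0 1) z \<partial>lborel)
      \<le> ennreal (C * (1 - cmod b) powr (real CARD('n) + 1 + \<alpha> - real p))"
proof -
  define N where "N = CARD('n)"
  define n where "n = DIM('n cvec)"
  have n: "n > 0" unfolding n_def by simp
  obtain C where C: "C > 0" "\<And>b. cmod b < 1 \<Longrightarrow>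
    (\<integral>\<^sup>+x. ennreal (1 / cmod (1 - b * sgn (x::'n cvec) $ k) ^ p) * indicator (ball 0 1) x \<partial>lborel)
      \<le> ennreal (C * (1 - cmod b) ^ N / (1 - cmod b) ^ p)"
    using sphere_kernel_integral_le[OF p(1)] unfolding N_def by blast
  define e where "e = real p - real N"
  have e: "e > 0" "e \<ge> \<alpha> + 2" using p unfolding e_def N_def by auto
  \<comment> \<open>The factors are the radial density, the bound of
    \<open>(1 + \<rho>) powr \<alpha>\<close> for either sign of \<alpha>, the sphere constant, and
    the loss from \<open>1 - |b| \<rho> \<ge> (t + \<delta>) / 2\<close>.\<close>
  define D where "D = real n * 2 powr \<bar>\<alpha>\<bar> * C * 2 powr e"
  have D: "D > 0" unfolding D_def using n C by simp
  show thesis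
  proof (rule that[of "D / (\<alpha> + 1)"])
    show "D / (\<alpha> + 1) > 0" using D \<alpha> by simp
    fix b :: complex assume b: "cmod b < 1"
    define \<delta> where "\<delta> = 1 - cmod b"
    have \<delta>: "\<delta> > 0" "\<delta> \<le> 1" using b unfolding \<delta>_def by auto
    let ?F = "\<lambda>z::'n cvec. ennreal (1 / cmod (1 - b * z $ k) ^ p * (1 - (norm z)\<^sup>2) powr \<alpha>) * indicator (ball 0 1) z"
    have inner: "(\<integral>\<^sup>+x. ?F (\<rho> *\<^sub>R sgn x) * indicator (ball 0 1) x \<partial>lborel)
        \<le> ennreal ((1 - \<rho>\<^sup>2) powr \<alpha> * (C * (1 - cmod b * \<rho>) powr (- e)))" if \<rho>: "0 < \<rho>" "\<rho> < 1" for \<rho>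
    proof -
      have b': "cmod (b * \<rho>) < 1" using b \<rho> by (simp add: norm_mult) (meson less_eq_real_def less_trans mult_left_le norm_ge_zero order_le_less_trans)
      have pos: "0 < 1 - cmod b * \<rho>" using b' \<rho> by (simp add: norm_mult)
      have "AE x in lborel. x \<noteq> (0::'n cvec)" by (rule AE_lborel_singleton)
      then have "(\<integral>\<^sup>+x. ?F (\<rho> *\<^sub>R sgn x) * indicator (ball 0 1) x \<partial>lborel)
         = (\<integral>\<^sup>+x. ennreal ((1 - \<rho>\<^sup>2) powr \<alpha>) * (ennreal (1 / cmod (1 - (b * \<rho>) * sgn (x::'n cvec) $ k) ^ p) * indicator (ball 0 1) x) \<partial>lborel)"
      proof (intro nn_integral_cong_AE, elim AE_mp, intro AE_I2 impI)
        fix x :: "'n cvec" assume x: "x \<noteq> 0"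
        have "norm (\<rho> *\<^sub>R sgn x) = \<rho>" using x \<rho> by (simp add: norm_sgn)
        moreover have "b * (\<rho> *\<^sub>R sgn x) $ k = (b * \<rho>) * sgn x $ k"
          by (simp add: scaleR_conv_of_real[where 'a=complex])
        ultimately show "?F (\<rho> *\<^sub>R sgn x) * indicator (ball 0 1) x = ennreal ((1 - \<rho>\<^sup>2) powr \<alpha>) * (ennreal (1 / cmod (1 - (b * \<rho>) * sgn (x::'n cvec) $ k) ^ p) * indicator (ball 0 1) x)"
          using \<rho> by (simp add: ennreal_mult[symmetric] indicator_def del: norm_scaleR)
      qed
      also have "\<dots> = ennreal ((1 - \<rho>\<^sup>2) powr \<alpha>) * (\<integral>\<^sup>+x. ennreal (1 / cmod (1 - (b * \<rho>) * sgn (x::'n cvec) $ k) ^ p) * indicator (ball 0 1) x \<partial>lborel)"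
        by (rule nn_integral_cmult) measurable
      also have "\<dots> \<le> ennreal ((1 - \<rho>\<^sup>2) powr \<alpha>) * ennreal (C * (1 - cmod (b * \<rho>)) ^ N / (1 - cmod (b * \<rho>)) ^ p)"
        by (intro mult_left_mono C b') simp
      also have "C * (1 - cmod (b * \<rho>)) ^ N / (1 - cmod (b * \<rho>)) ^ p = C * (1 - cmod b * \<rho>) powr (- e)"
        using pos \<rho> by (simp add: e_def norm_mult powr_diff powr_realpow)
      also have "ennreal ((1 - \<rho>\<^sup>2) powr \<alpha>) * ennreal (C * (1 - cmod b * \<rho>) powr (- e)) = ennreal ((1 - \<rho>\<^sup>2) powr \<alpha> * (C * (1 - cmod b * \<rho>) powr (- e)))"
        using C by (simp add: ennreal_mult)
      finally show ?thesis .
    qed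
    let ?h = "\<lambda>t. (t / (t + \<delta>)) powr \<alpha> / (t + \<delta>)\<^sup>2"
    have pt: "real n * \<rho> ^ (n - 1) * ((1 - \<rho>\<^sup>2) powr \<alpha> * (C * (1 - cmod b * \<rho>) powr (- e)))
        \<le> D * \<delta> powr (\<alpha> + 2 - e) * ?h (1 - \<rho>)" if \<rho>: "0 < \<rho>" "\<rho> < 1" for \<rho>
    proof -
      define t where "t = 1 - \<rho>"
      have t: "0 < t" "t < 1" using \<rho> unfolding t_def by auto
      have 1: "\<rho> ^ (n - 1) \<le> 1" using \<rho> by (intro power_le_one) auto
      have "1 - \<rho>\<^sup>2 = (1 + \<rho>) * t" unfolding t_def by (simp add: power2_eq_square algebra_simps)
      then have "(1 - \<rho>\<^sup>2) powr \<alpha> = (1 + \<rho>) powr \<alpha> * t powr \<alpha>" using \<rho> t by (simp add: powr_mult)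
      also have "(1 + \<rho>) powr \<alpha> \<le> (1 + \<rho>) powr \<bar>\<alpha>\<bar>" using \<rho> by (intro powr_mono) auto
      also have "(1 + \<rho>) powr \<bar>\<alpha>\<bar> \<le> 2 powr \<bar>\<alpha>\<bar>" using \<rho> by (intro powr_mono2) auto
      finally have 2: "(1 - \<rho>\<^sup>2) powr \<alpha> \<le> 2 powr \<bar>\<alpha>\<bar> * t powr \<alpha>" by (simp add: mult_right_mono)
      \<comment> \<open>\<open>1 - |b| \<rho>\<close> is at least \<open>t\<close> and at least
        \<delta>, hence at least their mean.\<close>
      have "cmod b * \<rho> \<le> \<rho>" "cmod b * \<rho> \<le> cmod b" using b \<rho> by (auto simp: mult_left_le mult_left_le_one_le)
      then have "(t + \<delta>) / 2 \<le> 1 - cmod b * \<rho>" unfolding t_def \<delta>_def by simp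
      then have "(1 - cmod b * \<rho>) powr (- e) \<le> ((t + \<delta>) / 2) powr (- e)"
        using t \<delta> e by (intro powr_mono2') auto
      also have "\<dots> = 2 powr e * (t + \<delta>) powr (- e)"
        using t \<delta> by (simp add: powr_divide powr_minus field_simps)
      finally have 3: "(1 - cmod b * \<rho>) powr (- e) \<le> 2 powr e * (t + \<delta>) powr (- e)" .
      have 4: "t powr \<alpha> * (t + \<delta>) powr (- e) \<le> \<delta> powr (\<alpha> + 2 - e) * ?h t"
      proof -
        have "(t + \<delta>) powr (- e) = (t + \<delta>) powr (\<alpha> + 2 - e) * (t + \<delta>) powr (- \<alpha>) * (t + \<delta>) powr (- 2)"
          using t \<delta> by (simp add: powr_add[symmetric])
        moreover have "(t + \<delta>) powr (- 2) = 1 / (t + \<delta>)\<^sup>2"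
          using t \<delta> by (simp add: powr_minus_divide powr_numeral)
        moreover have "t powr \<alpha> * (t + \<delta>) powr (- \<alpha>) = (t / (t + \<delta>)) powr \<alpha>"
          using t \<delta> by (simp add: powr_divide powr_minus_divide)
        ultimately have "t powr \<alpha> * (t + \<delta>) powr (- e) = (t + \<delta>) powr (\<alpha> + 2 - e) * ?h t"
          by (simp add: mult_ac)
        also have "\<dots> \<le> \<delta> powr (\<alpha> + 2 - e) * ?h t"
          using t \<delta> e by (intro mult_right_mono powr_mono2') auto
        finally show ?thesis .
      qed
      have "real n * \<rho> ^ (n - 1) * ((1 - \<rho>\<^sup>2) powr \<alpha> * (C * (1 - cmod b * \<rho>) powr (- e)))
         \<le> real n * 1 * ((2 powr \<bar>\<alpha>\<bar> * t powr \<alpha>) * (C * (2 powr e * (t + \<delta>) powr (- e))))"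
        using 1 2 3 C \<rho> by (intro mult_mono) auto
      also have "\<dots> = D * (t powr \<alpha> * (t + \<delta>) powr (- e))" unfolding D_def by (simp add: mult_ac)
      also have "\<dots> \<le> D * (\<delta> powr (\<alpha> + 2 - e) * ?h t)" using 4 D by (intro mult_left_mono) auto
      finally show ?thesis unfolding t_def by (simp add: mult.assoc)
    qed
    have "(\<integral>\<^sup>+z. ?F z \<partial>lborel) = (\<integral>\<^sup>+\<rho>. ennreal (real n * \<rho> ^ (n - 1)) * indicator {0<..} \<rho> *
         (\<integral>\<^sup>+x. ?F (\<rho> *\<^sub>R sgn x) * indicator (ball 0 1) x \<partial>lborel) \<partial>lborel)"
      unfolding n_def by (rule nn_integral_polar) measurable
    also have "\<dots> \<le> (\<integral>\<^sup>+\<rho>. ennreal (D * \<delta> powr (\<alpha> + 2 - e)) * (ennreal (?h (1 - \<rho>)) * indicator {0<..1} (1 - \<rho>)) \<partial>lborel)"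
    proof (rule nn_integral_mono)
      fix \<rho> :: real
      show "ennreal (real n * \<rho> ^ (n - 1)) * indicator {0<..} \<rho> *
         (\<integral>\<^sup>+x. ?F (\<rho> *\<^sub>R sgn x) * indicator (ball 0 1) x \<partial>lborel)
        \<le> ennreal (D * \<delta> powr (\<alpha> + 2 - e)) * (ennreal (?h (1 - \<rho>)) * indicator {0<..1} (1 - \<rho>))"
      proof (cases "\<rho> > 0 \<and> \<rho> < 1")
        case True
        then have \<rho>: "0 < \<rho>" "\<rho> < 1" by auto
        have "ennreal (real n * \<rho> ^ (n - 1)) * (\<integral>\<^sup>+x. ?F (\<rho> *\<^sub>R sgn x) * indicator (ball 0 1) x \<partial>lborel)
          \<le> ennreal (real n * \<rho> ^ (n - 1)) * ennreal ((1 - \<rho>\<^sup>2) powr \<alpha> * (C * (1 - cmod b * \<rho>) powr (- e)))"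
          by (rule mult_left_mono[OF inner[OF \<rho>]]) simp
        also have "\<dots> = ennreal (real n * \<rho> ^ (n - 1) * ((1 - \<rho>\<^sup>2) powr \<alpha> * (C * (1 - cmod b * \<rho>) powr (- e))))"
          using C \<rho> by (simp add: ennreal_mult)
        also have "\<dots> \<le> ennreal (D * \<delta> powr (\<alpha> + 2 - e) * ?h (1 - \<rho>))" by (rule ennreal_leI[OF pt[OF \<rho>]])
        also have "\<dots> = ennreal (D * \<delta> powr (\<alpha> + 2 - e)) * ennreal (?h (1 - \<rho>))"
          using D by (intro ennreal_mult) auto
        finally show ?thesis using \<rho> by simp
      next
        case False
        show ?thesis
        proof (cases "\<rho> > 0")
          case True
          then have "\<rho> \<ge> 1" using False by simp
          have "(\<integral>\<^sup>+x. ?F (\<rho> *\<^sub>R sgn x) * indicator (ball 0 1) x \<partial>lborel) = (\<integral>\<^sup>+x. 0 \<partial>(lborel :: 'n cvec measure))"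
          proof (intro nn_integral_cong_AE)
            have "AE x in lborel. x \<noteq> (0::'n cvec)" by (rule AE_lborel_singleton)
            then show "AE x in lborel. ?F (\<rho> *\<^sub>R sgn x) * indicator (ball 0 1) x = 0"
              by eventually_elim (use \<open>\<rho> \<ge> 1\<close> in \<open>auto simp: norm_sgn indicator_def\<close>)
          qed
          then show ?thesis by simp
        qed simp
      qed
    qed
    also have "\<dots> = ennreal (D * \<delta> powr (\<alpha> + 2 - e)) * (\<integral>\<^sup>+\<rho>. ennreal (?h (1 - \<rho>)) * indicator {0<..1} (1 - \<rho>) \<partial>lborel)"
      by (rule nn_integral_cmult) measurable
    also have "(\<integral>\<^sup>+\<rho>. ennreal (?h (1 - \<rho>)) * indicator {0<..1} (1 - \<rho>) \<partial>lborel) = (\<integral>\<^sup>+t. ennreal (?h t) * indicator {0<..1} t \<partial>lborel)"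
      by (subst (2) nn_integral_real_affine[where c = "-1" and t = 1]) (auto simp: algebra_simps)
    also have "ennreal (D * \<delta> powr (\<alpha> + 2 - e)) * \<dots> \<le> ennreal (D * \<delta> powr (\<alpha> + 2 - e)) * ennreal (1 / ((\<alpha> + 1) * \<delta>))"
      by (intro mult_left_mono weighted_tail_integral_le \<alpha> \<delta>) simp
    also have "\<dots> = ennreal (D / (\<alpha> + 1) * (\<delta> powr (\<alpha> + 2 - e) / \<delta>))"
      using D \<alpha> \<delta> by (simp add: ennreal_mult[symmetric])
    \<comment> \<open>The tail integral costs a further \<open>1 / \<delta>\<close>, and
      \<open>\<alpha> + 1 - e\<close> is the exponent claimed.\<close>
    also have "\<delta> powr (\<alpha> + 2 - e) / \<delta> = \<delta> powr (real CARD('n) + 1 + \<alpha> - real p)"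
    proof -
      have "\<delta> powr (\<alpha> + 2 - e) / \<delta> = \<delta> powr (\<alpha> + 2 - e - 1)"
        using \<delta> by (subst powr_diff) auto
      then show ?thesis unfolding e_def N_def by (simp add: algebra_simps)
    qed
    finally show "(\<integral>\<^sup>+z. ?F z \<partial>lborel) \<le> ennreal (D / (\<alpha> + 1) * (1 - cmod b) powr (real CARD('n) + 1 + \<alpha> - real p))"
      unfolding \<delta>_def .
  qed
qed

section \<open>Norms of functions dominated by a kernel\<close>

lemma emeasure_unit_ball_cvec:
  obtains V where "V > 0" "emeasure lborel (ball 0 1 :: 'n::finite cvec set) = ennreal V"
proof (rule that[of "measure lborel (ball 0 1 :: 'n cvec set)"])
  show "measure lborel (ball 0 1 :: 'n cvec set) > 0"
    using content_ball_pos[of 1 "0 :: 'n cvec"] by (simp add: measure_completion)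
  show "emeasure lborel (ball 0 1 :: 'n cvec set) = ennreal (measure lborel (ball 0 1 :: 'n cvec set))"
    by (rule emeasure_eq_ennreal_measure) (metis emeasure_lborel_ball_finite infinity_ennreal_def less_irrefl)
qed

text \<open>The exponent \<open>s\<close> for which \<open>(1 - cmod b) powr (s - 2 m)\<close> is the size of the squared norm of
  \<open>1 / (1 - b z\<^sub>k)\<^sup>m\<close>.\<close>

definition space_exponent :: "(('n::finite cvec \<Rightarrow> complex) \<Rightarrow> ennreal) \<Rightarrow> real \<Rightarrow> bool" where
  "space_exponent Nsq s \<longleftrightarrow> (Nsq = H2_sqnorm \<and> s = real CARD('n)) \<or>
     (\<exists>\<alpha>>-1. Nsq = A2_sqnorm \<alpha> \<and> s = real CARD('n) + 1 + \<alpha>)"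

lemma bergman_const_pos: "\<alpha> > -1 \<Longrightarrow> bergman_const N \<alpha> > 0"
  unfolding bergman_const_def by (intro divide_pos_pos mult_pos_pos Gamma_real_pos) auto

text \<open>Squaring turns the kernel exponent into \<open>p = 2 m\<close>, and the two conditions
  on \<open>m\<close> become those on \<open>p\<close>. In the Hardy case the radius is absorbed
  into the parameter, \<open>b r\<close> replacing \<open>b\<close>; as \<open>s - 2 m\<close> is
  negative, the power of \<open>1 - |b r|\<close> is at most that of \<open>1 - |b|\<close>, so the
  bound is uniform over the supremum.\<close>

lemma sqnorm_le_of_kernel_bound:
  fixes k :: "'n::finite" and Nsq :: "('n cvec \<Rightarrow> complex) \<Rightarrow> ennreal"
  assumes Nsq: "space_exponent Nsq s" and m: "m > CARD('n)" "2 * real m \<ge> s + 1"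
  obtains C where "C > 0" "\<And>b K f. cmod b < 1 \<Longrightarrow> K \<ge> 0 \<Longrightarrow>
     (\<And>z. z \<in> unit_ball \<Longrightarrow> cmod (f z) \<le> K / cmod (1 - b * z $ k) ^ m) \<Longrightarrow>
     Nsq f \<le> ennreal (C * K\<^sup>2 * (1 - cmod b) powr (s - 2 * real m))"
proof -
  obtain V where V: "V > 0" "emeasure lborel (ball 0 1 :: 'n cvec set) = ennreal V"
    by (rule emeasure_unit_ball_cvec)
  have sq: "(cmod (f z))\<^sup>2 \<le> K\<^sup>2 * (1 / cmod (1 - b * z $ k) ^ (2 * m))"
    if "cmod (f z) \<le> K / cmod (1 - b * z $ k) ^ m" for f K b and z :: "'n cvec"
    using power_mono[OF that, of 2] by (simp add: power_divide power_mult[symmetric] mult.commute)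
  from Nsq consider "Nsq = H2_sqnorm" "s = real CARD('n)"
    | \<alpha> where "\<alpha> > -1" "Nsq = A2_sqnorm \<alpha>" "s = real CARD('n) + 1 + \<alpha>"
    unfolding space_exponent_def by blast
  then show thesis
  proof cases
    case 1
    obtain C where C: "C > 0" "\<And>b. cmod b < 1 \<Longrightarrow>
      (\<integral>\<^sup>+x. ennreal (1 / cmod (1 - b * sgn (x::'n cvec) $ k) ^ (2 * m)) * indicator (ball 0 1) x \<partial>lborel)
      \<le> ennreal (C * (1 - cmod b) ^ CARD('n) / (1 - cmod b) ^ (2 * m))"
      using sphere_kernel_integral_le[of "2 * m" k] m(1) by auto
    show thesis
    proof (rule that[of "C / V"])
      show "C / V > 0" using C V by simp
      fix b :: complex and K :: real and f :: "'n cvec \<Rightarrow> complex"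
      assume b: "cmod b < 1" and K: "K \<ge> 0"
        and f: "\<And>z. z \<in> unit_ball \<Longrightarrow> cmod (f z) \<le> K / cmod (1 - b * z $ k) ^ m"
      have "sphere_nnint (\<lambda>\<zeta>. ennreal ((cmod (f (r *\<^sub>R \<zeta>)))\<^sup>2)) \<le> ennreal (C / V * K\<^sup>2 * (1 - cmod b) powr (s - 2 * real m))"
        if r: "0 < r" "r < 1" for r
      proof -
        have br: "cmod (b * r) \<le> cmod b" using r by (simp add: norm_mult mult_left_le)
        then have b': "cmod (b * r) < 1" using b by simp
        have pos: "1 - cmod (b * r) > 0" using b' by simp
        have "(\<integral>\<^sup>+x. ennreal ((cmod (f (r *\<^sub>R sgn x)))\<^sup>2) * indicator (ball 0 1) x \<partial>lborel)
          \<le> (\<integral>\<^sup>+x. ennreal (K\<^sup>2) * (ennreal (1 / cmod (1 - (b * r) * sgn (x::'n cvec) $ k) ^ (2 * m)) * indicator (ball 0 1) x) \<partial>lborel)"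
        proof (rule nn_integral_mono)
          fix x :: "'n cvec"
          have "r *\<^sub>R sgn x \<in> unit_ball" using r norm_sgn_le_1[of x]
            by (simp add: norm_sgn)
          from sq[of f "r *\<^sub>R sgn x", OF f[OF this]]
          have "ennreal ((cmod (f (r *\<^sub>R sgn x)))\<^sup>2) \<le> ennreal (K\<^sup>2) * ennreal (1 / cmod (1 - (b * r) * sgn (x::'n cvec) $ k) ^ (2 * m))"
            by (subst ennreal_mult[symmetric]) (auto intro!: ennreal_leI simp: scaleR_conv_of_real[where 'a=complex] mult.assoc)
          from mult_right_mono[OF this, of "indicator (ball 0 1) x"]
          show "ennreal ((cmod (f (r *\<^sub>R sgn x)))\<^sup>2) * indicator (ball 0 1) x \<le> ennreal (K\<^sup>2) * (ennreal (1 / cmod (1 - (b * r) * sgn (x::'n cvec) $ k) ^ (2 * m)) * indicator (ball 0 1) x)"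
            by (simp add: mult.assoc)
        qed
        also have "\<dots> = ennreal (K\<^sup>2) * (\<integral>\<^sup>+x. ennreal (1 / cmod (1 - (b * r) * sgn (x::'n cvec) $ k) ^ (2 * m)) * indicator (ball 0 1) x \<partial>lborel)"
          by (rule nn_integral_cmult) measurable
        also have "\<dots> \<le> ennreal (K\<^sup>2) * ennreal (C * (1 - cmod (b * r)) ^ CARD('n) / (1 - cmod (b * r)) ^ (2 * m))"
          by (intro mult_left_mono C b') simp
        also have "(1 - cmod (b * r)) ^ CARD('n) / (1 - cmod (b * r)) ^ (2 * m) = (1 - cmod (b * r)) powr (s - 2 * real m)"
          using pos unfolding 1 by (simp add: powr_diff powr_realpow[symmetric])
        then have "C * (1 - cmod (b * r)) ^ CARD('n) / (1 - cmod (b * r)) ^ (2 * m) = C * (1 - cmod (b * r)) powr (s - 2 * real m)"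
          by (metis times_divide_eq_right)
        also have "\<dots> \<le> C * (1 - cmod b) powr (s - 2 * real m)"
          using br b C m(2) by (intro mult_left_mono powr_mono2') auto
        finally have "(\<integral>\<^sup>+x. ennreal ((cmod (f (r *\<^sub>R sgn x)))\<^sup>2) * indicator (ball 0 1) x \<partial>lborel)
            \<le> ennreal (K\<^sup>2) * ennreal (C * (1 - cmod b) powr (s - 2 * real m))" by (simp add: ennreal_leI mult_left_mono)
        then have "sphere_nnint (\<lambda>\<zeta>. ennreal ((cmod (f (r *\<^sub>R \<zeta>)))\<^sup>2)) \<le> ennreal (K\<^sup>2) * ennreal (C * (1 - cmod b) powr (s - 2 * real m)) / ennreal V"
          unfolding sphere_nnint_def V(2) by (rule divide_right_mono_ennreal)
        also have "\<dots> = ennreal (C / V * K\<^sup>2 * (1 - cmod b) powr (s - 2 * real m))"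
          using C V by (simp add: ennreal_mult[symmetric] divide_ennreal mult_ac)
        finally show ?thesis .
      qed
      then show "Nsq f \<le> ennreal (C / V * K\<^sup>2 * (1 - cmod b) powr (s - 2 * real m))"
        unfolding 1(1) H2_sqnorm_def by (intro SUP_least) auto
    qed
  next
    case (2 \<alpha>)
    obtain C where C: "C > 0" "\<And>b. cmod b < 1 \<Longrightarrow>
      (\<integral>\<^sup>+z. ennreal (1 / cmod (1 - b * (z::'n cvec) $ k) ^ (2 * m) * (1 - (norm z)\<^sup>2) powr \<alpha>) * indicator (ball 0 1) z \<partial>lborel)
      \<le> ennreal (C * (1 - cmod b) powr (real CARD('n) + 1 + \<alpha> - real (2 * m)))"
      by (rule weighted_kernel_integral_le[of \<alpha> "2 * m" k]) (use 2 m in auto)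
    define B where "B = bergman_const CARD('n) \<alpha>"
    have B: "B > 0" unfolding B_def by (rule bergman_const_pos[OF 2(1)])
    show thesis
    proof (rule that[of "C * B / V"])
      show "C * B / V > 0" using C V B by simp
      fix b :: complex and K :: real and f :: "'n cvec \<Rightarrow> complex"
      assume b: "cmod b < 1" and K: "K \<ge> 0"
        and f: "\<And>z. z \<in> unit_ball \<Longrightarrow> cmod (f z) \<le> K / cmod (1 - b * z $ k) ^ m"
      let ?k = "\<lambda>z::'n cvec. 1 / cmod (1 - b * z $ k) ^ (2 * m) * (1 - (norm z)\<^sup>2) powr \<alpha>"
      have "(\<integral>\<^sup>+z. ennreal ((cmod (f z))\<^sup>2 * B * (1 - (norm z)\<^sup>2) powr \<alpha>) * indicator (ball 0 1) z \<partial>lborel)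
         \<le> (\<integral>\<^sup>+z. ennreal (K\<^sup>2 * B) * (ennreal (?k z) * indicator (ball 0 1) z) \<partial>lborel)"
      proof (rule nn_integral_mono)
        fix z :: "'n cvec"
        show "ennreal ((cmod (f z))\<^sup>2 * B * (1 - (norm z)\<^sup>2) powr \<alpha>) * indicator (ball 0 1) z
           \<le> ennreal (K\<^sup>2 * B) * (ennreal (?k z) * indicator (ball 0 1) z)"
        proof (cases "z \<in> ball 0 1")
          case True
          have "(cmod (f z))\<^sup>2 * (B * (1 - (norm z)\<^sup>2) powr \<alpha>) \<le> K\<^sup>2 * (1 / cmod (1 - b * z $ k) ^ (2 * m)) * (B * (1 - (norm z)\<^sup>2) powr \<alpha>)"
            using B by (intro mult_right_mono sq[of f z] f True) auto
          then have "ennreal ((cmod (f z))\<^sup>2 * B * (1 - (norm z)\<^sup>2) powr \<alpha>) \<le> ennreal (K\<^sup>2 * B) * ennreal (?k z)"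
            using B by (subst ennreal_mult[symmetric]) (auto intro!: ennreal_leI simp: mult_ac)
          then show ?thesis using True by simp
        qed simp
      qed
      also have "\<dots> = ennreal (K\<^sup>2 * B) * (\<integral>\<^sup>+z. ennreal (?k z) * indicator (ball 0 1) z \<partial>lborel)"
        by (rule nn_integral_cmult) measurable
      also have "\<dots> \<le> ennreal (K\<^sup>2 * B) * ennreal (C * (1 - cmod b) powr (real CARD('n) + 1 + \<alpha> - real (2 * m)))"
        by (intro mult_left_mono C b) simp
      finally have "Nsq f \<le> ennreal (K\<^sup>2 * B) * ennreal (C * (1 - cmod b) powr (real CARD('n) + 1 + \<alpha> - real (2 * m))) / ennreal V"
        unfolding 2(2) A2_sqnorm_def V(2) B_def[symmetric] by (rule divide_right_mono_ennreal)
      also have "\<dots> = ennreal (C * B / V * K\<^sup>2 * (1 - cmod b) powr (s - 2 * real m))"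
        using C V B unfolding 2(3) by (simp add: ennreal_mult[symmetric] divide_ennreal mult_ac)
      finally show "Nsq f \<le> ennreal (C * B / V * K\<^sup>2 * (1 - cmod b) powr (s - 2 * real m))" .
    qed
  qed
qed

section \<open>Lower bounds and pointwise limits\<close>

text \<open>Both norms become suprema of weighted \<open>L^2\<close> integrals, so that limit
  arguments are made once. For the Hardy space the index is the radius and \<gamma> projects to that
  sphere; for the Bergman space there is one index and \<open>W\<close> carries the density. The
  condition on \<open>W\<close> keeps points outside the ball out of the integrals.\<close>

lemma space_exponent_rep:
  fixes Nsq :: "('n::finite cvec \<Rightarrow> complex) \<Rightarrow> ennreal"
  assumes "space_exponent Nsq s"
  obtains I :: "real set" and \<gamma> :: "real \<Rightarrow> 'n cvec \<Rightarrow> 'n cvec" and W :: "real \<Rightarrow> 'n cvec \<Rightarrow> ennreal" and V :: real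
  where "V > 0" "\<And>i. \<gamma> i \<in> borel_measurable borel" "\<And>i. W i \<in> borel_measurable borel"
    "\<And>i x. i \<in> I \<Longrightarrow> W i x \<noteq> 0 \<Longrightarrow> \<gamma> i x \<in> unit_ball"
    "\<And>f. Nsq f = (SUP i\<in>I. (\<integral>\<^sup>+x. ennreal ((cmod (f (\<gamma> i x)))\<^sup>2) * W i x \<partial>lborel) / ennreal V)"
proof -
  obtain V where V: "V > 0" "emeasure lborel (ball 0 1 :: 'n cvec set) = ennreal V"
    by (rule emeasure_unit_ball_cvec)
  from assms consider "Nsq = H2_sqnorm" | \<alpha> where "\<alpha> > -1" "Nsq = A2_sqnorm \<alpha>"
    unfolding space_exponent_def by blast
  then show thesis
  proof cases
    case 1
    show thesis
    proof (rule that[of V "\<lambda>r x. r *\<^sub>R sgn x" "\<lambda>r x. indicator (ball 0 1) x" "{0<..<1}"])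
      show "r *\<^sub>R sgn x \<in> unit_ball" if "r \<in> {0<..<1}" for r and x :: "'n cvec"
        using that by (simp add: norm_sgn)
      show "Nsq f = (SUP i\<in>{0<..<1}. (\<integral>\<^sup>+x. ennreal ((cmod (f (i *\<^sub>R sgn x)))\<^sup>2) * indicator (ball 0 1) x \<partial>lborel) / ennreal V)" for f
        unfolding 1 H2_sqnorm_def sphere_nnint_def V(2) ..
    qed (use V in measurable)
  next
    case (2 \<alpha>)
    define B where "B = bergman_const CARD('n) \<alpha>"
    have B: "B > 0" unfolding B_def by (rule bergman_const_pos[OF 2(1)])
    show thesis
    proof (rule that[of V "\<lambda>r x. x" "\<lambda>r x. ennreal (B * (1 - (norm x)\<^sup>2) powr \<alpha>) * indicator (ball 0 1) x" "{0}"])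
      show "x \<in> unit_ball" if "ennreal (B * (1 - (norm x)\<^sup>2) powr \<alpha>) * indicator (ball 0 1) x \<noteq> 0" for x :: "'n cvec"
        using that by (cases "x \<in> ball 0 1") auto
      show "Nsq f = (SUP i\<in>{0}. (\<integral>\<^sup>+x. ennreal ((cmod (f x))\<^sup>2) * (ennreal (B * (1 - (norm x)\<^sup>2) powr \<alpha>) * indicator (ball 0 1) x) \<partial>lborel) / ennreal V)" for f
        unfolding 2 A2_sqnorm_def V(2) B_def[symmetric]
        using B by (simp add: ennreal_mult[symmetric] mult.assoc[symmetric])
    qed (use V in measurable)
  qed
qed

lemma ennreal_of_divide_le:
  assumes "V > 0" "A / ennreal V \<le> B" shows "A \<le> ennreal V * B"
proof -
  have "ennreal V * (A / ennreal V) = A"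
    using assms(1) by (metis ennreal_eq_0_iff ennreal_neq_top ennreal_times_divide mult.commute mult_divide_eq_ennreal not_le)
  then show ?thesis using mult_left_mono[OF assms(2), of "ennreal V"] by simp
qed

lemma cmod_diff_sq_bound: "(cmod a)\<^sup>2 \<le> 2 * (cmod (a - b))\<^sup>2 + 2 * (cmod b)\<^sup>2"
proof -
  have "cmod a \<le> cmod (a - b) + cmod b" using norm_triangle_ineq[of "a - b" b] by simp
  then have "(cmod a)\<^sup>2 \<le> (cmod (a - b) + cmod b)\<^sup>2" by (rule power_mono) simp
  also have "\<dots> \<le> 2 * (cmod (a - b))\<^sup>2 + 2 * (cmod b)\<^sup>2"
    using sum_squares_bound[of "cmod (a - b)" "cmod b"] by (simp add: power2_sum)
  finally show ?thesis .
qed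

text \<open>For each index, Fatou's lemma applied to \<open>h j - g\<close> bounds the integral of
  \<open>|g|^2\<close> by a multiple of the limit of \<open>Nsq (h j - g)\<close>, which is 0. With
  \<open>g\<close> of norm zero, \<open>|h|^2 \<le> 2 |h - g|^2 + 2 |g|^2\<close> transfers the
  convergence to \<open>h j\<close>.\<close>

lemma sqnorm_tendsto_0_of_pointwise:
  fixes Nsq :: "('n::finite cvec \<Rightarrow> complex) \<Rightarrow> ennreal" and h :: "nat \<Rightarrow> 'n cvec \<Rightarrow> complex"
  assumes Nsq: "space_exponent Nsq s"
    and h: "\<And>j. continuous_on unit_ball (h j)" and g: "continuous_on unit_ball g"
    and pw: "\<And>z. z \<in> unit_ball \<Longrightarrow> (\<lambda>j. h j z) \<longlonglongrightarrow> 0"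
    and lim: "(\<lambda>j. Nsq (h j - g)) \<longlonglongrightarrow> 0"
  shows "(\<lambda>j. Nsq (h j)) \<longlonglongrightarrow> 0"
proof -
  obtain I :: "real set" and \<gamma> :: "real \<Rightarrow> 'n cvec \<Rightarrow> 'n cvec" and W :: "real \<Rightarrow> 'n cvec \<Rightarrow> ennreal" and V :: real where V: "V > 0"
    and [measurable]: "\<And>i. \<gamma> i \<in> borel_measurable borel" "\<And>i. W i \<in> borel_measurable borel"
    and W: "\<And>i x. i \<in> I \<Longrightarrow> W i x \<noteq> 0 \<Longrightarrow> \<gamma> i x \<in> (unit_ball :: 'n cvec set)"
    and rep: "\<And>f. Nsq f = (SUP i\<in>I. (\<integral>\<^sup>+x. ennreal ((cmod (f (\<gamma> i x)))\<^sup>2) * W i x \<partial>lborel) / ennreal V)"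
    by (rule space_exponent_rep[OF Nsq]) (rule that)
  have meas: "(\<lambda>x. ennreal ((cmod (f (\<gamma> i x)))\<^sup>2) * W i x) \<in> borel_measurable lborel"
    if i: "i \<in> I" and f: "continuous_on unit_ball f" for i and f :: "'n cvec \<Rightarrow> complex"
  proof -
    \<comment> \<open>\<open>f\<close> is controlled only on the ball. Cut off by the indicator it
      is Borel, and the cut-off is invisible wherever \<open>W i\<close> is nonzero.\<close>
    have [measurable]: "(\<lambda>y. indicator unit_ball y *\<^sub>R f y) \<in> borel_measurable borel"
      by (rule borel_measurable_continuous_on_indicator[OF _ f]) simp
    have "(\<lambda>x. ennreal ((cmod (f (\<gamma> i x)))\<^sup>2) * W i x)
        = (\<lambda>x. ennreal ((cmod ((\<lambda>y. indicator unit_ball y *\<^sub>R f y) (\<gamma> i x)))\<^sup>2) * W i x)"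
    proof
      fix x show "ennreal ((cmod (f (\<gamma> i x)))\<^sup>2) * W i x
        = ennreal ((cmod ((\<lambda>y. indicator unit_ball y *\<^sub>R f y) (\<gamma> i x)))\<^sup>2) * W i x"
        using W[OF i, of x] by (cases "W i x = 0") auto
    qed
    also have "\<dots> \<in> borel_measurable lborel" by measurable
    finally show ?thesis .
  qed
  have le: "(\<integral>\<^sup>+x. ennreal ((cmod (f (\<gamma> i x)))\<^sup>2) * W i x \<partial>lborel) \<le> ennreal V * Nsq f" if "i \<in> I" for i f
    by (rule ennreal_of_divide_le[OF V]) (unfold rep, rule SUP_upper[OF that])
  have hg: "continuous_on unit_ball (h j - g)" for j
    using continuous_on_diff[OF h[of j] g] by (simp add: fun_diff_def)
  have g0: "(\<integral>\<^sup>+x. ennreal ((cmod (g (\<gamma> i x)))\<^sup>2) * W i x \<partial>lborel) = 0" if i: "i \<in> I" for i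
  proof -
    have "(\<integral>\<^sup>+x. ennreal ((cmod (g (\<gamma> i x)))\<^sup>2) * W i x \<partial>lborel)
       \<le> (\<integral>\<^sup>+x. liminf (\<lambda>j. ennreal ((cmod ((h j - g) (\<gamma> i x)))\<^sup>2) * W i x) \<partial>lborel)"
    proof (rule nn_integral_mono)
      fix x
      show "ennreal ((cmod (g (\<gamma> i x)))\<^sup>2) * W i x \<le> liminf (\<lambda>j. ennreal ((cmod ((h j - g) (\<gamma> i x)))\<^sup>2) * W i x)"
      proof (cases "W i x = 0")
        case False
        have "(\<lambda>j. (cmod (h j (\<gamma> i x) - g (\<gamma> i x)))\<^sup>2) \<longlonglongrightarrow> (cmod (0 - g (\<gamma> i x)))\<^sup>2"
          by (intro tendsto_intros pw W[OF i False])
        then have l1: "(\<lambda>j. ennreal ((cmod ((h j - g) (\<gamma> i x)))\<^sup>2)) \<longlonglongrightarrow> ennreal ((cmod (g (\<gamma> i x)))\<^sup>2)"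
          by (intro tendsto_ennrealI) (simp add: fun_diff_def)
        \<comment> \<open>Nothing bounds \<open>W i x\<close>, and multiplication in
          \<open>ennreal\<close> is discontinuous at \<open>0 * top\<close>; where \<open>g\<close>
          vanishes the inequality is trivial.\<close>
        show ?thesis
        proof (cases "g (\<gamma> i x) = 0")
          case False
          then have "(\<lambda>j. ennreal ((cmod ((h j - g) (\<gamma> i x)))\<^sup>2) * W i x) \<longlonglongrightarrow> ennreal ((cmod (g (\<gamma> i x)))\<^sup>2) * W i x"
            by (intro tendsto_mult_ennreal l1 tendsto_const) auto
          then show ?thesis by (simp add: lim_imp_Liminf)
        qed simp
      qed simp
    qed
    also have "\<dots> \<le> liminf (\<lambda>j. \<integral>\<^sup>+x. ennreal ((cmod ((h j - g) (\<gamma> i x)))\<^sup>2) * W i x \<partial>lborel)"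
      by (rule nn_integral_liminf) (rule meas[OF i hg])
    also have "\<dots> \<le> liminf (\<lambda>j. ennreal V * Nsq (h j - g))"
      by (intro Liminf_mono always_eventually allI le i)
    also have "(\<lambda>j. ennreal V * Nsq (h j - g)) \<longlonglongrightarrow> ennreal V * 0"
      by (intro tendsto_mult_ennreal lim tendsto_const) (use V in auto)
    then have "liminf (\<lambda>j. ennreal V * Nsq (h j - g)) = 0"
      by (simp add: lim_imp_Liminf)
    finally show ?thesis by simp
  qed
  have bound: "Nsq (h j) \<le> 2 * Nsq (h j - g)" for j
  proof -
    have "(\<integral>\<^sup>+x. ennreal ((cmod (h j (\<gamma> i x)))\<^sup>2) * W i x \<partial>lborel) / ennreal V \<le> 2 * Nsq (h j - g)" if i: "i \<in> I" for i
    proof -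
      let ?a = "\<lambda>x. ennreal ((cmod ((h j - g) (\<gamma> i x)))\<^sup>2) * W i x"
      let ?b = "\<lambda>x. ennreal ((cmod (g (\<gamma> i x)))\<^sup>2) * W i x"
      have "(\<integral>\<^sup>+x. ennreal ((cmod (h j (\<gamma> i x)))\<^sup>2) * W i x \<partial>lborel) \<le> (\<integral>\<^sup>+x. 2 * ?a x + 2 * ?b x \<partial>lborel)"
      proof (rule nn_integral_mono)
        fix x
        have "ennreal ((cmod (h j (\<gamma> i x)))\<^sup>2) \<le> ennreal (2 * (cmod ((h j - g) (\<gamma> i x)))\<^sup>2 + 2 * (cmod (g (\<gamma> i x)))\<^sup>2)"
          by (intro ennreal_leI) (simp add: cmod_diff_sq_bound)
        also have "\<dots> = 2 * ennreal ((cmod ((h j - g) (\<gamma> i x)))\<^sup>2) + 2 * ennreal ((cmod (g (\<gamma> i x)))\<^sup>2)"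
          by (simp add: ennreal_plus ennreal_mult')
        finally have "ennreal ((cmod (h j (\<gamma> i x)))\<^sup>2) * W i x \<le> (2 * ennreal ((cmod ((h j - g) (\<gamma> i x)))\<^sup>2) + 2 * ennreal ((cmod (g (\<gamma> i x)))\<^sup>2)) * W i x"
          by (rule mult_right_mono) simp
        then show "ennreal ((cmod (h j (\<gamma> i x)))\<^sup>2) * W i x \<le> 2 * ?a x + 2 * ?b x"
          by (simp add: distrib_right mult.assoc)
      qed
      also have "\<dots> = 2 * (\<integral>\<^sup>+x. ?a x \<partial>lborel) + 2 * (\<integral>\<^sup>+x. ?b x \<partial>lborel)"
      proof -
        have "(\<integral>\<^sup>+x. 2 * a x + 2 * b x \<partial>lborel) = 2 * (\<integral>\<^sup>+x. a x \<partial>lborel) + 2 * (\<integral>\<^sup>+x. b x \<partial>lborel)"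
          if "a \<in> borel_measurable lborel" "b \<in> borel_measurable lborel" for a b :: "'n cvec \<Rightarrow> ennreal"
          using that by (simp add: nn_integral_add nn_integral_cmult)
        from this[OF meas[OF i hg[of j]] meas[OF i g]] show ?thesis .
      qed
      also have "\<dots> = 2 * (\<integral>\<^sup>+x. ?a x \<partial>lborel)" using g0[OF i] by simp
      finally have "(\<integral>\<^sup>+x. ennreal ((cmod (h j (\<gamma> i x)))\<^sup>2) * W i x \<partial>lborel) / ennreal V \<le> 2 * (\<integral>\<^sup>+x. ?a x \<partial>lborel) / ennreal V"
        by (rule divide_right_mono_ennreal)
      also have "\<dots> = 2 * ((\<integral>\<^sup>+x. ?a x \<partial>lborel) / ennreal V)" by (simp only: ennreal_times_divide)
      also have "\<dots> \<le> 2 * Nsq (h j - g)"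
        unfolding rep[of "h j - g"] by (intro mult_left_mono SUP_upper i) simp
      finally show ?thesis .
    qed
    then show ?thesis unfolding rep[of "h j"] by (intro SUP_least)
  qed
  have "(\<lambda>j. 2 * Nsq (h j - g)) \<longlonglongrightarrow> 2 * 0"
    by (intro tendsto_mult_ennreal lim tendsto_const) auto
  then have "(\<lambda>j. 2 * Nsq (h j - g)) \<longlonglongrightarrow> 0" by simp
  then show ?thesis
    by (rule tendsto_sandwich[OF always_eventually always_eventually tendsto_const, rotated 2]) (simp_all add: bound)
qed

text \<open>In the Bergman case the volume \<open>t^(2 N + 2)\<close> times the weight
  \<open>t^(2 \<alpha>)\<close> gives \<open>t^(2 s)\<close>. In the Hardy case \<open>Q\<close>
  meets only spheres with radii in an interval of length at most \<open>c2 t^2\<close>, and each of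
  them contributes at most a constant times \<open>Nsq F\<close>; the volume bound therefore loses a
  factor \<open>t^2\<close> and leaves \<open>t^(2 N)\<close>.\<close>

lemma sqnorm_ge_of_lower_bound_on_set:
  fixes Nsq :: "('n::finite cvec \<Rightarrow> complex) \<Rightarrow> ennreal"
  assumes Nsq: "space_exponent Nsq s" and c012: "c0 > 0" "c1 > 0" "c2 > 0"
  obtains c where "c > 0" "\<And>t \<kappa> F Q. t > 0 \<Longrightarrow> \<kappa> \<ge> 0 \<Longrightarrow> Q \<in> sets borel \<Longrightarrow>
      ennreal (c0 * t ^ (2 * CARD('n) + 2)) \<le> emeasure lborel Q \<Longrightarrow>
      (\<And>z. z \<in> Q \<Longrightarrow> c1 * t\<^sup>2 \<le> 1 - (norm z)\<^sup>2 \<and> 1 - (norm z)\<^sup>2 \<le> c2 * t\<^sup>2) \<Longrightarrow>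
      (\<And>z. z \<in> Q \<Longrightarrow> \<kappa> \<le> cmod (F z)) \<Longrightarrow> ennreal (c * \<kappa>\<^sup>2 * t powr (2 * s)) \<le> Nsq F"
proof -
  obtain V where V: "V > 0" "emeasure lborel (ball 0 1 :: 'n cvec set) = ennreal V"
    by (rule emeasure_unit_ball_cvec)
  from Nsq consider "Nsq = H2_sqnorm" "s = real CARD('n)"
    | \<alpha> where "\<alpha> > -1" "Nsq = A2_sqnorm \<alpha>" "s = real CARD('n) + 1 + \<alpha>"
    unfolding space_exponent_def by blast
  then show thesis
  proof cases
    case 1
    define n where "n = DIM('n cvec)"
    have n: "n > 0" unfolding n_def by simp
    show thesis
    proof (rule that[of "c0 / (real n * V * c2)"])
      show "c0 / (real n * V * c2) > 0" using n V c012 by simp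
      fix t \<kappa> :: real and F :: "'n cvec \<Rightarrow> complex" and Q
      assume t: "t > 0" and \<kappa>: "\<kappa> \<ge> 0" and [measurable]: "Q \<in> sets borel"
        and vol: "ennreal (c0 * t ^ (2 * CARD('n) + 2)) \<le> emeasure lborel Q"
        and Q: "\<And>z. z \<in> Q \<Longrightarrow> c1 * t\<^sup>2 \<le> 1 - (norm z)\<^sup>2 \<and> 1 - (norm z)\<^sup>2 \<le> c2 * t\<^sup>2"
        and F: "\<And>z. z \<in> Q \<Longrightarrow> \<kappa> \<le> cmod (F z)"
      let ?G = "\<lambda>z. ennreal (\<kappa>\<^sup>2) * indicator Q z"
      \<comment> \<open>Other spheres miss \<open>Q\<close>: on a sphere meeting \<open>Q\<close>,
        \<open>\<rho> < 1\<close> and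
        \<open>1 - \<rho> \<le> 1 - \<rho>\<^sup>2 \<le> c2 * t\<^sup>2\<close>.\<close>
      have inner: "(\<integral>\<^sup>+x. ?G (\<rho> *\<^sub>R sgn x) * indicator (ball 0 1) x \<partial>lborel) \<le> ennreal V * Nsq F * indicator {1 - c2 * t\<^sup>2..1} \<rho>"
        if \<rho>: "\<rho> > 0" for \<rho>
      proof (cases "1 - c2 * t\<^sup>2 \<le> \<rho> \<and> \<rho> < 1")
        case True
        have "(\<integral>\<^sup>+x. ?G (\<rho> *\<^sub>R sgn x) * indicator (ball 0 1) x \<partial>lborel)
           \<le> (\<integral>\<^sup>+x. ennreal ((cmod (F (\<rho> *\<^sub>R sgn x)))\<^sup>2) * indicator (ball 0 1) x \<partial>lborel)"
        proof (intro nn_integral_mono mult_right_mono)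
          fix x :: "'n cvec"
          show "?G (\<rho> *\<^sub>R sgn x) \<le> ennreal ((cmod (F (\<rho> *\<^sub>R sgn x)))\<^sup>2)"
            using F[of "\<rho> *\<^sub>R sgn x"] \<kappa> by (auto simp: indicator_def intro!: ennreal_leI power_mono)
        qed simp
        also have "\<dots> \<le> ennreal V * Nsq F"
        proof (rule ennreal_of_divide_le[OF V(1)])
          have "sphere_nnint (\<lambda>\<zeta>. ennreal ((cmod (F (\<rho> *\<^sub>R \<zeta>)))\<^sup>2)) \<le> Nsq F"
            unfolding 1 H2_sqnorm_def by (rule SUP_upper) (use \<rho> True in auto)
          then show "(\<integral>\<^sup>+x. ennreal ((cmod (F (\<rho> *\<^sub>R sgn x)))\<^sup>2) * indicator (ball 0 1) x \<partial>lborel) / ennreal V \<le> Nsq F"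
            unfolding sphere_nnint_def V(2) .
        qed
        finally show ?thesis using True by simp
      next
        case False
        have "(\<integral>\<^sup>+x. ?G (\<rho> *\<^sub>R sgn x) * indicator (ball 0 1) x \<partial>lborel) = (\<integral>\<^sup>+x. 0 \<partial>(lborel :: 'n cvec measure))"
        proof (intro nn_integral_cong_AE)
          have "AE x in lborel. x \<noteq> (0::'n cvec)" by (rule AE_lborel_singleton)
          then show "AE x in lborel. ?G (\<rho> *\<^sub>R sgn x) * indicator (ball 0 1) x = 0"
          proof eventually_elim
            fix x :: "'n cvec" assume x: "x \<noteq> 0"
            have nr: "norm (\<rho> *\<^sub>R sgn x) = \<rho>" using x \<rho> by (simp add: norm_sgn)
            have "\<rho> *\<^sub>R sgn x \<notin> Q"
            proof
              assume "\<rho> *\<^sub>R sgn x \<in> Q"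
              from Q[OF this] have q: "c1 * t\<^sup>2 \<le> 1 - \<rho>\<^sup>2" "1 - \<rho>\<^sup>2 \<le> c2 * t\<^sup>2" unfolding nr by auto
              have "c1 * t\<^sup>2 > 0" using c012 t by simp
              then have "\<rho>\<^sup>2 < 1" using q by linarith
              then have r1: "\<rho> < 1" using \<rho> by (simp add: power2_less_1_iff abs_square_less_1)
              then have "\<rho>\<^sup>2 \<le> \<rho>" using \<rho> by (simp add: power2_eq_square mult_left_le)
              then show False using False r1 q by simp
            qed
            then show "?G (\<rho> *\<^sub>R sgn x) * indicator (ball 0 1) x = 0" by simp
          qed
        qed
        then show ?thesis by simp
      qed
      have "ennreal (\<kappa>\<^sup>2) * ennreal (c0 * t ^ (2 * CARD('n) + 2)) \<le> ennreal (\<kappa>\<^sup>2) * emeasure lborel Q"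
        by (rule mult_left_mono[OF vol]) simp
      also have "\<dots> = (\<integral>\<^sup>+z. ?G z \<partial>lborel)" by (rule nn_integral_cmult_indicator[symmetric]) simp
      also have "\<dots> = (\<integral>\<^sup>+\<rho>. ennreal (real n * \<rho> ^ (n - 1)) * indicator {0<..} \<rho> *
          (\<integral>\<^sup>+x. ?G (\<rho> *\<^sub>R sgn x) * indicator (ball 0 1) x \<partial>lborel) \<partial>lborel)"
        unfolding n_def by (rule nn_integral_polar) measurable
      also have "\<dots> \<le> (\<integral>\<^sup>+\<rho>. (ennreal (real n) * (ennreal V * Nsq F)) * indicator {1 - c2 * t\<^sup>2..1} \<rho> \<partial>lborel)"
      proof (rule nn_integral_mono)
        fix \<rho> :: real
        show "ennreal (real n * \<rho> ^ (n - 1)) * indicator {0<..} \<rho> *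
          (\<integral>\<^sup>+x. ?G (\<rho> *\<^sub>R sgn x) * indicator (ball 0 1) x \<partial>lborel)
          \<le> (ennreal (real n) * (ennreal V * Nsq F)) * indicator {1 - c2 * t\<^sup>2..1} \<rho>"
        proof (cases "\<rho> > 0")
          case True
          show ?thesis
          proof (cases "\<rho> \<le> 1")
            case le1: True
            have "real n * \<rho> ^ (n - 1) \<le> real n" using True le1 by (simp add: mult_left_le power_le_one)
            then have "ennreal (real n * \<rho> ^ (n - 1)) * (\<integral>\<^sup>+x. ?G (\<rho> *\<^sub>R sgn x) * indicator (ball 0 1) x \<partial>lborel)
              \<le> ennreal (real n) * (ennreal V * Nsq F * indicator {1 - c2 * t\<^sup>2..1} \<rho>)"
              by (intro mult_mono inner True ennreal_leI) auto
            then show ?thesis using True by (simp add: mult.assoc)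
          next
            case gt1: False
            then have "indicator {1 - c2 * t\<^sup>2..1} \<rho> = (0::ennreal)" by simp
            then have "(\<integral>\<^sup>+x. ?G (\<rho> *\<^sub>R sgn x) * indicator (ball 0 1) x \<partial>lborel) = 0"
              using inner[OF True] by simp
            then show ?thesis by simp
          qed
        qed simp
      qed
      also have "\<dots> = (ennreal (real n) * (ennreal V * Nsq F)) * ennreal (c2 * t\<^sup>2)"
        using c012 by (subst nn_integral_cmult_indicator) auto
      finally have main: "ennreal (\<kappa>\<^sup>2) * ennreal (c0 * t ^ (2 * CARD('n) + 2)) \<le> (ennreal (real n) * (ennreal V * Nsq F)) * ennreal (c2 * t\<^sup>2)" .
      show "ennreal (c0 / (real n * V * c2) * \<kappa>\<^sup>2 * t powr (2 * s)) \<le> Nsq F"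
      proof (cases "Nsq F")
        case (real h)
        then have "ennreal (\<kappa>\<^sup>2 * (c0 * t ^ (2 * CARD('n) + 2))) \<le> ennreal (real n * (V * h) * (c2 * t\<^sup>2))"
          using main c012 t V by (simp add: ennreal_mult)
        then have "\<kappa>\<^sup>2 * (c0 * t ^ (2 * CARD('n) + 2)) \<le> real n * (V * h) * (c2 * t\<^sup>2)"
          using real V c012 by (subst (asm) ennreal_le_iff) auto
        then have "(\<kappa>\<^sup>2 * (c0 * t ^ (2 * CARD('n)))) * t\<^sup>2 \<le> (real n * V * c2 * h) * t\<^sup>2"
          by (simp add: power_add mult_ac power2_eq_square)
        then have "\<kappa>\<^sup>2 * (c0 * t ^ (2 * CARD('n))) \<le> real n * V * c2 * h" using t by simp
        then have "c0 * \<kappa>\<^sup>2 * t ^ (2 * CARD('n)) / (real n * V * c2) \<le> h"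
          using n V c012 by (simp add: divide_le_eq mult_ac)
        moreover have "t powr (2 * s) = t ^ (2 * CARD('n))"
          unfolding 1 using t by (subst powr_realpow[symmetric]) auto
        ultimately show ?thesis unfolding real by (intro ennreal_leI) simp
      qed simp
    qed
  next
    case (2 \<alpha>)
    define B where "B = bergman_const CARD('n) \<alpha>"
    have B: "B > 0" unfolding B_def by (rule bergman_const_pos[OF 2(1)])
    \<comment> \<open>The smallest weight is attained at one end of the range of
      \<open>1 - |z|^2\<close>, and which end depends on the sign of \<alpha>; the minimum serves
      both cases.\<close>
    define w where "w = min (c1 powr \<alpha>) (c2 powr \<alpha>)"
    have w: "w > 0" unfolding w_def using c012 by simp
    show thesis
    proof (rule that[of "w * B * c0 / V"])
      show "w * B * c0 / V > 0" using w B V c012 by simp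
      fix t \<kappa> :: real and F :: "'n cvec \<Rightarrow> complex" and Q
      assume t: "t > 0" and \<kappa>: "\<kappa> \<ge> 0" and [measurable]: "Q \<in> sets borel"
        and vol: "ennreal (c0 * t ^ (2 * CARD('n) + 2)) \<le> emeasure lborel Q"
        and Q: "\<And>z. z \<in> Q \<Longrightarrow> c1 * t\<^sup>2 \<le> 1 - (norm z)\<^sup>2 \<and> 1 - (norm z)\<^sup>2 \<le> c2 * t\<^sup>2"
        and F: "\<And>z. z \<in> Q \<Longrightarrow> \<kappa> \<le> cmod (F z)"
      define A where "A = \<kappa>\<^sup>2 * B * (w * t powr (2 * \<alpha>))"
      have A: "A \<ge> 0" unfolding A_def using B w by simp
      have pt: "A \<le> (cmod (F z))\<^sup>2 * B * (1 - (norm z)\<^sup>2) powr \<alpha>" if "z \<in> Q" for z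
      proof -
        have "w * t powr (2 * \<alpha>) \<le> (1 - (norm z)\<^sup>2) powr \<alpha>"
        proof -
          have e: "(c * t\<^sup>2) powr \<alpha> = c powr \<alpha> * t powr (2 * \<alpha>)" if "c > 0" for c
            using that t by (simp add: powr_mult powr_powr[symmetric] powr_numeral)
          have p1: "c1 * t\<^sup>2 > 0" using c012 t by simp
          show ?thesis
          proof (cases "\<alpha> \<ge> 0")
            case True
            have "w * t powr (2 * \<alpha>) \<le> c1 powr \<alpha> * t powr (2 * \<alpha>)" unfolding w_def by (intro mult_right_mono) auto
            also have "\<dots> \<le> (1 - (norm z)\<^sup>2) powr \<alpha>"
              unfolding e[OF c012(2), symmetric] using Q[OF that] p1 True by (intro powr_mono2) auto
            finally show ?thesis .
          next
            case False
            have "w * t powr (2 * \<alpha>) \<le> c2 powr \<alpha> * t powr (2 * \<alpha>)" unfolding w_def by (intro mult_right_mono) auto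
            also have "\<dots> \<le> (1 - (norm z)\<^sup>2) powr \<alpha>"
              unfolding e[OF c012(3), symmetric] using Q[OF that] p1 False by (intro powr_mono2') auto
            finally show ?thesis .
          qed
        qed
        then show ?thesis unfolding A_def using F[OF that] \<kappa> B w
          by (intro mult_mono power_mono) auto
      qed
      have sub: "Q \<subseteq> ball 0 1"
      proof
        fix z assume "z \<in> Q"
        have "c1 * t\<^sup>2 > 0" using c012 t by simp
        then have "(norm z)\<^sup>2 < 1" using Q[OF \<open>z \<in> Q\<close>] by linarith
        then show "z \<in> ball 0 1" by (simp add: power2_less_1_iff abs_square_less_1)
      qed
      have "ennreal A * ennreal (c0 * t ^ (2 * CARD('n) + 2)) \<le> ennreal A * emeasure lborel Q"
        by (rule mult_left_mono[OF vol]) simp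
      also have "\<dots> = (\<integral>\<^sup>+z. ennreal A * indicator Q z \<partial>lborel)" by (rule nn_integral_cmult_indicator[symmetric]) simp
      also have "\<dots> \<le> (\<integral>\<^sup>+z. ennreal ((cmod (F z))\<^sup>2 * B * (1 - (norm z)\<^sup>2) powr \<alpha>) * indicator (ball 0 1) z \<partial>lborel)"
        using sub pt by (intro nn_integral_mono) (auto simp: indicator_def intro!: ennreal_leI)
      finally have "ennreal A * ennreal (c0 * t ^ (2 * CARD('n) + 2)) / ennreal V \<le> Nsq F"
        unfolding 2 A2_sqnorm_def V(2) B_def by (rule divide_right_mono_ennreal)
      also have "ennreal A * ennreal (c0 * t ^ (2 * CARD('n) + 2)) / ennreal V = ennreal (A * (c0 * t ^ (2 * CARD('n) + 2)) / V)"
        using A V c012 t by (simp add: ennreal_mult[symmetric] divide_ennreal)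
      also have "A * (c0 * t ^ (2 * CARD('n) + 2)) / V = w * B * c0 / V * \<kappa>\<^sup>2 * t powr (2 * s)"
      proof -
        have "t powr (2 * s) = t powr (2 * \<alpha>) * t powr real (2 * CARD('n) + 2)"
          unfolding 2 powr_add[symmetric] by (simp add: algebra_simps)
        also have "t powr real (2 * CARD('n) + 2) = t ^ (2 * CARD('n) + 2)" using t by (rule powr_realpow)
        finally show ?thesis unfolding A_def by simp
      qed
      finally show "ennreal (w * B * c0 / V * \<kappa>\<^sup>2 * t powr (2 * s)) \<le> Nsq F" .
    qed
  qed
qed

section \<open>Parabolic maps in Siegel coordinates\<close>

lemma cinner_add_left: "cinner (x + y) c = cinner x c + cinner y c"
  unfolding cinner_def by (simp add: sum.distrib distrib_right)

lemma cinner_scale_left: "cinner (a *s x) c = a * cinner x c"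
  unfolding cinner_def by (simp add: sum_distrib_left mult.assoc)

lemma continuous_on_cinner_left: "continuous_on S (\<lambda>x. cinner x c)"
  unfolding cinner_def by (intro continuous_intros)

lemma continuous_on_matrix_vector_mult: "continuous_on S (\<lambda>x. (A :: complex^'n^'m) *v x)"
  unfolding matrix_vector_mult_def by (intro continuous_intros)

text \<open>Only the coordinate \<open>u\<close>, kept at full length with entry 0 at
  \<open>k\<close>; \<open>w\<close> is carried separately as
  \<open>1 / (1 - z $ k)\<close>.\<close>

definition siegel :: "'n::finite \<Rightarrow> 'n cvec \<Rightarrow> 'n cvec" where
  "siegel k z = (\<chi> j. if j = k then 0 else z $ j / (1 - z $ k))"

lemma unit_ball_nth_ne_1:
  assumes "z \<in> (unit_ball :: 'n::finite cvec set)" shows "1 - z $ k \<noteq> 0"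
proof
  assume "1 - z $ k = 0"
  then have "cmod (z $ k) = 1" by simp
  then show False using assms Finite_Cartesian_Product.norm_nth_le[of z k] by simp
qed

text \<open>Every linear form in \<open>z - axis k 1\<close> thus equals \<open>1 - z $ k\<close>
  times an affine function of \<open>u\<close>, which is what makes a fractional map affine in
  Siegel coordinates.\<close>

lemma siegel_affine:
  assumes "z \<in> (unit_ball :: 'n::finite cvec set)"
  shows "z - axis k 1 = (1 - z $ k) *s (siegel k z - axis k 1)"
  using unit_ball_nth_ne_1[OF assms, of k] by (auto simp: vec_eq_iff siegel_def axis_def field_simps)

lemma lf_selfmap_continuous_on:
  fixes \<phi> :: "'n::finite cvec \<Rightarrow> 'n cvec"
  assumes "lf_selfmap \<phi>"
  shows "continuous_on unit_ball \<phi>"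
proof -
  obtain A :: "complex^'n^'n" and B C :: "'n cvec" and d where
    \<phi>: "\<And>z. \<phi> z = (1 / (cinner z C + d)) *s (A *v z + B)" and nz: "\<And>z. z \<in> unit_ball \<Longrightarrow> cinner z C + d \<noteq> 0"
    using assms unfolding lf_selfmap_def by blast
  have "continuous_on unit_ball (\<lambda>z. \<chi> j. (1 / (cinner z C + d)) * (A *v z + B) $ j)"
    by (intro continuous_intros continuous_on_cinner_left continuous_on_matrix_vector_mult) (use nz in auto)
  then show ?thesis by (simp add: \<phi>[abs_def] vector_scalar_mult_def)
qed

text \<open>Expand at the fixed point \<open>e\<close>: with \<open>x = z - e\<close> the numerator
  is \<open>D e + A x\<close>, the denominator \<open>D + <x, C>\<close>, and
  \<open>1 - \<phi>_k = - \<Lambda> x / (D + <x, C>)\<close> for the linear form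
  \<open>\<Lambda> x = (A x)_k - <x, C>\<close>. The derivative condition says
  \<open>\<Lambda> e = D\<close>, and mapping the ball into itself forces \<Lambda> to vanish where
  \<open>v_k = 0\<close>. Hence \<open>\<Lambda> (z - e) = - (1 - z_k) D\<close>, and the reciprocal
  is a pure shift of \<open>w\<close> by \<open>L u\<close>.\<close>

lemma parabolic_lf_normal_form:
  fixes \<phi> :: "'n::finite cvec \<Rightarrow> 'n cvec"
  assumes par: "parabolic_lf_fixing k \<phi>"
  obtains L :: "'n cvec \<Rightarrow> complex" and G :: "'n cvec \<Rightarrow> 'n cvec"
  where "continuous_on UNIV L" "continuous_on UNIV G"
    "\<And>z. z \<in> unit_ball \<Longrightarrow> 1 / (1 - z $ k) + L (siegel k z) \<noteq> 0"
    "\<And>z. z \<in> unit_ball \<Longrightarrow> 1 - \<phi> z $ k = 1 / (1 / (1 - z $ k) + L (siegel k z))"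
    "\<And>z j. z \<in> unit_ball \<Longrightarrow> j \<noteq> k \<Longrightarrow> \<phi> z $ j = G (siegel k z) $ j / (1 / (1 - z $ k) + L (siegel k z))"
proof -
  let ?e = "axis k 1 :: 'n cvec"
  have "lf_selfmap \<phi>" using par unfolding parabolic_lf_fixing_def by blast
  then obtain A :: "complex^'n^'n" and B C :: "'n cvec" and d where
    \<phi>: "\<And>z. \<phi> z = (1 / (cinner z C + d)) *s (A *v z + B)"
    and nz: "\<And>z. z \<in> unit_ball \<Longrightarrow> cinner z C + d \<noteq> 0" and self: "\<phi> ` unit_ball \<subseteq> unit_ball"
    unfolding lf_selfmap_def by blast
  have fix_e: "\<phi> ?e = ?e" and der: "((\<lambda>t. \<phi> (?e + t *s ?e) $ k) has_field_derivative 1) (at 0)"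
    using par unfolding parabolic_lf_fixing_def by blast+
  define D where "D = cinner ?e C + d"
  have D: "D \<noteq> 0"
  proof
    assume "D = 0"
    then have "\<phi> ?e = 0" unfolding \<phi> D_def by simp
    then have "?e $ k = 0" using fix_e by simp
    then show False by simp
  qed
  have ne: "A *v ?e + B = D *s ?e"
  proof -
    have "D *s \<phi> ?e = A *v ?e + B" unfolding \<phi> D_def[symmetric] using D by (simp add: vec_eq_iff)
    then show ?thesis using fix_e by simp
  qed
  have den: "cinner (?e + x) C + d = D + cinner x C" for x
    unfolding D_def by (simp add: cinner_add_left)
  have num: "A *v (?e + x) + B = D *s ?e + A *v x" for x
    using ne by (simp add: matrix_vector_right_distrib algebra_simps)
  have \<phi>e: "\<phi> (?e + x) $ j = ((if j = k then D else 0) + (A *v x) $ j) / (D + cinner x C)" for x j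
    unfolding \<phi> den num by (simp add: axis_def add_divide_distrib)
  define \<Lambda> where "\<Lambda> x = (A *v x) $ k - cinner x C" for x
  have \<Lambda>_add: "\<Lambda> (x + y) = \<Lambda> x + \<Lambda> y" for x y
    unfolding \<Lambda>_def by (simp add: cinner_add_left matrix_vector_right_distrib)
  have \<Lambda>_scale: "\<Lambda> (c *s x) = c * \<Lambda> x" for c x
    unfolding \<Lambda>_def by (simp add: cinner_scale_left vector_scalar_commute algebra_simps)
  have \<phi>k: "1 - \<phi> (?e + x) $ k = - \<Lambda> x / (D + cinner x C)" if "D + cinner x C \<noteq> 0" for x
    unfolding \<phi>e \<Lambda>_def using that by (simp add: field_simps)
  have \<Lambda>e: "\<Lambda> ?e = D"
  proof -
    have d: "((\<lambda>t. (D + t * (A *v ?e) $ k) / (D + t * cinner ?e C)) has_field_derivative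
        ((A *v ?e) $ k * D - D * cinner ?e C) / (D * D)) (at 0)"
      using D by (auto intro!: derivative_eq_intros)
    have eq: "(\<lambda>t. \<phi> (?e + t *s ?e) $ k) = (\<lambda>t. (D + t * (A *v ?e) $ k) / (D + t * cinner ?e C))"
      by (simp add: \<phi>e cinner_scale_left vector_scalar_commute)
    have "((A *v ?e) $ k * D - D * cinner ?e C) / (D * D) = 1"
      using d der[unfolded eq] by (rule DERIV_unique)
    then have "(A *v ?e) $ k * D - D * cinner ?e C = D * D" using D by (simp add: divide_eq_eq)
    then have "D * \<Lambda> ?e = D * D" unfolding \<Lambda>_def by (simp add: algebra_simps)
    then show ?thesis using D by simp
  qed
  \<comment> \<open>Approach \<open>e\<close> along
    \<open>e - M \<epsilon>^2 e + \<epsilon> v\<close>: the tangential term is of lower order in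
    \<epsilon> and dominates \<open>1 - \<phi>_k\<close>, whose real part cannot be
    negative.\<close>
  have re: "Re (- \<Lambda> v / D) \<ge> 0" if v: "v $ k = 0" for v
  proof -
    \<comment> \<open>The inward displacement \<open>M \<epsilon>^2\<close> has to outweigh
      \<open>\<epsilon>^2 |v|^2\<close>; with this \<open>M\<close> the curve lies in the open ball
      as long as \<open>\<epsilon>^2 < 1 / M\<close>.\<close>
    define M where "M = 1 + (norm v)\<^sup>2"
    have M: "M \<ge> 1" unfolding M_def by simp
    \<comment> \<open>The quotient \<open>(1 - \<phi>_k) / \<epsilon>\<close> along the curve with
      the common factor cancelled, so that it is continuous at 0.\<close>
    let ?q = "\<lambda>\<epsilon>::real. (of_real (\<epsilon> * M) * \<Lambda> ?e - \<Lambda> v) / (D + (- of_real (M * \<epsilon>\<^sup>2) * cinner ?e C + of_real \<epsilon> * cinner v C))"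
    have pos: "Re (?q \<epsilon>) \<ge> 0" if \<epsilon>: "0 < \<epsilon>" "\<epsilon>\<^sup>2 < 1 / M" for \<epsilon> :: real
    proof -
      define x where "x = (- complex_of_real (M * \<epsilon>\<^sup>2)) *s ?e + complex_of_real \<epsilon> *s v"
      have xk: "x $ k = - complex_of_real (M * \<epsilon>\<^sup>2)" unfolding x_def using v by simp
      have xj: "x $ j = \<epsilon> * v $ j" if "j \<noteq> k" for j unfolding x_def using that by (simp add: axis_def)
      have "(norm (?e + x))\<^sup>2 = (cmod ((?e + x) $ k))\<^sup>2 + (\<Sum>j\<in>UNIV-{k}. (cmod ((?e + x) $ j))\<^sup>2)"
        by (rule norm_cvec_split)
      also have "(?e + x) $ k = complex_of_real (1 - M * \<epsilon>\<^sup>2)" by (simp add: xk)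
      also have "(cmod \<dots>)\<^sup>2 = (1 - M * \<epsilon>\<^sup>2)\<^sup>2" by (simp only: norm_of_real power2_abs)
      also have "(\<Sum>j\<in>UNIV-{k}. (cmod ((?e + x) $ j))\<^sup>2) = (\<Sum>j\<in>UNIV-{k}. \<epsilon>\<^sup>2 * (cmod (v $ j))\<^sup>2)"
        by (intro sum.cong) (auto simp: xj axis_def norm_mult power_mult_distrib)
      also have "\<dots> = \<epsilon>\<^sup>2 * (norm v)\<^sup>2"
        using norm_cvec_split[of v k] v by (simp add: sum_distrib_left)
      finally have "(norm (?e + x))\<^sup>2 = 1 - \<epsilon>\<^sup>2 * (2 * M - M * (M * \<epsilon>\<^sup>2) - (norm v)\<^sup>2)"
        by (simp add: power2_eq_square algebra_simps)
      moreover have "M * (M * \<epsilon>\<^sup>2) \<le> M * 1"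
        using \<epsilon> M by (intro mult_left_mono) (auto simp: field_simps)
      then have "2 * M - M * (M * \<epsilon>\<^sup>2) - (norm v)\<^sup>2 > 0" using M_def by linarith
      then have "\<epsilon>\<^sup>2 * (2 * M - M * (M * \<epsilon>\<^sup>2) - (norm v)\<^sup>2) > 0" using \<epsilon> by simp
      ultimately have "(norm (?e + x))\<^sup>2 < 1" by linarith
      then have ball: "?e + x \<in> unit_ball" by (simp add: power2_less_1_iff abs_square_less_1)
      then have "\<phi> (?e + x) \<in> unit_ball" using self by blast
      then have "cmod (\<phi> (?e + x) $ k) \<le> 1" using Finite_Cartesian_Product.norm_nth_le[of "\<phi> (?e + x)" k] by simp
      then have r: "Re (1 - \<phi> (?e + x) $ k) \<ge> 0" using complex_Re_le_cmod[of "\<phi> (?e + x) $ k"] by simp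
      have dn: "D + cinner x C \<noteq> 0" using nz[OF ball] by (simp add: den)
      have "\<Lambda> x = - of_real (M * \<epsilon>\<^sup>2) * \<Lambda> ?e + of_real \<epsilon> * \<Lambda> v"
        unfolding x_def by (simp only: \<Lambda>_add \<Lambda>_scale)
      moreover have "cinner x C = - of_real (M * \<epsilon>\<^sup>2) * cinner ?e C + of_real \<epsilon> * cinner v C"
        unfolding x_def by (simp only: cinner_add_left cinner_scale_left)
      ultimately have "1 - \<phi> (?e + x) $ k = of_real \<epsilon> * ?q \<epsilon>"
        unfolding \<phi>k[OF dn] times_divide_eq_right
        by (intro arg_cong2[where f = "(/)"]) (simp_all add: power2_eq_square algebra_simps)
      then have "Re (of_real \<epsilon> * ?q \<epsilon>) \<ge> 0" using r by simp
      then show ?thesis using \<epsilon> by (simp only: Re_complex_of_real Im_complex_of_real times_complex.sel) (simp add: zero_le_mult_iff)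
    qed
    have "((\<lambda>\<epsilon>. Re (?q \<epsilon>)) \<longlongrightarrow> Re ((of_real (0 * M) * \<Lambda> ?e - \<Lambda> v) / (D + (- of_real (M * 0\<^sup>2) * cinner ?e C + of_real 0 * cinner v C)))) (at_right 0)"
      by (intro tendsto_intros) (use D in auto)
    then have lim: "((\<lambda>\<epsilon>. Re (?q \<epsilon>)) \<longlongrightarrow> Re (- \<Lambda> v / D)) (at_right 0)" by simp
    have "((\<lambda>\<epsilon>::real. \<epsilon>\<^sup>2) \<longlongrightarrow> 0\<^sup>2) (at_right 0)" by (intro tendsto_intros)
    then have "eventually (\<lambda>\<epsilon>::real. \<epsilon>\<^sup>2 < 1 / M) (at_right 0)"
      by (rule order_tendstoD(2)) (use M in auto)
    moreover have "eventually (\<lambda>\<epsilon>::real. \<epsilon> > 0) (at_right 0)" by (rule eventually_at_right_less)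
    ultimately have "eventually (\<lambda>\<epsilon>. Re (?q \<epsilon>) \<ge> 0) (at_right 0)"
      by eventually_elim (rule pos)
    then show ?thesis by (rule tendsto_lowerbound[OF lim]) simp
  qed
  have \<Lambda>0: "\<Lambda> v = 0" if v: "v $ k = 0" for v
  proof -
    \<comment> \<open>The hyperplane is complex, so the inequality holds for all complex multiples
      of \<open>v\<close>; the multiples by 1, -1, \<open>\<i>\<close> and \<open>-\<i>\<close>
      force both parts of \<open>\<Lambda> v / D\<close> to be 0.\<close>
    have r: "Re (- (c * \<Lambda> v) / D) \<ge> 0" for c
      using re[of "c *s v"] v by (simp add: \<Lambda>_scale)
    have a: "Re (\<Lambda> v / D) = 0" using r[of 1] r[of "-1"] by simp
    have "Im (\<Lambda> v / D) = 0" using r[of \<i>] r[of "-\<i>"] by (simp add: times_divide_eq_right[symmetric] del: times_divide_eq_right)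
    with a have "\<Lambda> v / D = 0" by (simp add: complex_eq_iff)
    then show ?thesis using D by simp
  qed
  define L where "L u = cinner (u - ?e) C / D" for u
  define G where "G u = (\<chi> j. (A *v (u - ?e)) $ j / D)" for u
  have main: "1 / (1 - z $ k) + L (siegel k z) = (D + cinner (z - ?e) C) / ((1 - z $ k) * D)"
    "D + cinner (z - ?e) C \<noteq> 0" "\<Lambda> (z - ?e) = - ((1 - z $ k) * D)"
    "(A *v (z - ?e)) $ j = (1 - z $ k) * D * G (siegel k z) $ j" if z: "z \<in> unit_ball" for z j
  proof -
    have a: "1 - z $ k \<noteq> 0" by (rule unit_ball_nth_ne_1[OF z])
    note s = siegel_affine[OF z, of k]
    show "1 / (1 - z $ k) + L (siegel k z) = (D + cinner (z - ?e) C) / ((1 - z $ k) * D)"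
      unfolding L_def s cinner_scale_left using a D by (simp add: add_divide_distrib)
    show "D + cinner (z - ?e) C \<noteq> 0" using nz[OF z] den[of "z - ?e"] by simp
    show "(A *v (z - ?e)) $ j = (1 - z $ k) * D * G (siegel k z) $ j"
      unfolding G_def s vector_scalar_commute vector_smult_component vec_lambda_beta using D by (simp only: mult.assoc) (simp add: D)
    have "\<Lambda> (siegel k z + (-1) *s ?e) = 0 + -1 * D"
      unfolding \<Lambda>_add \<Lambda>_scale \<Lambda>e by (simp add: \<Lambda>0 siegel_def)
    then have "\<Lambda> (siegel k z - ?e) = - D" by (simp add: vector_sneg_minus1[symmetric])
    then show "\<Lambda> (z - ?e) = - ((1 - z $ k) * D)" unfolding s \<Lambda>_scale by (simp add: algebra_simps)
  qed
  show thesis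
  proof (rule that[of L G])
    have sub: "continuous_on UNIV (\<lambda>u. u - ?e)" by (intro continuous_intros)
    show "continuous_on UNIV L" unfolding L_def
      using continuous_on_compose2[OF continuous_on_cinner_left sub, of UNIV C]
      by (intro continuous_intros) (use D in auto)
    have "continuous_on UNIV (\<lambda>u. A *v (u - ?e))"
      using continuous_on_compose2[OF continuous_on_matrix_vector_mult sub, of UNIV A] by simp
    then show "continuous_on UNIV G" unfolding G_def
      by (intro continuous_intros) (use D in auto)
    fix z assume z: "z \<in> (unit_ball :: 'n cvec set)"
    have a: "1 - z $ k \<noteq> 0" by (rule unit_ball_nth_ne_1[OF z])
    note m = main[OF z]
    show "1 / (1 - z $ k) + L (siegel k z) \<noteq> 0" unfolding m(1) using m(2) a D by simp
    show "1 - \<phi> z $ k = 1 / (1 / (1 - z $ k) + L (siegel k z))"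
      using \<phi>k[OF m(2)] unfolding m(1,3) by simp
    show "\<phi> z $ j = G (siegel k z) $ j / (1 / (1 - z $ k) + L (siegel k z))" if "j \<noteq> k" for j
      using \<phi>e[of "z - ?e" j] that unfolding m(1) m(4)[of j] by simp
  qed
qed

section \<open>Test functions\<close>

lemma analytic_several_const: "analytic_several (\<lambda>z. c) S"
  unfolding analytic_several_def by (auto intro!: exI[of _ "\<lambda>_. 0"] derivative_eq_intros)

lemma analytic_several_nth: "analytic_several (\<lambda>z. z $ k) S"
  unfolding analytic_several_def
  by (intro ballI exI[of _ "\<lambda>z. z $ k"]) (auto intro: bounded_linear_imp_has_derivative bounded_linear_vec_nth)

lemma analytic_several_add:
  assumes "analytic_several f S" "analytic_several g S"
  shows "analytic_several (\<lambda>z. f z + g z) S"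
  unfolding analytic_several_def
proof
  fix z assume z: "z \<in> S"
  obtain L where L: "(f has_derivative L) (at z)" "\<forall>(c::complex) v. L (c *s v) = c * L v"
    using assms(1) z unfolding analytic_several_def by blast
  obtain M where M: "(g has_derivative M) (at z)" "\<forall>(c::complex) v. M (c *s v) = c * M v"
    using assms(2) z unfolding analytic_several_def by blast
  show "\<exists>L. ((\<lambda>z. f z + g z) has_derivative L) (at z) \<and> (\<forall>(c::complex) v. L (c *s v) = c * L v)"
    using has_derivative_add[OF L(1) M(1)] L(2) M(2)
    by (intro exI[of _ "\<lambda>x. L x + M x"]) (simp add: distrib_left)
qed

lemma analytic_several_mult:
  assumes "analytic_several f S" "analytic_several g S"
  shows "analytic_several (\<lambda>z. f z * g z) S"
  unfolding analytic_several_def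
proof
  fix z assume z: "z \<in> S"
  obtain L where L: "(f has_derivative L) (at z)" "\<forall>(c::complex) v. L (c *s v) = c * L v"
    using assms(1) z unfolding analytic_several_def by blast
  obtain M where M: "(g has_derivative M) (at z)" "\<forall>(c::complex) v. M (c *s v) = c * M v"
    using assms(2) z unfolding analytic_several_def by blast
  show "\<exists>L. ((\<lambda>z. f z * g z) has_derivative L) (at z) \<and> (\<forall>(c::complex) v. L (c *s v) = c * L v)"
    using has_derivative_mult[OF L(1) M(1)] L(2) M(2)
    by (intro exI[of _ "\<lambda>h. f z * M h + L h * g z"]) (simp add: algebra_simps)
qed

lemma analytic_several_inverse:
  assumes "analytic_several f S" "\<And>z. z \<in> S \<Longrightarrow> f z \<noteq> 0"
  shows "analytic_several (\<lambda>z. inverse (f z)) S"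
  unfolding analytic_several_def
proof
  fix z assume z: "z \<in> S"
  obtain L where L: "(f has_derivative L) (at z)" "\<forall>(c::complex) v. L (c *s v) = c * L v"
    using assms(1) z unfolding analytic_several_def by blast
  show "\<exists>L. ((\<lambda>z. inverse (f z)) has_derivative L) (at z) \<and> (\<forall>(c::complex) v. L (c *s v) = c * L v)"
    using Deriv.has_derivative_inverse[OF assms(2)[OF z] L(1)] L(2)
    by (intro exI[of _ "\<lambda>h. - (inverse (f z) * L h * inverse (f z))"]) simp
qed

lemma analytic_several_power:
  assumes "analytic_several f S"
  shows "analytic_several (\<lambda>z. f z ^ n) S"
  by (induction n) (auto intro: analytic_several_const analytic_several_mult assms)

lemma analytic_several_continuous_on:
  assumes "analytic_several f S"
  shows "continuous_on S f"
proof (rule continuous_at_imp_continuous_on, rule ballI)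
  fix z assume "z \<in> S"
  then obtain L where "(f has_derivative L) (at z)" using assms unfolding analytic_several_def by blast
  then show "isCont f z" by (rule has_derivative_continuous)
qed

section \<open>Peaking functions and their norms\<close>

definition bump :: "'n::finite \<Rightarrow> real \<Rightarrow> 'n cvec \<Rightarrow> complex" where
  "bump k t z = inverse (1 - \<i> / of_real t * (1 - z $ k))"

text \<open>Two families in one: \<open>c = 1\<close>, \<open>d = 0\<close> sees the shift of
  \<open>w\<close>, while \<open>c = 0\<close>, \<open>d = 1\<close> brings in a transverse
  coordinate. The recurring condition \<open>d = 0 \<or> j \<noteq> k\<close> says that the
  coordinate is indeed transverse.\<close>

definition test_fn :: "'n::finite \<Rightarrow> nat \<Rightarrow> real \<Rightarrow> complex \<Rightarrow> complex \<Rightarrow> 'n \<Rightarrow> real \<Rightarrow> 'n cvec \<Rightarrow> complex" where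
  "test_fn k m s c d j t z = of_real (t powr (real m - s)) * bump k t z ^ m * (c + d * bump k t z * z $ j)"

text \<open>The pole \<open>1 + \<i> t\<close> outside the disc is traded for the kernel parameter
  \<open>b = 1 / (1 + \<i> t)\<close> inside it, so that the kernel estimates apply.\<close>

lemma bump_denominator:
  assumes "t > 0"
  shows "1 - \<i> / of_real t * (1 - z $ k) = (- \<i> / of_real t) * (1 + \<i> * of_real t) * (1 - 1 / (1 + \<i> * of_real t) * z $ k)"
proof -
  have "1 + \<i> * of_real t \<noteq> 0" by (simp add: complex_eq_iff)
  then have "(1 + \<i> * of_real t) * (1 - 1 / (1 + \<i> * of_real t) * z $ k) = 1 + \<i> * of_real t - z $ k"
    by (simp add: right_diff_distrib)
  then show ?thesis using assms by (simp only: mult.assoc) (simp add: field_simps)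
qed

text \<open>The pole is at distance \<open>t\<close> from 1 but only about \<open>t^2 / 2\<close>
  from the disc. The bounds \<open>sqrt (1 + t^2) \<ge> 1 + t^2 / 3\<close> and
  \<open>1 / (1 + t^2 / 3) \<le> 1 - t^2 / 4\<close> are crude forms of this valid up to
  \<open>t = 1\<close>.\<close>

lemma pole_modulus:
  fixes t :: real assumes t: "0 < t" "t \<le> 1"
  shows "cmod (1 / (1 + \<i> * of_real t)) < 1" "t\<^sup>2 / 4 \<le> 1 - cmod (1 / (1 + \<i> * of_real t))"
    "1 \<le> cmod (1 + \<i> * of_real t)"
proof -
  define r where "r = cmod (1 + \<i> * of_real t)"
  have r: "r = sqrt (1 + t\<^sup>2)" unfolding r_def by (simp add: cmod_def)
  have t2: "0 < t\<^sup>2" "t\<^sup>2 \<le> 1" using t by (auto simp: power_le_one)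
  have "(1 + t\<^sup>2 / 3)\<^sup>2 = 1 + 2 / 3 * t\<^sup>2 + t\<^sup>2 * t\<^sup>2 / 9" by (simp add: power2_eq_square algebra_simps)
  also have "\<dots> \<le> 1 + t\<^sup>2" using mult_left_le[of "t\<^sup>2" "t\<^sup>2"] t2 by linarith
  finally have "1 + t\<^sup>2 / 3 \<le> r" unfolding r by (rule real_le_rsqrt)
  then have "1 / r \<le> 1 / (1 + t\<^sup>2 / 3)" using t2 by (intro frac_le) (auto intro: add_pos_pos)
  also have "\<dots> \<le> 1 - t\<^sup>2 / 4"
  proof -
    have "(1 - t\<^sup>2 / 4) * (1 + t\<^sup>2 / 3) = 1 + t\<^sup>2 * (1 - t\<^sup>2) / 12" by (simp add: field_simps)
    moreover have "t\<^sup>2 * (1 - t\<^sup>2) \<ge> 0" using t2 by simp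
    ultimately have "1 \<le> (1 - t\<^sup>2 / 4) * (1 + t\<^sup>2 / 3)" by simp
    moreover have "1 + t\<^sup>2 / 3 > 0" using t2 by linarith
    ultimately show ?thesis by (simp only: pos_divide_le_eq)
  qed
  finally have main: "t\<^sup>2 / 4 \<le> 1 - 1 / r" by simp
  show "t\<^sup>2 / 4 \<le> 1 - cmod (1 / (1 + \<i> * of_real t))" using main unfolding r_def by (simp add: norm_divide)
  then show "cmod (1 / (1 + \<i> * of_real t)) < 1" using t2 by linarith
  show "1 \<le> cmod (1 + \<i> * of_real t)" using \<open>1 + t\<^sup>2 / 3 \<le> r\<close> t2 unfolding r_def by linarith
qed

lemma bump_denominator_bounds:
  fixes z :: "'n::finite cvec"
  assumes t: "0 < t" "t \<le> 1" and z: "z \<in> unit_ball"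
  shows "1 - \<i> / of_real t * (1 - z $ k) \<noteq> 0"
    "cmod (bump k t z) \<le> t / cmod (1 - 1 / (1 + \<i> * of_real t) * z $ k)"
    "t\<^sup>2 / 4 \<le> cmod (1 - 1 / (1 + \<i> * of_real t) * z $ k)"
proof -
  define q where "q = cmod (1 - 1 / (1 + \<i> * of_real t) * z $ k)"
  note p = pole_modulus[OF t]
  have t2: "t\<^sup>2 > 0" using t by simp
  show q: "t\<^sup>2 / 4 \<le> cmod (1 - 1 / (1 + \<i> * of_real t) * z $ k)"
    using ball_kernel_bounds(1)[OF _ p(1), of z k] p(2) z by simp
  then have qpos: "q > 0" unfolding q_def using t2 by linarith
  have n: "cmod (1 - \<i> / of_real t * (1 - z $ k)) = 1 / t * cmod (1 + \<i> * of_real t) * q"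
    unfolding bump_denominator[OF t(1)] q_def norm_mult norm_divide norm_minus_cancel using t by simp
  moreover have ge: "1 / t * 1 * q \<le> 1 / t * cmod (1 + \<i> * of_real t) * q"
    using p(3) t qpos by (intro mult_right_mono mult_left_mono) auto
  moreover have pos: "1 / t * 1 * q > 0" using t qpos by simp
  ultimately show "1 - \<i> / of_real t * (1 - z $ k) \<noteq> 0" by (metis less_le_trans norm_eq_zero order_less_irrefl)
  have "cmod (bump k t z) = 1 / (1 / t * cmod (1 + \<i> * of_real t) * q)"
    unfolding bump_def norm_inverse n by (simp add: inverse_eq_divide)
  also have "\<dots> \<le> 1 / (1 / t * 1 * q)" by (rule frac_le[OF _ _ pos ge]) auto
  also have "\<dots> = t / q" by simp
  finally show "cmod (bump k t z) \<le> t / cmod (1 - 1 / (1 + \<i> * of_real t) * z $ k)" unfolding q_def .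
qed

lemma test_fn_analytic:
  assumes "0 < t" "t \<le> 1"
  shows "analytic_several (test_fn k m s c d j t) unit_ball"
proof -
  have "analytic_several (\<lambda>z. 1 + (- (\<i> / of_real t)) * (1 + (-1) * z $ k)) unit_ball"
    by (intro analytic_several_add analytic_several_mult analytic_several_const analytic_several_nth)
  then have "analytic_several (\<lambda>z. 1 - \<i> / of_real t * (1 - z $ k)) unit_ball" by simp
  then have b: "analytic_several (bump k t) unit_ball"
    unfolding bump_def by (rule analytic_several_inverse) (rule bump_denominator_bounds(1)[OF assms])
  then show ?thesis unfolding test_fn_def
    by (intro analytic_several_add analytic_several_mult analytic_several_const analytic_several_nth analytic_several_power)
qed

text \<open>\<open>|E| \<le> t / q\<close> gives the main factor. The extra factor is harmless
  because \<open>z_j\<close> is small where \<open>E\<close> is large: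
  \<open>|z_j|^2 \<le> 2 q\<close> and \<open>q \<ge> t^2 / 4\<close> yield
  \<open>|E z_j|^2 \<le> 2 t^2 / q \<le> 8\<close>, whence the 3.\<close>

lemma test_fn_bound:
  fixes z :: "'n::finite cvec"
  assumes t: "0 < t" "t \<le> 1" and z: "z \<in> unit_ball" and j: "d = 0 \<or> j \<noteq> k"
  shows "cmod (test_fn k m s c d j t z) \<le>
     (cmod c + 3 * cmod d) * t powr (2 * real m - s) / cmod (1 - 1 / (1 + \<i> * of_real t) * z $ k) ^ m"
proof -
  define q where "q = cmod (1 - 1 / (1 + \<i> * of_real t) * z $ k)"
  note p = pole_modulus[OF t]
  have t2: "t\<^sup>2 > 0" using t by simp
  have q: "t\<^sup>2 / 4 \<le> q" "cmod (bump k t z) \<le> t / q"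
    using bump_denominator_bounds[OF t z] unfolding q_def by auto
  have qpos: "q > 0" using q t2 by linarith
  have small: "cmod (d * bump k t z * z $ j) \<le> 3 * cmod d"
  proof (cases "d = 0")
    case False
    then have j': "j \<noteq> k" using j by simp
    have "(cmod (z $ j))\<^sup>2 \<le> (\<Sum>i\<in>UNIV-{k}. (cmod (z $ i))\<^sup>2)" using j' by (intro member_le_sum) auto
    also have "\<dots> \<le> 2 * q" using ball_kernel_bounds(3)[OF _ p(1), of z k] z unfolding q_def by simp
    finally have zj: "(cmod (z $ j))\<^sup>2 \<le> 2 * q" .
    have "(cmod (bump k t z * z $ j))\<^sup>2 = (cmod (bump k t z))\<^sup>2 * (cmod (z $ j))\<^sup>2"
      by (simp add: norm_mult power_mult_distrib)
    also have "\<dots> \<le> (t / q)\<^sup>2 * (2 * q)" using q zj by (intro mult_mono power_mono) auto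
    also have "\<dots> = 2 * t\<^sup>2 / q" using qpos by (simp add: power2_eq_square)
    also have "\<dots> \<le> 2 * t\<^sup>2 / (t\<^sup>2 / 4)" using q t2 qpos by (intro divide_left_mono) auto
    also have "\<dots> \<le> 3\<^sup>2" using t2 by simp
    finally have "cmod (bump k t z * z $ j) \<le> 3" by (rule power2_le_imp_le) simp
    then have "cmod d * cmod (bump k t z * z $ j) \<le> cmod d * 3" by (rule mult_left_mono) simp
    then show ?thesis by (simp add: norm_mult mult_ac)
  qed simp
  have "cmod (test_fn k m s c d j t z) = t powr (real m - s) * cmod (bump k t z) ^ m * cmod (c + d * bump k t z * z $ j)"
    unfolding test_fn_def by (simp add: norm_mult norm_power)
  also have "\<dots> \<le> t powr (real m - s) * (t / q) ^ m * (cmod c + 3 * cmod d)"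
    using q qpos t norm_triangle_ineq[of c "d * bump k t z * z $ j"] small
    by (intro mult_mono power_mono) auto
  also have "\<dots> = (cmod c + 3 * cmod d) * (t powr (real m - s) * t ^ m) / q ^ m"
    by (simp add: power_divide)
  also have "t powr (real m - s) * t ^ m = t powr (2 * real m - s)"
    using t by (simp add: powr_realpow[symmetric] powr_add[symmetric])
  finally show ?thesis unfolding q_def .
qed

text \<open>The normalising power is chosen for this: as \<open>1 - |b| \<ge> t^2 / 4\<close>, the
  square of \<open>t powr (2 m - s)\<close> cancels \<open>(t^2) powr (s - 2 m)\<close> and no power
  of \<open>t\<close> is left.\<close>

lemma test_fn_sqnorm_bounded:
  fixes Nsq :: "('n::finite cvec \<Rightarrow> complex) \<Rightarrow> ennreal"
  assumes Nsq: "space_exponent Nsq s" and m: "m > CARD('n)" "2 * real m \<ge> s + 1" and j: "d = 0 \<or> j \<noteq> k"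
  obtains M where "\<And>t. 0 < t \<Longrightarrow> t \<le> 1 \<Longrightarrow> Nsq (test_fn k m s c d j t) \<le> ennreal M"
proof -
  obtain C where C: "C > 0" "\<And>b K f. cmod b < 1 \<Longrightarrow> K \<ge> 0 \<Longrightarrow>
     (\<And>z. z \<in> unit_ball \<Longrightarrow> cmod (f z) \<le> K / cmod (1 - b * z $ k) ^ m) \<Longrightarrow>
     Nsq f \<le> ennreal (C * K\<^sup>2 * (1 - cmod b) powr (s - 2 * real m))"
    using sqnorm_le_of_kernel_bound[OF Nsq m, of k] by blast
  define A where "A = cmod c + 3 * cmod d"
  have A: "A \<ge> 0" unfolding A_def by simp
  show thesis
  proof (rule that[of "C * A\<^sup>2 * 4 powr (2 * real m - s)"])
    fix t :: real assume t: "0 < t" "t \<le> 1"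
    note p = pole_modulus[OF t]
    let ?b = "1 / (1 + \<i> * of_real t)"
    have "Nsq (test_fn k m s c d j t) \<le> ennreal (C * (A * t powr (2 * real m - s))\<^sup>2 * (1 - cmod ?b) powr (s - 2 * real m))"
      by (rule C(2)[OF p(1)]) (use A test_fn_bound[OF t _ j, where m = m and s = s and c = c] in \<open>auto simp: A_def\<close>)
    also have "\<dots> \<le> ennreal (C * A\<^sup>2 * 4 powr (2 * real m - s))"
    proof (rule ennreal_leI)
      have "(1 - cmod ?b) powr (s - 2 * real m) \<le> (t\<^sup>2 / 4) powr (s - 2 * real m)"
        using p(2) t m(2) by (intro powr_mono2') auto
      also have "\<dots> = 4 powr (2 * real m - s) * (t\<^sup>2) powr (s - 2 * real m)"
        using t powr_minus_divide[of 4 "2 * real m - s"] by (simp add: powr_divide powr_minus_divide[of 4] field_simps)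
      also have "(t\<^sup>2) powr (s - 2 * real m) = t powr (2 * (s - 2 * real m))"
        using t powr_powr[of t 2 "s - 2 * real m"] by (simp add: powr_numeral)
      finally have "(t powr (2 * real m - s))\<^sup>2 * (1 - cmod ?b) powr (s - 2 * real m)
          \<le> (t powr (2 * real m - s))\<^sup>2 * (4 powr (2 * real m - s) * t powr (2 * (s - 2 * real m)))"
        by (intro mult_left_mono) auto
      also have "(t powr (2 * real m - s))\<^sup>2 * (4 powr (2 * real m - s) * t powr (2 * (s - 2 * real m)))
         = 4 powr (2 * real m - s) * (t powr (2 * real m - s) * t powr (2 * real m - s) * t powr (2 * (s - 2 * real m)))"
        by (simp add: power2_eq_square mult_ac)
      also have "t powr (2 * real m - s) * t powr (2 * real m - s) * t powr (2 * (s - 2 * real m)) = 1"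
        using t by (simp add: powr_add[symmetric])
      finally have "C * A\<^sup>2 * ((t powr (2 * real m - s))\<^sup>2 * (1 - cmod ?b) powr (s - 2 * real m)) \<le> C * A\<^sup>2 * (4 powr (2 * real m - s) * 1)"
        using C by (intro mult_left_mono) auto
      then show "C * (A * t powr (2 * real m - s))\<^sup>2 * (1 - cmod ?b) powr (s - 2 * real m) \<le> C * A\<^sup>2 * 4 powr (2 * real m - s)"
        by (simp add: power_mult_distrib mult_ac)
    qed
    finally show "Nsq (test_fn k m s c d j t) \<le> ennreal (C * A\<^sup>2 * 4 powr (2 * real m - s))" .
  qed
qed

text \<open>At a fixed \<open>z\<close> the kernel denominator stays above \<open>1 - |z_k|\<close>,
  so the positive power \<open>t powr (2 m - s)\<close> decides.\<close>

lemma test_fn_tendsto_0: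
  fixes z :: "'n::finite cvec" and t :: "nat \<Rightarrow> real"
  assumes t: "\<And>i. 0 < t i" "\<And>i. t i \<le> 1" "t \<longlonglongrightarrow> 0" and z: "z \<in> unit_ball"
    and j: "d = 0 \<or> j \<noteq> k" and ms: "2 * real m > s"
  shows "(\<lambda>i. test_fn k m s c d j (t i) z) \<longlonglongrightarrow> 0"
proof -
  define r where "r = 1 - cmod (z $ k)"
  have r: "r > 0" unfolding r_def using z Finite_Cartesian_Product.norm_nth_le[of z k] by simp
  have b: "norm (test_fn k m s c d j (t i) z) \<le> (cmod c + 3 * cmod d) * t i powr (2 * real m - s) / r ^ m" for i
  proof -
    have "r \<le> cmod (1 - 1 / (1 + \<i> * of_real (t i)) * z $ k)"
      unfolding r_def using z by (intro ball_kernel_bounds(2) pole_modulus(1) t) auto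
    then have "r ^ m \<le> cmod (1 - 1 / (1 + \<i> * of_real (t i)) * z $ k) ^ m" using r by (intro power_mono) auto
    then have "(cmod c + 3 * cmod d) * t i powr (2 * real m - s) / cmod (1 - 1 / (1 + \<i> * of_real (t i)) * z $ k) ^ m
       \<le> (cmod c + 3 * cmod d) * t i powr (2 * real m - s) / r ^ m"
      using r by (intro divide_left_mono) (auto intro!: mult_pos_pos intro: less_le_trans[OF zero_less_power])
    then show ?thesis using test_fn_bound[OF t(1,2) z j, of m s c i] by linarith
  qed
  have "(\<lambda>i. t i powr (2 * real m - s)) \<longlonglongrightarrow> 0 powr (2 * real m - s)"
    by (rule tendsto_powr'[OF t(3) tendsto_const]) (use ms in \<open>auto simp: less_imp_le[OF t(1)]\<close>)
  then have "(\<lambda>i. (cmod c + 3 * cmod d) * t i powr (2 * real m - s) / r ^ m) \<longlonglongrightarrow> (cmod c + 3 * cmod d) * 0 powr (2 * real m - s) / r ^ m"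
    by (intro tendsto_divide tendsto_mult tendsto_const) (use r in auto)
  then have "(\<lambda>i. (cmod c + 3 * cmod d) * t i powr (2 * real m - s) / r ^ m) \<longlonglongrightarrow> 0" by simp
  then show ?thesis by (rule Lim_null_comparison[OF always_eventually, rotated]) (use b in auto)
qed

section \<open>Rescaled images near the boundary point\<close>

text \<open>The pullback of the test function by \<open>(w, u) \<mapsto> (w + L u, G u)\<close>, times \<open>t\<^sup>s\<close>, in the rescaled
  coordinate \<open>v\<close>: here \<open>u\<close> is the Siegel coordinate, \<open>e = w + L u - \<i> / t\<close> and \<open>\<i> / q = t w\<close>. Unlike the
  original expression it extends to \<open>t = 0\<close>.\<close>

definition limit_fn :: "'n::finite \<Rightarrow> nat \<Rightarrow> complex \<Rightarrow> complex \<Rightarrow> 'n \<Rightarrow> ('n cvec \<Rightarrow> complex) \<Rightarrow> ('n cvec \<Rightarrow> 'n cvec) \<Rightarrow>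
    'n cvec \<times> real \<Rightarrow> complex" where
  "limit_fn k m c d j L G = (\<lambda>(v, t). let q = 1 - \<i> * of_real t * v $ k;
      u = (\<chi> i. if i = k then 0 else \<i> * v $ i / q); e = - (v $ k) / q + L u
    in ((\<i> / q + of_real t * L u) / e) ^ m * (c + d * (G u $ j / e)))"

text \<open>The singular terms cancel exactly: \<open>1 - z_k = - \<i> t q\<close>, so
  \<open>w = \<i> / (t q)\<close> and \<open>w - \<i> / t = - v_k / q\<close>, which is bounded.
  Hence \<open>E = (w + L u) / e\<close> has size \<open>1 / t\<close>, and the part
  \<open>t^m\<close> of the prefactor \<open>t powr (m - s)\<close> compensates it.\<close>

lemma test_fn_rescaled:
  fixes \<phi> :: "'n::finite cvec \<Rightarrow> 'n cvec" and v :: "'n cvec"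
  assumes t: "t > 0" and j: "d = 0 \<or> j \<noteq> k"
    and z: "z = axis k (1 + \<i> * of_real t) + parabolic_dil k t v" "z \<in> unit_ball"
    and ne: "1 / (1 - z $ k) + L (siegel k z) \<noteq> 0"
    and \<phi>k: "1 - \<phi> z $ k = 1 / (1 / (1 - z $ k) + L (siegel k z))"
    and \<phi>j: "\<And>j. j \<noteq> k \<Longrightarrow> \<phi> z $ j = G (siegel k z) $ j / (1 / (1 - z $ k) + L (siegel k z))"
  shows "test_fn k m s c d j t (\<phi> z) = of_real (t powr (- s)) * limit_fn k m c d j L G (v, t)"
proof -
  define q where "q = 1 - \<i> * of_real t * v $ k"
  define u where "u = (\<chi> i. if i = k then 0 else \<i> * v $ i / q)"
  define e where "e = - (v $ k) / q + L u"
  define w where "w = 1 / (1 - z $ k)"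
  have T: "complex_of_real t \<noteq> 0" using t by simp
  have a: "1 - z $ k = - \<i> * of_real t * q"
    unfolding z(1) q_def parabolic_dil_def
    by (simp add: algebra_simps power2_eq_square scaleR_conv_of_real[where 'a=complex])
  have q: "q \<noteq> 0" using a unit_ball_nth_ne_1[OF z(2), of k] by auto
  have w: "of_real t * w = \<i> / q" unfolding w_def a using T q by (simp add: field_simps)
  have we: "w - \<i> / of_real t = - (v $ k) / q"
  proof -
    have "of_real t * q * (w - \<i> / of_real t) = q * (of_real t * w) - \<i> * q"
      using T by (simp add: algebra_simps)
    also have "\<dots> = \<i> - \<i> * q" unfolding w using q by simp
    also have "\<dots> = - of_real t * v $ k" by (simp add: q_def algebra_simps)
    finally show ?thesis using T q by (simp add: field_simps)
  qed
  have u: "siegel k z = u"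
  proof (rule vec_eq_iff[THEN iffD2], rule allI)
    fix i
    show "siegel k z $ i = u $ i"
    proof (cases "i = k")
      case False
      then have "z $ i = of_real t * v $ i" unfolding z(1) parabolic_dil_def
        by (simp add: axis_def scaleR_conv_of_real[where 'a=complex])
      then show ?thesis unfolding siegel_def u_def a using False T q by (simp add: field_simps)
    qed (simp add: siegel_def u_def)
  qed
  have wL: "w + L u \<noteq> 0" using ne unfolding w_def u .
  have b: "bump k t (\<phi> z) = (w + L u) / e"
  proof -
    have "1 - \<i> / of_real t * (1 - \<phi> z $ k) = (w + L u - \<i> / of_real t) / (w + L u)"
      unfolding \<phi>k w_def[symmetric] u using wL by (simp add: diff_divide_distrib)
    also have "w + L u - \<i> / of_real t = e" unfolding e_def we[symmetric] by simp
    finally show ?thesis unfolding bump_def by simp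
  qed
  have tb: "of_real t * bump k t (\<phi> z) = (\<i> / q + of_real t * L u) / e"
    unfolding b w[symmetric] by (simp add: distrib_left)
  have bj: "d * bump k t (\<phi> z) * \<phi> z $ j = d * (G u $ j / e)"
  proof (cases "d = 0")
    case False
    then have "\<phi> z $ j = G u $ j / (w + L u)" using \<phi>j[of j] j unfolding u w_def by simp
    then show ?thesis unfolding b using wL by simp
  qed simp
  have "complex_of_real (t powr (real m - s)) = of_real (t powr (- s)) * of_real t ^ m"
    using t by (simp add: powr_diff powr_minus_divide powr_realpow flip: of_real_power of_real_mult)
  then have "test_fn k m s c d j t (\<phi> z) = of_real (t powr (- s)) * ((of_real t * bump k t (\<phi> z)) ^ m * (c + d * bump k t (\<phi> z) * \<phi> z $ j))"
    unfolding test_fn_def by (simp add: power_mult_distrib mult_ac)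
  then show ?thesis unfolding tb bj limit_fn_def by (simp add: Let_def q_def u_def e_def cong: if_cong)
qed

text \<open>Continuity is joint in \<open>v\<close> and \<open>t\<close>, so a nonzero value at
  \<open>t = 0\<close> persists on one ball of \<open>v\<close> for all small \<open>t\<close>. At
  \<open>t = 0\<close> one has \<open>q = 1\<close>, and the hypothesis says that \<open>e\<close>
  does not vanish.\<close>

lemma isCont_limit_fn:
  fixes v0 :: "'n::finite cvec"
  assumes L: "continuous_on UNIV L" and G: "continuous_on UNIV G"
    and ne: "- (v0 $ k) + L (\<chi> i. if i = k then 0 else \<i> * v0 $ i) \<noteq> 0"
  shows "isCont (limit_fn k m c d j L G) (v0, 0)"
proof -
  let ?F = "at (v0, 0 :: real)"
  define q where "q x = 1 - \<i> * of_real (snd x) * fst x $ k" for x :: "'n cvec \<times> real"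
  define u where "u x = (\<chi> i. if i = k then 0 else \<i> * fst x $ i / q x)" for x :: "'n cvec \<times> real"
  define e where "e x = - (fst x $ k) / q x + L (u x)" for x
  have q0: "q (v0, 0) = 1" unfolding q_def by simp
  have u0: "u (v0, 0) = (\<chi> i. if i = k then 0 else \<i> * v0 $ i)" unfolding u_def q0 by (simp cong: if_cong)
  have e0: "e (v0, 0) \<noteq> 0" unfolding e_def q0 u0 using ne by simp
  have cq: "isCont q (v0, 0)" unfolding q_def by (intro continuous_intros)
  have cu: "isCont u (v0, 0)"
  proof -
    have "isCont (\<lambda>x. if i = k then 0 else \<i> * fst x $ i / q x) (v0, 0)" for i
      using cq q0 by (cases "i = k") (auto intro!: continuous_intros)
    then show ?thesis unfolding u_def isCont_def by (intro tendsto_vec_lambda) auto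
  qed
  have "isCont L y" for y using L by (simp add: continuous_on_eq_continuous_at)
  then have cL: "isCont (\<lambda>x. L (u x)) (v0, 0)" using cu by (rule isCont_o2[rotated])
  have "isCont G y" for y using G by (simp add: continuous_on_eq_continuous_at)
  then have cG: "isCont (\<lambda>x. G (u x)) (v0, 0)" using cu by (rule isCont_o2[rotated])
  have ce: "isCont e (v0, 0)" unfolding e_def using cq cL q0 by (auto intro!: continuous_intros)
  have "isCont (\<lambda>x. ((\<i> / q x + of_real (snd x) * L (u x)) / e x) ^ m * (c + d * (G (u x) $ j / e x))) (v0, 0)"
    using cq cL cG ce e0 q0 by (auto intro!: continuous_intros)
  moreover have "limit_fn k m c d j L G = (\<lambda>x. ((\<i> / q x + of_real (snd x) * L (u x)) / e x) ^ m * (c + d * (G (u x) $ j / e x)))"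
    unfolding limit_fn_def by (auto simp: fun_eq_iff Let_def q_def u_def e_def cong: if_cong)
  ultimately show ?thesis by simp
qed

lemma limit_fn_at_0:
  "limit_fn k m c d j L G (v, 0) = (\<i> / (- (v $ k) + L (\<chi> i. if i = k then 0 else \<i> * v $ i))) ^ m *
     (c + d * (G (\<chi> i. if i = k then 0 else \<i> * v $ i) $ j / (- (v $ k) + L (\<chi> i. if i = k then 0 else \<i> * v $ i))))"
  unfolding limit_fn_def by (simp add: Let_def cong: if_cong)

text \<open>At \<open>t = 0\<close> the bracket is the defining function
  \<open>2 Re w - 1 - |u|^2\<close> of the Siegel domain, with \<open>w = - v_k\<close> and
  \<open>|u_i| = |v_i|\<close>; the \<open>- 1\<close> stems from
  \<open>|1 + \<i> t|^2 = 1 + t^2\<close>.\<close>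

lemma one_minus_norm_sq_rescaled:
  fixes v :: "'n::finite cvec"
  shows "1 - (norm (axis k (1 + \<i> * of_real t) + parabolic_dil k t v))\<^sup>2
    = t\<^sup>2 * (- 1 - 2 * Re (v $ k) - 2 * t * Im (v $ k) - t\<^sup>2 * (cmod (v $ k))\<^sup>2 - (\<Sum>i\<in>UNIV-{k}. (cmod (v $ i))\<^sup>2))"
proof -
  let ?z = "axis k (1 + \<i> * of_real t) + parabolic_dil k t v"
  have "(norm ?z)\<^sup>2 = (cmod (?z $ k))\<^sup>2 + (\<Sum>i\<in>UNIV-{k}. (cmod (?z $ i))\<^sup>2)" by (rule norm_cvec_split)
  also have "(\<Sum>i\<in>UNIV-{k}. (cmod (?z $ i))\<^sup>2) = (\<Sum>i\<in>UNIV-{k}. t\<^sup>2 * (cmod (v $ i))\<^sup>2)"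
    by (intro sum.cong) (auto simp: parabolic_dil_def axis_def power_mult_distrib)
  also have "\<dots> = t\<^sup>2 * (\<Sum>i\<in>UNIV-{k}. (cmod (v $ i))\<^sup>2)" by (simp add: sum_distrib_left)
  also have "(cmod (?z $ k))\<^sup>2 = (1 + t\<^sup>2 * Re (v $ k))\<^sup>2 + (t + t\<^sup>2 * Im (v $ k))\<^sup>2"
    unfolding cmod_power2 by (simp add: parabolic_dil_def)
  finally show ?thesis unfolding cmod_power2 by (simp add: power2_eq_square algebra_simps)
qed

lemma parabolic_dil_inverse:
  "t \<noteq> 0 \<Longrightarrow> parabolic_dil k (1 / t) (parabolic_dil k t v) = v"
  "t \<noteq> 0 \<Longrightarrow> parabolic_dil k t (parabolic_dil k (1 / t) v) = v"
  by (auto simp: parabolic_dil_def vec_eq_iff power_divide)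

lemma continuous_on_parabolic_dil: "continuous_on S (parabolic_dil k t)"
proof -
  have "continuous_on S (\<lambda>v. if j = k then t\<^sup>2 *\<^sub>R v $ j else t *\<^sub>R v $ j)" for j
    by (cases "j = k") (auto intro!: continuous_intros)
  then show ?thesis unfolding parabolic_dil_def by (intro continuous_on_vec_lambda)
qed

lemma space_exponent_exists:
  fixes Nsq :: "('n::finite cvec \<Rightarrow> complex) \<Rightarrow> ennreal"
  assumes "Nsq = H2_sqnorm \<or> (\<exists>\<alpha>>-1. Nsq = A2_sqnorm \<alpha>)"
  obtains s where "space_exponent Nsq s"
  using assms unfolding space_exponent_def by blast

text \<open>\<open>Q\<close> is a dilated and translated ball, written as a preimage so that
  openness is immediate; its volume is the Jacobian times that of the ball.\<close>

lemma rescaled_region: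
  fixes v0 :: "'n::finite cvec" and k :: 'n
  assumes t: "t > 0" and \<epsilon>: "\<epsilon> > 0"
  defines "Q \<equiv> (\<lambda>z. parabolic_dil k (1 / t) (z - axis k (1 + \<i> * of_real t))) -` ball v0 \<epsilon>"
  shows "Q \<in> sets borel"
    "emeasure lborel Q = ennreal (measure lborel (ball v0 \<epsilon>) * t ^ (2 * CARD('n) + 2))"
    "z \<in> Q \<Longrightarrow> \<exists>v\<in>ball v0 \<epsilon>. z = axis k (1 + \<i> * of_real t) + parabolic_dil k t v"
proof -
  have "continuous_on UNIV (\<lambda>z. parabolic_dil k (1 / t) (z - axis k (1 + \<i> * of_real t)))"
    by (rule continuous_on_compose2[OF continuous_on_parabolic_dil]) (auto intro!: continuous_intros)
  then have "open Q" unfolding Q_def by (intro open_vimage) auto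
  then show Q[measurable]: "Q \<in> sets borel" by simp
  have ind: "indicator Q (axis k (1 + \<i> * of_real t) + parabolic_dil k t v) = (indicator (ball v0 \<epsilon>) v :: ennreal)" for v
    using t by (simp add: Q_def indicator_def parabolic_dil_inverse)
  have "emeasure lborel Q = (\<integral>\<^sup>+z. indicator Q z \<partial>lborel)" by simp
  also have "\<dots> = ennreal (t ^ (2 * CARD('n) + 2)) * (\<integral>\<^sup>+v. indicator Q (axis k (1 + \<i> * of_real t) + parabolic_dil k t v) \<partial>lborel)"
    by (rule nn_integral_parabolic_dil[OF _ t]) measurable
  also have "(\<integral>\<^sup>+v. indicator Q (axis k (1 + \<i> * of_real t) + parabolic_dil k t v) \<partial>lborel) = emeasure lborel (ball v0 \<epsilon>)"
    unfolding ind by simp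
  also have "\<dots> = ennreal (measure lborel (ball v0 \<epsilon>))"
    by (rule emeasure_eq_ennreal_measure) (metis emeasure_lborel_ball_finite infinity_ennreal_def less_irrefl)
  finally show "emeasure lborel Q = ennreal (measure lborel (ball v0 \<epsilon>) * t ^ (2 * CARD('n) + 2))"
    using t by (simp add: ennreal_mult mult.commute)
  assume "z \<in> Q"
  then show "\<exists>v\<in>ball v0 \<epsilon>. z = axis k (1 + \<i> * of_real t) + parabolic_dil k t v"
    using t unfolding Q_def
    by (intro bexI[of _ "parabolic_dil k (1 / t) (z - axis k (1 + \<i> * of_real t))"]) (auto simp: parabolic_dil_inverse)
qed

text \<open>Two consecutive exponents suffice: \<open>\<i> / A\<close> is determined by its powers of order \<open>M\<close> and \<open>M + 1\<close>.\<close>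

lemma separating_parameters:
  fixes A B :: complex and g h :: "'n \<Rightarrow> complex"
  assumes A: "A \<noteq> 0" and B: "B \<noteq> 0" and ne: "A \<noteq> B \<or> (\<exists>j. j \<noteq> k \<and> g j \<noteq> h j)"
  obtains m c d j where "m \<ge> (M::nat)" "d = 0 \<or> j \<noteq> k"
    "(\<i> / A) ^ m * (c + d * (g j / A)) \<noteq> (\<i> / B) ^ m * (c + d * (h j / B))"
proof (cases "A = B")
  case True
  then obtain j where "j \<noteq> k" "g j \<noteq> h j" using ne by blast
  then show thesis using A B True that[of M 1 j 0] by simp
next
  case False
  have "(\<i> / A) ^ M \<noteq> (\<i> / B) ^ M \<or> (\<i> / A) ^ Suc M \<noteq> (\<i> / B) ^ Suc M"
  proof (rule ccontr)
    assume *: "\<not> ?thesis"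
    then have "(\<i> / A) ^ M * (\<i> / A) = (\<i> / A) ^ M * (\<i> / B)" by (simp add: mult.commute)
    then have "\<i> / A = \<i> / B" using A by simp
    then show False using False A B by (simp add: field_simps)
  qed
  then show thesis using that[of M 0 k 1] that[of "Suc M" 0 k 1] by (auto simp del: power_Suc)
qed

section \<open>Contradiction with compactness\<close>

theorem theorem5:
  fixes \<phi> \<psi> :: "'n::finite cvec \<Rightarrow> 'n cvec"
    and k :: 'n
    and Nsq :: "('n cvec \<Rightarrow> complex) \<Rightarrow> ennreal"
  assumes "CARD('n) > 1"
    and "Nsq = H2_sqnorm \<or> (\<exists>\<alpha>>-1. Nsq = A2_sqnorm \<alpha>)"
    and "parabolic_lf_fixing k \<phi>"
    and "parabolic_lf_fixing k \<psi>"
    and "\<exists>z\<in>unit_ball. \<phi> z \<noteq> \<psi> z"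
  shows "\<not> compact_op Nsq (\<lambda>f z. f (\<phi> z) - f (\<psi> z))"
proof
  assume compact: "compact_op Nsq (\<lambda>f z. f (\<phi> z) - f (\<psi> z))"
  obtain s where s: "space_exponent Nsq s" using space_exponent_exists[OF assms(2)] .
  obtain L1 G1 where 1: "continuous_on UNIV L1" "continuous_on UNIV G1"
    and n1: "\<And>z. z \<in> unit_ball \<Longrightarrow> 1 / (1 - z $ k) + L1 (siegel k z) \<noteq> 0"
    "\<And>z. z \<in> unit_ball \<Longrightarrow> 1 - \<phi> z $ k = 1 / (1 / (1 - z $ k) + L1 (siegel k z))"
    "\<And>z j. z \<in> unit_ball \<Longrightarrow> j \<noteq> k \<Longrightarrow> \<phi> z $ j = G1 (siegel k z) $ j / (1 / (1 - z $ k) + L1 (siegel k z))"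
    using parabolic_lf_normal_form[OF assms(3)] by blast
  obtain L2 G2 where 2: "continuous_on UNIV L2" "continuous_on UNIV G2"
    and n2: "\<And>z. z \<in> unit_ball \<Longrightarrow> 1 / (1 - z $ k) + L2 (siegel k z) \<noteq> 0"
    "\<And>z. z \<in> unit_ball \<Longrightarrow> 1 - \<psi> z $ k = 1 / (1 / (1 - z $ k) + L2 (siegel k z))"
    "\<And>z j. z \<in> unit_ball \<Longrightarrow> j \<noteq> k \<Longrightarrow> \<psi> z $ j = G2 (siegel k z) $ j / (1 / (1 - z $ k) + L2 (siegel k z))"
    using parabolic_lf_normal_form[OF assms(4)] by blast
  obtain z1 where z1: "z1 \<in> unit_ball" "\<phi> z1 \<noteq> \<psi> z1" using assms(5) by blast
  \<comment> \<open>\<open>L\<close> and \<open>G\<close> see only \<open>u\<close>, so a point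
    where the maps differ fixes \<open>u0\<close> and leaves \<open>w\<close> free to be
    chosen.\<close>
  define u0 where "u0 = siegel k z1"
  have diff: "L1 u0 \<noteq> L2 u0 \<or> (\<exists>j. j \<noteq> k \<and> G1 u0 $ j \<noteq> G2 u0 $ j)"
  proof (rule ccontr)
    assume *: "\<not> ?thesis"
    have "\<phi> z1 $ j = \<psi> z1 $ j" for j
    proof (cases "j = k")
      case True
      have "1 - \<phi> z1 $ k = 1 - \<psi> z1 $ k" using n1(2)[OF z1(1)] n2(2)[OF z1(1)] * unfolding u0_def by simp
      then show ?thesis using True by simp
    next
      case False
      then show ?thesis using n1(3)[OF z1(1), of j] n2(3)[OF z1(1), of j] * unfolding u0_def by auto
    qed
    then show False using z1(2) by (simp add: vec_eq_iff)
  qed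
  \<comment> \<open>The limit of \<open>w - \<i> / t\<close> at the base point: large enough that
    \<open>2 x > 1 + |u0|^2\<close>, so that \<open>(x, u0)\<close> lies in the Siegel domain, and
    that the limits \<open>x + L1 u0\<close> and \<open>x + L2 u0\<close> of \<open>e\<close> cannot
    vanish.\<close>
  define x where "x = 1 + (norm u0)\<^sup>2 + cmod (L1 u0) + cmod (L2 u0)"
  have x: "x > 1 / 2 + (norm u0)\<^sup>2 / 2" unfolding x_def by (simp add: field_simps add_nonneg_nonneg add_pos_nonneg)
  have xL: "complex_of_real x + L1 u0 \<noteq> 0" "complex_of_real x + L2 u0 \<noteq> 0"
  proof -
    have a: "complex_of_real x + l \<noteq> 0" if "cmod l < x" for l
    proof
      assume "complex_of_real x + l = 0"
      then have "cmod l = cmod (complex_of_real x)" by (metis add_eq_0_iff norm_minus_cancel)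
      then show False using that by simp
    qed
    show "complex_of_real x + L1 u0 \<noteq> 0" "complex_of_real x + L2 u0 \<noteq> 0"
      by (rule a, simp add: x_def add_pos_nonneg add.assoc)+
  qed
  obtain M :: nat where M: "real M \<ge> real CARD('n) + 1 + \<bar>s\<bar>" using real_arch_simple by blast
  have diff': "complex_of_real x + L1 u0 \<noteq> complex_of_real x + L2 u0 \<or> (\<exists>j. j \<noteq> k \<and> G1 u0 $ j \<noteq> G2 u0 $ j)"
    using diff by simp
  obtain m c d j where m: "m \<ge> M" and dj: "d = 0 \<or> j \<noteq> k"
    and sep: "(\<i> / (complex_of_real x + L1 u0)) ^ m * (c + d * (G1 u0 $ j / (complex_of_real x + L1 u0)))
      \<noteq> (\<i> / (complex_of_real x + L2 u0)) ^ m * (c + d * (G2 u0 $ j / (complex_of_real x + L2 u0)))"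
    by (rule separating_parameters[OF xL diff', where M = M]) (rule that)
  have mreal: "real m \<ge> real CARD('n) + 1 + \<bar>s\<bar>" using M m by linarith
  then have ms: "m > CARD('n)" "2 * real m \<ge> s + 1" "2 * real m > s" by linarith+
  \<comment> \<open>Solved from the rescaled coordinates at \<open>t = 0\<close>, where
    \<open>w - \<i> / t\<close> is \<open>- v_k\<close> and \<open>u_i\<close> is
    \<open>\<i> v_i\<close>.\<close>
  define v0 where "v0 = (\<chi> i. if i = k then - complex_of_real x else - \<i> * u0 $ i)"
  have v0: "- (v0 $ k) = complex_of_real x" "(\<chi> i. if i = k then 0 else \<i> * v0 $ i) = u0"
    unfolding v0_def by (auto simp: vec_eq_iff u0_def siegel_def)
  define H where "H p = limit_fn k m c d j L1 G1 p - limit_fn k m c d j L2 G2 p" for p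
  have contH: "isCont H (v0, 0)"
    unfolding H_def using isCont_limit_fn[OF 1, of v0 k m c d j] isCont_limit_fn[OF 2, of v0 k m c d j] xL
    by (intro continuous_intros) (auto simp: v0)
  have H0: "H (v0, 0) \<noteq> 0" using sep unfolding H_def limit_fn_at_0 v0 by simp
  \<comment> \<open>\<open>K\<close> is \<open>(1 - |z|^2) / t^2\<close> in rescaled coordinates,
    and \<open>K (v0, 0) = 2 x - 1 - |u0|^2\<close>. Its positivity puts the region inside the ball
    at depth comparable with \<open>t^2\<close>.\<close>
  define K where "K = (\<lambda>p::'n cvec \<times> real. - 1 - 2 * Re (fst p $ k) - 2 * snd p * Im (fst p $ k)
     - (snd p)\<^sup>2 * (cmod (fst p $ k))\<^sup>2 - (\<Sum>i\<in>UNIV-{k}. (cmod (fst p $ i))\<^sup>2))"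
  have contK: "isCont K (v0, 0)" unfolding K_def by (intro continuous_intros isCont_Re isCont_Im)
  have K0: "K (v0, 0) > 0"
  proof -
    have "(\<Sum>i\<in>UNIV-{k}. (cmod (v0 $ i))\<^sup>2) = (\<Sum>i\<in>UNIV-{k}. (cmod (u0 $ i))\<^sup>2)"
      by (intro sum.cong) (auto simp: v0_def norm_mult)
    also have "\<dots> = (norm u0)\<^sup>2" using norm_cvec_split[of u0 k] by (simp add: u0_def siegel_def)
    finally show ?thesis using x unfolding K_def by (simp add: v0_def)
  qed
  have "eventually (\<lambda>p. cmod (H p) > cmod (H (v0, 0)) / 2 \<and> K p > K (v0, 0) / 2 \<and> K p < 2 * K (v0, 0)) (nhds (v0, 0))"
  proof (intro eventually_conj)
    have tH: "((\<lambda>p. cmod (H p)) \<longlongrightarrow> cmod (H (v0, 0))) (nhds (v0, 0))"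
      using contH by (intro tendsto_norm) (simp add: isCont_def tendsto_at_iff_tendsto_nhds)
    have tK: "(K \<longlongrightarrow> K (v0, 0)) (nhds (v0, 0))"
      using contK by (simp add: isCont_def tendsto_at_iff_tendsto_nhds)
    show "eventually (\<lambda>p. cmod (H p) > cmod (H (v0, 0)) / 2) (nhds (v0, 0))"
      by (rule order_tendstoD(1)[OF tH]) (use H0 in simp)
    show "eventually (\<lambda>p. K p > K (v0, 0) / 2) (nhds (v0, 0))" by (rule order_tendstoD(1)[OF tK]) (use K0 in simp)
    show "eventually (\<lambda>p. K p < 2 * K (v0, 0)) (nhds (v0, 0))" by (rule order_tendstoD(2)[OF tK]) (use K0 in simp)
  qed
  then obtain r where r: "r > 0" and near: "\<And>p. dist p (v0, 0) < r \<Longrightarrow>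
      cmod (H p) > cmod (H (v0, 0)) / 2 \<and> K p > K (v0, 0) / 2 \<and> K p < 2 * K (v0, 0)"
    unfolding eventually_nhds_metric by blast
  \<comment> \<open>Half of \<open>r\<close>, because the distance in the product is at most the sum
    of the two distances; the bound 1 keeps \<open>t\<close> in the range of the norm
    estimates.\<close>
  define \<epsilon> where "\<epsilon> = min 1 (r / 2)"
  have \<epsilon>: "\<epsilon> > 0" "\<epsilon> \<le> 1" using r unfolding \<epsilon>_def by auto
  have near': "cmod (H (v, t)) > cmod (H (v0, 0)) / 2 \<and> K (v, t) > K (v0, 0) / 2 \<and> K (v, t) < 2 * K (v0, 0)"
    if "v \<in> ball v0 \<epsilon>" "0 < t" "t < \<epsilon>" for v t
  proof (rule near)
    have "dist (v, t) (v0, 0) \<le> dist v v0 + dist t 0"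
      unfolding dist_Pair_Pair by (rule sqrt_sum_squares_le_sum) auto
    also have "\<dots> < \<epsilon> + \<epsilon>" using that by (intro add_strict_mono) (auto simp: dist_commute)
    also have "\<dots> \<le> r" unfolding \<epsilon>_def by simp
    finally show "dist (v, t) (v0, 0) < r" .
  qed
  define \<kappa> where "\<kappa> = cmod (H (v0, 0)) / 2"
  have \<kappa>: "\<kappa> > 0" using H0 unfolding \<kappa>_def by simp
  define c0 where "c0 = measure lborel (ball v0 \<epsilon>)"
  have c0: "c0 > 0" unfolding c0_def using content_ball_pos[OF \<epsilon>(1), of v0] by (simp add: measure_completion)
  obtain C where C: "C > 0" and lower: "\<And>t \<kappa> F Q. t > 0 \<Longrightarrow> \<kappa> \<ge> 0 \<Longrightarrow> Q \<in> sets borel \<Longrightarrow>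
      ennreal (c0 * t ^ (2 * CARD('n) + 2)) \<le> emeasure lborel Q \<Longrightarrow>
      (\<And>z. z \<in> Q \<Longrightarrow> K (v0, 0) / 2 * t\<^sup>2 \<le> 1 - (norm z)\<^sup>2 \<and> 1 - (norm z)\<^sup>2 \<le> 2 * K (v0, 0) * t\<^sup>2) \<Longrightarrow>
      (\<And>z. z \<in> Q \<Longrightarrow> \<kappa> \<le> cmod (F z)) \<Longrightarrow> ennreal (C * \<kappa>\<^sup>2 * t powr (2 * s)) \<le> Nsq F"
    using sqnorm_ge_of_lower_bound_on_set[OF s c0, of "K (v0, 0) / 2" "2 * K (v0, 0)"] K0 by auto
  let ?T = "\<lambda>f z. f (\<phi> z) - f (\<psi> z)"
  \<comment> \<open>On the region the image has modulus at least
    \<open>\<kappa> * t powr (- s)\<close>. Its square cancels the \<open>t powr (2 * s)\<close> of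
    the lower estimate, so the bound does not depend on \<open>t\<close>.\<close>
  have big: "ennreal (C * \<kappa>\<^sup>2) \<le> Nsq (?T (test_fn k m s c d j t))" if t: "0 < t" "t < \<epsilon>" for t
  proof -
    let ?Q = "(\<lambda>z. parabolic_dil k (1 / t) (z - axis k (1 + \<i> * of_real t))) -` ball v0 \<epsilon>"
    note R = rescaled_region[OF t(1) \<epsilon>(1), where k = k and ?v0.0 = v0]
    have "ennreal (C * (\<kappa> * t powr (- s))\<^sup>2 * t powr (2 * s)) \<le> Nsq (?T (test_fn k m s c d j t))"
    proof (rule lower[OF t(1)])
      show "0 \<le> \<kappa> * t powr (- s)" using \<kappa> by simp
      show "?Q \<in> sets borel" by (rule R(1))
      show "ennreal (c0 * t ^ (2 * CARD('n) + 2)) \<le> emeasure lborel ?Q" unfolding R(2) c0_def ..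
      fix z assume "z \<in> ?Q"
      then obtain v where v: "v \<in> ball v0 \<epsilon>" "z = axis k (1 + \<i> * of_real t) + parabolic_dil k t v"
        using R(3) by blast
      note nr = near'[OF v(1) t]
      have zK: "1 - (norm z)\<^sup>2 = t\<^sup>2 * K (v, t)" unfolding v(2) one_minus_norm_sq_rescaled K_def by simp
      have "K (v0, 0) / 2 * t\<^sup>2 \<le> K (v, t) * t\<^sup>2" "K (v, t) * t\<^sup>2 \<le> 2 * K (v0, 0) * t\<^sup>2"
        by (rule mult_right_mono; use nr in simp)+
      then show "K (v0, 0) / 2 * t\<^sup>2 \<le> 1 - (norm z)\<^sup>2 \<and> 1 - (norm z)\<^sup>2 \<le> 2 * K (v0, 0) * t\<^sup>2"
        unfolding zK by (simp add: mult.commute)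
      have "t\<^sup>2 * K (v, t) > 0" using nr K0 t by (intro mult_pos_pos) auto
      then have "(norm z)\<^sup>2 < 1" using zK by linarith
      then have ball: "z \<in> unit_ball" by (simp add: power2_less_1_iff abs_square_less_1)
      have "?T (test_fn k m s c d j t) z = of_real (t powr (- s)) * H (v, t)"
        unfolding H_def right_diff_distrib
        by (intro arg_cong2[where f = "(-)"] test_fn_rescaled[OF t(1) dj v(2) ball] n1[OF ball] n2[OF ball])
      then have "cmod (?T (test_fn k m s c d j t) z) = t powr (- s) * cmod (H (v, t))" by (simp add: norm_mult)
      moreover have "t powr (- s) * \<kappa> \<le> t powr (- s) * cmod (H (v, t))"
        using nr unfolding \<kappa>_def by (intro mult_left_mono) auto
      ultimately show "\<kappa> * t powr (- s) \<le> cmod (?T (test_fn k m s c d j t) z)" by (simp add: mult.commute)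
    qed
    also have "C * (\<kappa> * t powr (- s))\<^sup>2 * t powr (2 * s) = C * \<kappa>\<^sup>2 * (t powr (- s) * t powr (- s) * t powr (2 * s))"
      by (simp add: power_mult_distrib power2_eq_square)
    also have "t powr (- s) * t powr (- s) * t powr (2 * s) = 1" using t by (simp add: powr_add[symmetric])
    finally show ?thesis by simp
  qed
  \<comment> \<open>The offset 2 makes \<open>t i < \<epsilon>\<close> strict already at
    \<open>i = 0\<close>.\<close>
  define t where "t i = \<epsilon> / real (i + 2)" for i
  have t: "0 < t i" "t i < \<epsilon>" "t i \<le> 1" for i
  proof -
    show "0 < t i" unfolding t_def using \<epsilon> by simp
    have "\<epsilon> * 1 < \<epsilon> * real (i + 2)" using \<epsilon> by (intro mult_strict_left_mono) auto
    then show "t i < \<epsilon>" unfolding t_def by (simp add: divide_less_eq)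
    then show "t i \<le> 1" using \<epsilon> by simp
  qed
  have tlim: "t \<longlonglongrightarrow> 0"
    unfolding t_def by (rule LIMSEQ_ignore_initial_segment[OF lim_const_over_n])
  obtain B where B: "\<And>t. 0 < t \<Longrightarrow> t \<le> 1 \<Longrightarrow> Nsq (test_fn k m s c d j t) \<le> ennreal B"
    using test_fn_sqnorm_bounded[OF s ms(1,2) dj] by blast
  define fs where "fs i = test_fn k m s c d j (t i)" for i
  have an: "analytic_several (fs i) unit_ball" for i
    unfolding fs_def by (rule test_fn_analytic[OF t(1,3)])
  have "\<forall>i. fs i \<in> fspace Nsq"
    unfolding fspace_def using an le_less_trans[OF B[OF t(1,3)] ennreal_less_top] by (simp add: fs_def)
  moreover have "\<exists>M::ennreal. M < top \<and> (\<forall>i. Nsq (fs i) \<le> M)"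
    unfolding fs_def using B[OF t(1,3)] by (intro exI[of _ "ennreal B"]) auto
  ultimately obtain \<rho> g where \<rho>: "strict_mono \<rho>" and g: "g \<in> fspace Nsq"
    and lim: "(\<lambda>i. Nsq (?T (fs (\<rho> i)) - g)) \<longlonglongrightarrow> 0"
    using compact unfolding compact_op_def by blast
  have lf: "lf_selfmap \<phi>" "lf_selfmap \<psi>" using assms(3,4) unfolding parabolic_lf_fixing_def by auto
  then have self: "\<phi> ` unit_ball \<subseteq> unit_ball" "\<psi> ` unit_ball \<subseteq> unit_ball" unfolding lf_selfmap_def by blast+
  \<comment> \<open>Pointwise the images tend to 0, since \<open>\<phi> z\<close> and
    \<open>\<psi> z\<close> are fixed points of the open ball while the test functions vary; this
    identifies the norm limit and contradicts \<open>big\<close>.\<close>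
  have "(\<lambda>i. Nsq (?T (fs (\<rho> i)))) \<longlonglongrightarrow> 0"
  proof (rule sqnorm_tendsto_0_of_pointwise[OF s _ _ _ lim])
    show "continuous_on unit_ball (?T (fs (\<rho> i)))" for i
      using continuous_on_compose2[OF analytic_several_continuous_on[OF an] lf_selfmap_continuous_on[OF lf(1)] self(1)]
        continuous_on_compose2[OF analytic_several_continuous_on[OF an] lf_selfmap_continuous_on[OF lf(2)] self(2)]
      by (intro continuous_on_diff)
    show "continuous_on unit_ball g" using g unfolding fspace_def by (auto intro: analytic_several_continuous_on)
    fix z :: "'n cvec" assume "z \<in> unit_ball"
    then have z: "\<phi> z \<in> unit_ball" "\<psi> z \<in> unit_ball" using self by blast+
    have tr: "(\<lambda>i. t (\<rho> i)) \<longlonglongrightarrow> 0" using LIMSEQ_subseq_LIMSEQ[OF tlim \<rho>] by (simp add: comp_def)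
    have "(\<lambda>i. fs (\<rho> i) (\<phi> z) - fs (\<rho> i) (\<psi> z)) \<longlonglongrightarrow> 0 - 0"
      unfolding fs_def
      by (intro tendsto_diff test_fn_tendsto_0[OF t(1) t(3) tr z(1) dj ms(3)] test_fn_tendsto_0[OF t(1) t(3) tr z(2) dj ms(3)])
    then show "(\<lambda>i. fs (\<rho> i) (\<phi> z) - fs (\<rho> i) (\<psi> z)) \<longlonglongrightarrow> 0" by simp
  qed
  then have "ennreal (C * \<kappa>\<^sup>2) \<le> 0"
    by (rule tendsto_lowerbound) (auto intro!: always_eventually big t simp: fs_def)
  then show False using C \<kappa> by simp
qed

end
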